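(* Let $K$ be a field given with a localization set $\mathcal M$, let $B$ be a smooth projective and geometrically integral $K$-variety, and let $F/K(B)$ be a (possibly infinite) Galois extension with the Tchebotarev existence property with respect to $\mathcal M$. Assume that the $\mathcal M$-local degrees of $F/K(B)$ are uniformly bounded and that $G=\mathrm{Gal}(F/K(B))$ is abelian. Then $F\subset K(B)^{(d)}$ for some integer $d\ge 1$.
   Context: For an integer $d\geq 1$, $K(B)^{(d)}$ is the compositum (in a fixed algebraic closure) of all finite extensions of $K(B)$ of degree $\leq d$. Localization sets and local fields. A localization set $\mathcal M$ of a field $K$ is a set of places of $K$, i.e. of equivalence classes of discrete valuations on $K$; the trivial valuation, denoted $0$, is allowed, and its completion is $K_0=K$. An $\mathcal M$-local field over $K$ is a finite extension $k_v$ of the completion $K_v$ of $K$ at some $v\in\mathcal M$, equipped with the unique prolongation of $v$. When $v$ is trivial, the local fields are the finite extensions of $K$ and all finite extensions of $k_v$ are considered unramified. Specializations. Let $F/K(B)$ be Galois (possibly infinite) of group $G$, $k\supset K$ an overfield and $t_0\in B(k)$. Let $Fk/k(B)$ be the extension obtained by scalar extension. If $\mathrm{Spec}(A)$ is an affine neighborhood of $t_0$ in $B\otimes_K k$ and $A'$ is the integral closure of $A$ in $Fk$, then $(Fk)_{t_0}/k$ denotes the residue extension of $A'/A$ at some prime above the maximal ideal of $t_0$. It is a normal extension, well-defined up to conjugation by elements of $G$. For an $\mathcal M$-local field $k_v$ and $t_0\in B(k_v)$, the degree $[(Fk_v)_{t_0}:k_v]$ (a supernatural number if infinite) is called an $\mathcal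 M$-local degree of $F/K(B)$. These are uniformly bounded if they are all finite and bounded by a constant independent of $k_v$, $v$ and $t_0$. Branch locus, Frobenius subgroups. The branch locus $D$ is the formal sum of all hypersurfaces of $B\otimes_K K^{\rm sep}$ whose associated discrete valuations are ramified in $FK^{\rm sep}/K^{\rm sep}(B)$ (for infinite $F/K(B)$, an inductive limit of effective divisors). For $t_0\in B(k_v)\setminus D$, the Frobenius subgroup of $F/K(B)$ at $t_0$ over $k_v$ is $\mathrm{Gal}((Fk_v)_{t_0}/k_v)$, a subgroup of $G$ well-defined up to conjugation; $t_0$ is $k_v$-unramified for $F/K(B)$ if $(Fk_v)_{t_0}/k_v$ is unramified. Tchebotarev existence property. A finite Galois extension $F/K(B)$ of group $G$ has the Tchebotarev existence property with respect to $\mathcal M$ if for every $g\in G$ there exist an $\mathcal M$-local field $k_v$ over $K$ and a point $t_0\in B(k_v)\setminus D$, $k_v$-unramified for $F/K(B)$, such that the Frobenius subgroup of $F/K(B)$ at $t_0$ over $k_v$ is cyclic and conjugate to $\langle g\rangle$ in $G$. A possibly infinite Galois extension has this property if it is the union of an increasing sequence of finite Galois extensions $F_n/K(B)$ that all have it. *)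

theory Defs
  imports
    "HOL-Algebra.Algebraic_Closure"
    "HOL-Algebra.Generated_Fields"
    "HOL-Algebra.Elementary_Groups"
    "HOL-Algebra.Bij"
begin

text \<open>
  Fields are subfields of an ambient field record, as usual in HOL-Algebra: \<open>K\<close>, the function field
  \<open>K(B)\<close> and \<open>F\<close> are subfields of a fixed algebraic closure \<open>C :: 'a ring\<close> of \<open>K(B)\<close>.
  The local fields \<open>k\<close> vary and so does the field \<open>k(B)\<close>; they are subfields of algebraically
  closed fields \<open>\<Omega> :: (nat \<Rightarrow> 'a) ring\<close>. That type is large enough: a completion of \<open>K\<close> consists of
  limits of sequences in \<open>K\<close>, and finite extensions, finitely generated extensions and (\<open>'a\<close> being
  infinite) algebraic closures do not increase the cardinality further. So, up to isomorphism, every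
  local field \<open>k\<close> and every algebraic closure of \<open>k(B)\<close> occurs.
\<close>


section \<open>Homogeneous polynomials and projective varieties\<close>

text \<open>
  \<open>K[x\<^sub>0,\<dots>,x\<^sub>n]\<close> on the library's indexed polynomials, which come without a product: a polynomial maps
  a monomial, i.e. a multiset of indices, to its coefficient.
\<close>

definition mpoly_ring :: "'a ring \<Rightarrow> 'a set \<Rightarrow> nat \<Rightarrow> (nat multiset \<Rightarrow> 'a) ring" where
  "mpoly_ring R K n =
     \<lparr>carrier = ring.indexed_pset R {..n} K,
      monoid.mult = (\<lambda>p q m. \<Oplus>\<^bsub>R\<^esub>a\<in>{a. a \<subseteq># m}. p a \<otimes>\<^bsub>R\<^esub> q (m - a)),
      one = ring.indexed_const R \<one>\<^bsub>R\<^esub>,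
      zero = ring.indexed_const R \<zero>\<^bsub>R\<^esub>,
      add = ring.indexed_padd R\<rparr>"

definition meval :: "'a ring \<Rightarrow> (nat multiset \<Rightarrow> 'a) \<Rightarrow> (nat \<Rightarrow> 'a) \<Rightarrow> 'a" where
  "meval R p x = (\<Oplus>\<^bsub>R\<^esub>m\<in>{m. p m \<noteq> \<zero>\<^bsub>R\<^esub>}.
     p m \<otimes>\<^bsub>R\<^esub> (\<Otimes>\<^bsub>R\<^esub>i\<in>set_mset m. x i [^]\<^bsub>R\<^esub> count m i))"

definition mpderiv :: "'a ring \<Rightarrow> nat \<Rightarrow> (nat multiset \<Rightarrow> 'a) \<Rightarrow> (nat multiset \<Rightarrow> 'a)" where
  "mpderiv R j p = (\<lambda>m. [Suc (count m j)] \<cdot>\<^bsub>R\<^esub> p (add_mset j m))"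

definition homog :: "'a ring \<Rightarrow> 'a set \<Rightarrow> nat \<Rightarrow> nat \<Rightarrow> (nat multiset \<Rightarrow> 'a) set" where
  "homog R K n d = {p \<in> carrier (mpoly_ring R K n). \<forall>m. p m \<noteq> \<zero>\<^bsub>R\<^esub> \<longrightarrow> size m = d}"

text \<open>Integral closed subschemes of projective \<open>n\<close>-space over \<open>K\<close>, as relevant homogeneous primes.\<close>

definition homog_prime :: "'a ring \<Rightarrow> 'a set \<Rightarrow> nat \<Rightarrow> (nat multiset \<Rightarrow> 'a) set \<Rightarrow> bool" where
  "homog_prime R K n J \<longleftrightarrow>
     primeideal J (mpoly_ring R K n) \<and>
     (\<forall>p\<in>J. \<forall>d. (\<lambda>m. if size m = d then p m else \<zero>\<^bsub>R\<^esub>) \<in> J) \<and>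
     (\<exists>i\<le>n. ring.indexed_var R i \<notin> J)"

text \<open>The ideal of the base change along \<open>\<iota>\<close> to the subfield \<open>k\<close> of \<open>S\<close>.\<close>

definition base_change ::
  "('a \<Rightarrow> 'b) \<Rightarrow> 'b ring \<Rightarrow> 'b set \<Rightarrow> nat \<Rightarrow> (nat multiset \<Rightarrow> 'a) set \<Rightarrow> (nat multiset \<Rightarrow> 'b) set" where
  "base_change \<iota> S k n I = genideal (mpoly_ring S k n) ((\<circ>) \<iota> ` I)"

text \<open>\<open>k\<close>-rational points of the subscheme with ideal \<open>J\<close>, by homogeneous coordinates.\<close>

definition proj_point ::
  "'a ring \<Rightarrow> 'a set \<Rightarrow> nat \<Rightarrow> (nat multiset \<Rightarrow> 'a) set \<Rightarrow> (nat \<Rightarrow> 'a) \<Rightarrow> bool" where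
  "proj_point R k n J t \<longleftrightarrow>
     (\<forall>i\<le>n. t i \<in> k) \<and> (\<exists>i\<le>n. t i \<noteq> \<zero>\<^bsub>R\<^esub>) \<and>
     (\<forall>d. \<forall>f\<in>homog R k n d. f \<in> J \<longrightarrow> meval R f t = \<zero>\<^bsub>R\<^esub>)"

definition geom_integral :: "'a ring \<Rightarrow> 'a set \<Rightarrow> nat \<Rightarrow> (nat multiset \<Rightarrow> 'a) set \<Rightarrow> bool" where
  "geom_integral R K n I \<longleftrightarrow>
     (\<forall>(S :: (nat \<Rightarrow> 'a) ring) \<iota>. field S \<and> \<iota> \<in> ring_hom (R\<lparr>carrier := K\<rparr>) S \<longrightarrow>
        homog_prime S (carrier S) n (base_change \<iota> S (carrier S) n I))"

text \<open>
  Smoothness at every (geometric) point \<open>P\<close>: near \<open>P\<close> the ideal is generated by some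
  \<open>g\<^sub>1,\<dots>,g\<^sub>r\<close> with linearly independent differentials at \<open>P\<close>. By Euler's relation the
  homogeneous gradients at \<open>P\<close> have the same rank as the gradients in an affine chart.
\<close>

definition smooth :: "'a ring \<Rightarrow> 'a set \<Rightarrow> nat \<Rightarrow> (nat multiset \<Rightarrow> 'a) set \<Rightarrow> bool" where
  "smooth R K n I \<longleftrightarrow>
     (\<forall>(S :: (nat \<Rightarrow> 'a) ring) \<iota> P.
        field S \<and> \<iota> \<in> ring_hom (R\<lparr>carrier := K\<rparr>) S \<and>
        proj_point S (carrier S) n (base_change \<iota> S (carrier S) n I) P \<longrightarrow>
        (\<exists>gs. set gs \<subseteq> I \<inter> (\<Union>d. homog R K n d) \<and>
           (\<forall>d. \<forall>f\<in>I \<inter> homog R K n d. \<exists>e. \<exists>h\<in>homog R K n e.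
              meval S (\<iota> \<circ> h) P \<noteq> \<zero>\<^bsub>S\<^esub> \<and>
              h \<otimes>\<^bsub>mpoly_ring R K n\<^esub> f \<in> genideal (mpoly_ring R K n) (set gs)) \<and>
           (\<forall>c. (\<forall>l<length gs. c l \<in> carrier S) \<and>
                (\<forall>j\<le>n. (\<Oplus>\<^bsub>S\<^esub>l\<in>{..<length gs}. c l \<otimes>\<^bsub>S\<^esub> meval S (\<iota> \<circ> mpderiv R j (gs ! l)) P)
                        = \<zero>\<^bsub>S\<^esub>) \<longrightarrow>
                (\<forall>l<length gs. c l = \<zero>\<^bsub>S\<^esub>))))"

definition smooth_projective_variety ::
  "'a ring \<Rightarrow> 'a set \<Rightarrow> nat \<Rightarrow> (nat multiset \<Rightarrow> 'a) set \<Rightarrow> bool" where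
  "smooth_projective_variety R K n I \<longleftrightarrow>
     homog_prime R K n I \<and> geom_integral R K n I \<and> smooth R K n I"

text \<open>
  \<open>x\<close> is a tuple of homogeneous coordinates of a generic point of the variety over \<open>k\<close> with ideal \<open>J\<close>.
  Then \<open>f/g \<mapsto> f(x)/g(x)\<close> (\<open>f\<close>, \<open>g\<close> homogeneous of the same degree, \<open>g \<notin> J\<close>) identifies the function
  field of the variety with the subfield \<open>function_field R k n x\<close> of \<open>R\<close>, the degree-zero part of
  \<open>(k[x\<^sub>0,\<dots>,x\<^sub>n]/J)[1/x\<^sub>i]\<close> with \<open>chart_ring R k n x i\<close>, and the local ring along the subvariety
  with ideal \<open>H\<close> with \<open>local_ring R k n x H\<close>.
\<close>

definition generic_point ::
  "'a ring \<Rightarrow> 'a set \<Rightarrow> nat \<Rightarrow> (nat multiset \<Rightarrow> 'a) set \<Rightarrow> (nat \<Rightarrow> 'a) \<Rightarrow> bool" where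
  "generic_point R k n J x \<longleftrightarrow>
     (\<forall>i\<le>n. x i \<in> carrier R) \<and>
     (\<forall>d. \<forall>f\<in>homog R k n d. meval R f x = \<zero>\<^bsub>R\<^esub> \<longleftrightarrow> f \<in> J)"

definition function_field :: "'a ring \<Rightarrow> 'a set \<Rightarrow> nat \<Rightarrow> (nat \<Rightarrow> 'a) \<Rightarrow> 'a set" where
  "function_field R k n x =
     {meval R f x \<otimes>\<^bsub>R\<^esub> inv\<^bsub>R\<^esub> (meval R g x) | f g d.
        f \<in> homog R k n d \<and> g \<in> homog R k n d \<and> meval R g x \<noteq> \<zero>\<^bsub>R\<^esub>}"

definition local_ring ::
  "'a ring \<Rightarrow> 'a set \<Rightarrow> nat \<Rightarrow> (nat \<Rightarrow> 'a) \<Rightarrow> (nat multiset \<Rightarrow> 'a) set \<Rightarrow> 'a set" where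
  "local_ring R k n x H =
     {meval R f x \<otimes>\<^bsub>R\<^esub> inv\<^bsub>R\<^esub> (meval R g x) | f g d.
        f \<in> homog R k n d \<and> g \<in> homog R k n d \<and> g \<notin> H}"

definition chart_ring :: "'a ring \<Rightarrow> 'a set \<Rightarrow> nat \<Rightarrow> (nat \<Rightarrow> 'a) \<Rightarrow> nat \<Rightarrow> 'a set" where
  "chart_ring R k n x i =
     {meval R f x \<otimes>\<^bsub>R\<^esub> inv\<^bsub>R\<^esub> (x i [^]\<^bsub>R\<^esub> d) | f d. f \<in> homog R k n d}"

definition chart_max_ideal ::
  "'a ring \<Rightarrow> 'a set \<Rightarrow> nat \<Rightarrow> (nat \<Rightarrow> 'a) \<Rightarrow> nat \<Rightarrow> (nat \<Rightarrow> 'a) \<Rightarrow> 'a set" where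
  "chart_max_ideal R k n x i t =
     {meval R f x \<otimes>\<^bsub>R\<^esub> inv\<^bsub>R\<^esub> (x i [^]\<^bsub>R\<^esub> d) | f d. f \<in> homog R k n d \<and> meval R f t = \<zero>\<^bsub>R\<^esub>}"


section \<open>Field extensions\<close>

definition separable_over :: "'a ring \<Rightarrow> 'a set \<Rightarrow> 'a \<Rightarrow> bool" where
  "separable_over R K x \<longleftrightarrow>
     (ring.algebraic R over K) x \<and> ring.alg_mult R (ring.Irr R K x) x = 1"

definition sep_closure :: "'a ring \<Rightarrow> 'a set \<Rightarrow> 'a set" where
  "sep_closure C K = {x \<in> carrier C. separable_over C K x}"

text \<open>Here \<open>C\<close> is algebraically closed, so the last conjunct is normality.\<close>

definition galois_ext :: "'a ring \<Rightarrow> 'a set \<Rightarrow> 'a set \<Rightarrow> bool" where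
  "galois_ext C N F \<longleftrightarrow>
     subfield N C \<and> subfield F C \<and> N \<subseteq> F \<and>
     (\<forall>x\<in>F. separable_over C N x) \<and>
     (\<forall>x\<in>F. \<forall>y\<in>carrier C. ring.eval C (ring.Irr C N x) y = \<zero>\<^bsub>C\<^esub> \<longrightarrow> y \<in> F)"

text \<open>Automorphisms of the subfield \<open>L\<close> of \<open>R\<close> over \<open>k\<close>.\<close>

definition gal_group :: "'a ring \<Rightarrow> 'a set \<Rightarrow> 'a set \<Rightarrow> ('a \<Rightarrow> 'a) monoid" where
  "gal_group R L k = BijGroup L
     \<lparr>carrier := {\<sigma> \<in> Bij L. \<sigma> \<in> ring_hom (R\<lparr>carrier := L\<rparr>) (R\<lparr>carrier := L\<rparr>) \<and> (\<forall>x\<in>k. \<sigma> x = x)}\<rparr>"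

definition bounded_degree_compositum :: "'a ring \<Rightarrow> 'a set \<Rightarrow> nat \<Rightarrow> 'a set" where
  "bounded_degree_compositum C N d =
     generate_field C (\<Union>{E. subfield E C \<and> N \<subseteq> E \<and>
       (ring.finite_dimension C over N) E \<and> (ring.dim C over N) E \<le> d})"


section \<open>Discrete valuations, completions and local fields\<close>

text \<open>
  A valuation on \<open>L\<close> is a function into \<open>int\<close> of which only the values on nonzero elements of \<open>L\<close>
  matter. The trivial valuation is included, and the value group need not be all of \<open>int\<close>.
\<close>

definition discrete_val :: "'a ring \<Rightarrow> 'a set \<Rightarrow> ('a \<Rightarrow> int) \<Rightarrow> bool" where
  "discrete_val R L v \<longleftrightarrow>
     (\<forall>x\<in>L - {\<zero>\<^bsub>R\<^esub>}. \<forall>y\<in>L - {\<zero>\<^bsub>R\<^esub>}.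
        v (x \<otimes>\<^bsub>R\<^esub> y) = v x + v y \<and>
        (x \<oplus>\<^bsub>R\<^esub> y \<noteq> \<zero>\<^bsub>R\<^esub> \<longrightarrow> min (v x) (v y) \<le> v (x \<oplus>\<^bsub>R\<^esub> y)))"

definition val_equiv :: "'a ring \<Rightarrow> 'a set \<Rightarrow> ('a \<Rightarrow> int) \<Rightarrow> ('a \<Rightarrow> int) \<Rightarrow> bool" where
  "val_equiv R L v w \<longleftrightarrow> (\<forall>x\<in>L - {\<zero>\<^bsub>R\<^esub>}. 0 \<le> v x \<longleftrightarrow> 0 \<le> w x)"

definition places :: "'a ring \<Rightarrow> 'a set \<Rightarrow> ('a \<Rightarrow> int) set set" where
  "places R L =
     {v. discrete_val R L v} //
       {(v, w). discrete_val R L v \<and> discrete_val R L w \<and> val_equiv R L v w}"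

definition trivial_val :: "'a ring \<Rightarrow> 'a set \<Rightarrow> ('a \<Rightarrow> int) \<Rightarrow> bool" where
  "trivial_val R L v \<longleftrightarrow> (\<forall>x\<in>L - {\<zero>\<^bsub>R\<^esub>}. v x = 0)"

text \<open>\<open>v(x) \<ge> N\<close>, with \<open>v(0) = \<infinity>\<close>.\<close>

definition val_ge :: "'a ring \<Rightarrow> ('a \<Rightarrow> int) \<Rightarrow> 'a \<Rightarrow> int \<Rightarrow> bool" where
  "val_ge R v x N \<longleftrightarrow> x = \<zero>\<^bsub>R\<^esub> \<or> N \<le> v x"

definition val_complete :: "'a ring \<Rightarrow> 'a set \<Rightarrow> ('a \<Rightarrow> int) \<Rightarrow> bool" where
  "val_complete R L v \<longleftrightarrow>
     (\<forall>s. (\<forall>j::nat. s j \<in> L) \<and> (\<forall>N. \<exists>j0. \<forall>i\<ge>j0. \<forall>j\<ge>j0. val_ge R v (s i \<ominus>\<^bsub>R\<^esub> s j) N) \<longrightarrow>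
        (\<exists>x\<in>L. \<forall>N. \<exists>j0. \<forall>j\<ge>j0. val_ge R v (s j \<ominus>\<^bsub>R\<^esub> x) N))"

text \<open>
  \<open>(L, u)\<close> is the completion of \<open>(K, v)\<close> via \<open>\<iota>\<close>. If \<open>v\<close> is trivial, density forces \<open>L = \<iota>(K)\<close>.
\<close>

definition completion ::
  "'a set \<Rightarrow> 'a ring \<Rightarrow> ('a \<Rightarrow> int) \<Rightarrow> 'b ring \<Rightarrow> ('a \<Rightarrow> 'b) \<Rightarrow> 'b set \<Rightarrow> ('b \<Rightarrow> int) \<Rightarrow> bool" where
  "completion K R v S \<iota> L u \<longleftrightarrow>
     subfield L S \<and> \<iota> ` K \<subseteq> L \<and> discrete_val S L u \<and>
     (\<forall>x\<in>K - {\<zero>\<^bsub>R\<^esub>}. u (\<iota> x) = v x) \<and>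
     (\<forall>x\<in>L. \<forall>N. \<exists>a\<in>K. val_ge S u (x \<ominus>\<^bsub>S\<^esub> \<iota> a) N) \<and>
     val_complete S L u"

text \<open>
  \<open>(k, w)\<close> is a finite extension of the completion at a place in \<open>M\<close>; \<open>w\<close> is the prolongation, which
  is unique up to equivalence (\<open>u\<close> may have to be rescaled for \<open>w\<close> to be integer-valued).
\<close>

definition local_field ::
  "'a ring \<Rightarrow> 'a set \<Rightarrow> ('a \<Rightarrow> int) set set \<Rightarrow>
   'b ring \<Rightarrow> ('a \<Rightarrow> 'b) \<Rightarrow> 'b set \<Rightarrow> ('b \<Rightarrow> int) \<Rightarrow> bool" where
  "local_field R K M S \<iota> k w \<longleftrightarrow>
     (\<exists>V\<in>M. \<exists>v\<in>V. \<exists>L u. completion K R v S \<iota> L u \<and>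
        subfield k S \<and> L \<subseteq> k \<and> (ring.finite_dimension S over L) k \<and>
        discrete_val S k w \<and> val_equiv S L u w)"

definition val_ring :: "'a ring \<Rightarrow> 'a set \<Rightarrow> ('a \<Rightarrow> int) \<Rightarrow> 'a set" where
  "val_ring R L w = {x \<in> L. val_ge R w x 0}"

definition val_ideal :: "'a ring \<Rightarrow> 'a set \<Rightarrow> ('a \<Rightarrow> int) \<Rightarrow> 'a set" where
  "val_ideal R L w = {x \<in> L. val_ge R w x 1}"

text \<open>
  \<open>L/k\<close> is unramified at the valuation \<open>w\<close> of \<open>L\<close>: the ramification index is 1 and the residue
  extension is separable. The residue field of \<open>k\<close> is taken as its image in that of \<open>L\<close>.
\<close>

definition val_unramified :: "'a ring \<Rightarrow> 'a set \<Rightarrow> 'a set \<Rightarrow> ('a \<Rightarrow> int) \<Rightarrow> bool" where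
  "val_unramified R k L w \<longleftrightarrow>
     w ` (L - {\<zero>\<^bsub>R\<^esub>}) = w ` (k - {\<zero>\<^bsub>R\<^esub>}) \<and>
     (let m = val_ideal R L w; Q = (R\<lparr>carrier := val_ring R L w\<rparr>) Quot m
      in \<forall>y\<in>carrier Q. separable_over Q ((\<lambda>x. m +>\<^bsub>R\<^esub> x) ` val_ring R k w) y)"


section \<open>Specializations\<close>

definition integral_over :: "'a ring \<Rightarrow> 'a set \<Rightarrow> 'a \<Rightarrow> bool" where
  "integral_over R A x \<longleftrightarrow>
     (\<exists>p\<in>carrier (univ_poly R A). p \<noteq> [] \<and> lead_coeff p = \<one>\<^bsub>R\<^esub> \<and> ring.eval R p x = \<zero>\<^bsub>R\<^esub>)"

definition integral_closure :: "'a ring \<Rightarrow> 'a set \<Rightarrow> 'a set \<Rightarrow> 'a set" where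
  "integral_closure R A E = {x \<in> E. integral_over R A x}"

text \<open>
  \<open>\<Omega>\<close> is an algebraically closed field containing the overfield \<open>k\<close> of \<open>K\<close> and the function field
  \<open>k(B)\<close> (generated over \<open>k\<close> by the image of \<open>K(B)\<close>); \<open>\<iota>\<close> extends \<open>K(B) \<rightarrow> k(B)\<close> to
  the algebraic closure \<open>C\<close> of \<open>K(B)\<close>.
\<close>

definition scalar_extension ::
  "'a ring \<Rightarrow> 'a set \<Rightarrow> nat \<Rightarrow> (nat multiset \<Rightarrow> 'a) set \<Rightarrow> (nat \<Rightarrow> 'a) \<Rightarrow>
   'b ring \<Rightarrow> ('a \<Rightarrow> 'b) \<Rightarrow> 'b set \<Rightarrow> bool" where
  "scalar_extension C K n I \<xi> \<Omega> \<iota> k \<longleftrightarrow>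
     algebraically_closed \<Omega> \<and> \<iota> \<in> ring_hom C \<Omega> \<and> subfield k \<Omega> \<and> \<iota> ` K \<subseteq> k \<and>
     generic_point \<Omega> k n (base_change \<iota> \<Omega> k n I) (\<iota> \<circ> \<xi>)"

text \<open>The field \<open>Fk\<close>.\<close>

definition compositum :: "'b ring \<Rightarrow> ('a \<Rightarrow> 'b) \<Rightarrow> 'b set \<Rightarrow> 'a set \<Rightarrow> 'b set" where
  "compositum \<Omega> \<iota> k F = generate_field \<Omega> (k \<union> \<iota> ` F)"

text \<open>
  The integral closure \<open>A'\<close> in \<open>Fk\<close> of the coordinate ring \<open>A\<close> of the chart where the \<open>i\<close>-th coordinate
  does not vanish.
\<close>

definition spec_ring ::
  "'b ring \<Rightarrow> ('a \<Rightarrow> 'b) \<Rightarrow> 'b set \<Rightarrow> nat \<Rightarrow> (nat \<Rightarrow> 'a) \<Rightarrow> 'a set \<Rightarrow> nat \<Rightarrow> 'b set" where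
  "spec_ring \<Omega> \<iota> k n \<xi> F i =
     integral_closure \<Omega> (chart_ring \<Omega> k n (\<iota> \<circ> \<xi>) i) (compositum \<Omega> \<iota> k F)"

definition specialization_at ::
  "'a ring \<Rightarrow> 'a set \<Rightarrow> nat \<Rightarrow> (nat multiset \<Rightarrow> 'a) set \<Rightarrow> (nat \<Rightarrow> 'a) \<Rightarrow> 'a set \<Rightarrow>
   'b ring \<Rightarrow> ('a \<Rightarrow> 'b) \<Rightarrow> 'b set \<Rightarrow> (nat \<Rightarrow> 'b) \<Rightarrow> nat \<Rightarrow> 'b set \<Rightarrow> bool" where
  "specialization_at C K n I \<xi> F \<Omega> \<iota> k t i P \<longleftrightarrow>
     scalar_extension C K n I \<xi> \<Omega> \<iota> k \<and>
     proj_point \<Omega> k n (base_change \<iota> \<Omega> k n I) t \<and> i \<le> n \<and> t i \<noteq> \<zero>\<^bsub>\<Omega>\<^esub> \<and>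
     primeideal P (\<Omega>\<lparr>carrier := spec_ring \<Omega> \<iota> k n \<xi> F i\<rparr>) \<and>
     P \<inter> chart_ring \<Omega> k n (\<iota> \<circ> \<xi>) i = chart_max_ideal \<Omega> k n (\<iota> \<circ> \<xi>) i t"

text \<open>
  The specialization \<open>(Fk)\<^sub>t/k\<close> at the prime \<open>P\<close>, as the field \<open>A'/P\<close> (\<open>A'\<close> is integral over \<open>A\<close> and
  \<open>P\<close> lies over a maximal ideal) with the image of \<open>k\<close> in it.
\<close>

definition spec_field ::
  "'b ring \<Rightarrow> ('a \<Rightarrow> 'b) \<Rightarrow> 'b set \<Rightarrow> nat \<Rightarrow> (nat \<Rightarrow> 'a) \<Rightarrow> 'a set \<Rightarrow> nat \<Rightarrow> 'b set \<Rightarrow> 'b set ring" where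
  "spec_field \<Omega> \<iota> k n \<xi> F i P = (\<Omega>\<lparr>carrier := spec_ring \<Omega> \<iota> k n \<xi> F i\<rparr>) Quot P"

definition spec_base :: "'b ring \<Rightarrow> 'b set \<Rightarrow> 'b set \<Rightarrow> 'b set set" where
  "spec_base \<Omega> k P = (\<lambda>c. P +>\<^bsub>\<Omega>\<^esub> c) ` k"

definition uniformly_bounded_local_degrees ::
  "'a ring \<Rightarrow> 'a set \<Rightarrow> nat \<Rightarrow> (nat multiset \<Rightarrow> 'a) set \<Rightarrow> (nat \<Rightarrow> 'a) \<Rightarrow>
   ('a \<Rightarrow> int) set set \<Rightarrow> 'a set \<Rightarrow> bool" where
  "uniformly_bounded_local_degrees C K n I \<xi> M F \<longleftrightarrow>
     (\<exists>b. \<forall>(\<Omega> :: (nat \<Rightarrow> 'a) ring) \<iota> k w t i P.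
        local_field C K M \<Omega> \<iota> k w \<and> specialization_at C K n I \<xi> F \<Omega> \<iota> k t i P \<longrightarrow>
        (let L = spec_field \<Omega> \<iota> k n \<xi> F i P; l = spec_base \<Omega> k P
         in (ring.finite_dimension L over l) (carrier L) \<and>
            (ring.dim L over l) (carrier L) \<le> b))"

text \<open>
  The specialization of a finite extension \<open>F\<close> is unramified over \<open>(k, w)\<close>; over a trivially valued
  field everything counts as unramified, inseparable extensions included.
\<close>

definition spec_unramified ::
  "'b ring \<Rightarrow> ('a \<Rightarrow> 'b) \<Rightarrow> 'b set \<Rightarrow> ('b \<Rightarrow> int) \<Rightarrow> nat \<Rightarrow> (nat \<Rightarrow> 'a) \<Rightarrow> 'a set \<Rightarrow>
   nat \<Rightarrow> 'b set \<Rightarrow> bool" where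
  "spec_unramified \<Omega> \<iota> k w n \<xi> F i P \<longleftrightarrow>
     trivial_val \<Omega> k w \<or>
     (let L = spec_field \<Omega> \<iota> k n \<xi> F i P
      in \<exists>w'. discrete_val L (carrier L) w' \<and>
           val_equiv \<Omega> k (\<lambda>c. w' (P +>\<^bsub>\<Omega>\<^esub> c)) w \<and>
           val_unramified L (spec_base \<Omega> k P) (carrier L) w')"


section \<open>Branch locus and Frobenius subgroups\<close>

text \<open>Hypersurfaces of the variety with ideal \<open>J0\<close>: its integral closed subschemes of codimension 1.\<close>

definition hypersurface ::
  "'a ring \<Rightarrow> 'a set \<Rightarrow> nat \<Rightarrow> (nat multiset \<Rightarrow> 'a) set \<Rightarrow> (nat multiset \<Rightarrow> 'a) set \<Rightarrow> bool" where
  "hypersurface R k n J0 J \<longleftrightarrow>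
     homog_prime R k n J \<and> J0 \<subset> J \<and> \<not> (\<exists>J'. homog_prime R k n J' \<and> J0 \<subset> J' \<and> J' \<subset> J)"

text \<open>
  The hypersurfaces over the separable closure of \<open>K\<close> that occur in the branch locus of a finite Galois
  extension \<open>F/K(B)\<close>: some discrete valuation \<open>w\<close> of \<open>F K\<^sup>s\<^sup>e\<^sup>p\<close> whose valuation ring lies over the
  local ring of the hypersurface is ramified over \<open>K\<^sup>s\<^sup>e\<^sup>p(B)\<close>.
\<close>

definition branch_hypersurface ::
  "'a ring \<Rightarrow> 'a set \<Rightarrow> nat \<Rightarrow> (nat multiset \<Rightarrow> 'a) set \<Rightarrow> (nat \<Rightarrow> 'a) \<Rightarrow> 'a set \<Rightarrow>
   (nat multiset \<Rightarrow> 'a) set \<Rightarrow> bool" where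
  "branch_hypersurface C K n I \<xi> F J \<longleftrightarrow>
     (let Ks = sep_closure C K; N = function_field C Ks n \<xi>; E = generate_field C (Ks \<union> F)
      in hypersurface C Ks n (base_change id C Ks n I) J \<and>
         (\<exists>w. discrete_val C E w \<and> val_ring C N w = local_ring C Ks n \<xi> J \<and>
              \<not> val_unramified C N E w))"

definition off_branch_locus ::
  "'a ring \<Rightarrow> 'a set \<Rightarrow> nat \<Rightarrow> (nat multiset \<Rightarrow> 'a) set \<Rightarrow> (nat \<Rightarrow> 'a) \<Rightarrow> 'a set \<Rightarrow>
   'b ring \<Rightarrow> ('a \<Rightarrow> 'b) \<Rightarrow> (nat \<Rightarrow> 'b) \<Rightarrow> bool" where
  "off_branch_locus C K n I \<xi> F \<Omega> \<iota> t \<longleftrightarrow>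
     (\<forall>J. branch_hypersurface C K n I \<xi> F J \<longrightarrow>
        (\<exists>d. \<exists>f \<in> J \<inter> homog C (sep_closure C K) n d. meval \<Omega> (\<iota> \<circ> f) t \<noteq> \<zero>\<^bsub>\<Omega>\<^esub>))"

definition decomposition_group ::
  "'b ring \<Rightarrow> ('a \<Rightarrow> 'b) \<Rightarrow> 'b set \<Rightarrow> nat \<Rightarrow> (nat \<Rightarrow> 'a) \<Rightarrow> 'a set \<Rightarrow> 'b set \<Rightarrow> ('b \<Rightarrow> 'b) set" where
  "decomposition_group \<Omega> \<iota> k n \<xi> F P =
     {\<tau> \<in> carrier (gal_group \<Omega> (compositum \<Omega> \<iota> k F) (function_field \<Omega> k n (\<iota> \<circ> \<xi>))). \<tau> ` P = P}"

text \<open>An element \<open>\<tau>\<close> of the decomposition group maps the residue class \<open>P + a\<close> to \<open>P + \<tau>(a)\<close>.\<close>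

definition reduction :: "'b set ring \<Rightarrow> ('b \<Rightarrow> 'b) \<Rightarrow> 'b set \<Rightarrow> 'b set" where
  "reduction L \<tau> = (\<lambda>Y\<in>carrier L. \<tau> ` Y)"

definition gal_restriction :: "('a \<Rightarrow> 'b) \<Rightarrow> 'a set \<Rightarrow> ('b \<Rightarrow> 'b) \<Rightarrow> 'a \<Rightarrow> 'a" where
  "gal_restriction \<iota> F \<tau> = (\<lambda>x\<in>F. inv_into F \<iota> (\<tau> (\<iota> x)))"

text \<open>
  Off the branch locus, reduction is an isomorphism from the decomposition group onto the Galois group
  of the specialization. Its inverse, followed by restriction to \<open>F\<close>, is how that Galois group is
  viewed as a subgroup of \<open>Gal(F/K(B))\<close>.
\<close>

definition frobenius_subgroup ::
  "'b ring \<Rightarrow> ('a \<Rightarrow> 'b) \<Rightarrow> 'b set \<Rightarrow> nat \<Rightarrow> (nat \<Rightarrow> 'a) \<Rightarrow> 'a set \<Rightarrow> nat \<Rightarrow> 'b set \<Rightarrow>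
   ('a \<Rightarrow> 'a) set" where
  "frobenius_subgroup \<Omega> \<iota> k n \<xi> F i P =
     (let L = spec_field \<Omega> \<iota> k n \<xi> F i P
      in (\<lambda>s. gal_restriction \<iota> F
                (inv_into (decomposition_group \<Omega> \<iota> k n \<xi> F P) (reduction L) s))
         ` carrier (gal_group L (carrier L) (spec_base \<Omega> k P)))"


section \<open>The Tchebotarev existence property\<close>

definition tchebotarev_finite ::
  "'a ring \<Rightarrow> 'a set \<Rightarrow> nat \<Rightarrow> (nat multiset \<Rightarrow> 'a) set \<Rightarrow> (nat \<Rightarrow> 'a) \<Rightarrow>
   ('a \<Rightarrow> int) set set \<Rightarrow> 'a set \<Rightarrow> bool" where
  "tchebotarev_finite C K n I \<xi> M F \<longleftrightarrow>
     (let G = gal_group C F (function_field C K n \<xi>)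
      in \<forall>g\<in>carrier G. \<exists>(\<Omega> :: (nat \<Rightarrow> 'a) ring) \<iota> k w t i P.
           local_field C K M \<Omega> \<iota> k w \<and> specialization_at C K n I \<xi> F \<Omega> \<iota> k t i P \<and>
           off_branch_locus C K n I \<xi> F \<Omega> \<iota> t \<and>
           spec_unramified \<Omega> \<iota> k w n \<xi> F i P \<and>
           (let H = frobenius_subgroup \<Omega> \<iota> k n \<xi> F i P
            in cyclic_group (G\<lparr>carrier := H\<rparr>) \<and>
               (\<exists>h\<in>carrier G. H = (\<lambda>x. h \<otimes>\<^bsub>G\<^esub> x \<otimes>\<^bsub>G\<^esub> inv\<^bsub>G\<^esub> h) ` generate G {g})))"

definition tchebotarev_existence ::
  "'a ring \<Rightarrow> 'a set \<Rightarrow> nat \<Rightarrow> (nat multiset \<Rightarrow> 'a) set \<Rightarrow> (nat \<Rightarrow> 'a) \<Rightarrow>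
   ('a \<Rightarrow> int) set set \<Rightarrow> 'a set \<Rightarrow> bool" where
  "tchebotarev_existence C K n I \<xi> M F \<longleftrightarrow>
     (let N = function_field C K n \<xi>
      in \<exists>E :: nat \<Rightarrow> 'a set.
           (\<forall>j. galois_ext C N (E j) \<and> (ring.finite_dimension C over N) (E j) \<and>
                tchebotarev_finite C K n I \<xi> M (E j) \<and> E j \<subseteq> E (Suc j)) \<and>
           F = (\<Union>j. E j))"

end

theory Submission
  imports Defs "HOL-Number_Theory.Cong"
begin

text \<open>
  Only the order of the elements of \<open>Gal(E/K(B))\<close>, for the finite layers \<open>E\<close> of \<open>F\<close>, has to be bounded.
  By the Tchebotarev property the cyclic group generated by \<open>g\<close> is conjugate to a Frobenius subgroup,
  an image of the automorphism group of a residue extension of \<open>E\<close>; its cardinality is bounded in terms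
  of the residue degree. That degree is at most the local degree of \<open>F\<close> at the same point, because
  a prime of the integral closure in \<open>Ek\<close> lies under one of the integral closure in \<open>Fk\<close>
  (Chevalley's extension theorem for valuation rings, which also shows that integral closures are rings).
  So \<open>Gal(E/K(B))\<close> is abelian of exponent dividing some \<open>e\<close> independent of \<open>E\<close>. An element \<open>s \<noteq> 1\<close>
  of it is avoided by a subgroup \<open>H\<close> of index at most \<open>e\<close>, and by independence of characters some
  element fixed by \<open>H\<close> is moved by \<open>s\<close>; it has at most \<open>e\<close> conjugates. Hence no \<open>s \<noteq> 1\<close> fixes
  \<open>E \<inter> K(B)\<^sup>(\<^sup>e\<^sup>)\<close>, which is therefore all of \<open>E\<close>.
\<close>

section \<open>Subgroups of abelian groups of finite exponent\<close>

text \<open>Abelian groups of a given exponent can be arbitrarily large, so the layers of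
  \<open>F\<close> need not have bounded degree. For this reason only orders of elements are
  bounded, and afterwards a single \<open>s\<close> is treated at a time. A quotient by a subgroup
  maximal among those avoiding \<open>s\<close> replaces a decomposition of the Galois group into
  cyclic factors: in such a quotient every nontrivial element has \<open>s\<close> among its powers,
  and this alone limits its size. On the side of specializations the obstacle is that
  \<open>F\<close> may be infinite over \<open>K(B)\<close>, so that integral closures need not be
  finite modules. Everything about them is therefore derived from valuation subrings. Since the
  point has coordinates in \<open>k\<close>, each function on the chart is congruent to a constant,
  and from this the primes above the point turn out to be maximal. The final \<open>d\<close> is a
  factorial: residue degree at most \<open>b\<close> leaves at most \<open>(b * b + 1) ^ b\<close>
  automorphisms, which bounds the orders of elements from above, and the factorial of the bound is a
  common multiple of all possible orders.\<close>

lemma (in group) subgroup_nat_pow_closed: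
  assumes "subgroup H G" "x \<in> H" shows "x [^] (n::nat) \<in> H"
  using assms by (induction n) (auto intro: subgroup.one_closed subgroup.m_closed)

context comm_group begin

text \<open>Modulo \<open>H\<close> every nontrivial cyclic subgroup contains the class of
  \<open>s\<close>. Hence the classes killed by a prime \<open>p\<close> are powers of that class,
  at most \<open>p\<close> of them. For \<open>m = q * p\<close>, taking \<open>q\<close>-th powers
  sends the classes killed by \<open>m\<close> to classes killed by \<open>p\<close>, with kernel
  the classes killed by \<open>q\<close>, and the counts multiply.\<close>

lemma power_in_subgroup_cover:
  assumes H: "subgroup H G" and s: "s \<in> carrier G"
    and ess: "\<And>g. g \<in> carrier G \<Longrightarrow> g \<notin> H \<Longrightarrow> \<exists>m::nat. \<exists>h\<in>H. s = h \<otimes> g [^] m"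
    and "m \<ge> 1"
  shows "s \<notin> H \<Longrightarrow> \<exists>R. finite R \<and> R \<subseteq> carrier G \<and> card R \<le> m \<and>
           (\<forall>g\<in>carrier G. g [^] m \<in> H \<longrightarrow> (\<exists>r\<in>R. \<exists>h\<in>H. g = h \<otimes> r))"
  using \<open>m \<ge> 1\<close>
proof (induction m rule: nat_less_induct)
  case (1 m)
  have Hc: "\<And>h. h \<in> H \<Longrightarrow> h \<in> carrier G" using H subgroup.mem_carrier by fast
  show ?case
  proof (cases "m = 1")
    case True
    show ?thesis
      by (rule exI[of _ "{\<one>}"]) (use True Hc in auto)
  next
    case False
    then obtain p where p: "prime p" "p dvd m" using prime_factor_nat by blast
    then obtain q where m: "m = q * p" by (metis dvd_def mult.commute)
    have q: "q \<ge> 1" "q < m"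
      using m 1(3) prime_gt_1_nat[OF p(1)] by (auto simp: Suc_le_eq)
    obtain R where R: "finite R" "R \<subseteq> carrier G" "card R \<le> q"
      "\<And>g. g \<in> carrier G \<Longrightarrow> g [^] q \<in> H \<Longrightarrow> \<exists>r\<in>R. \<exists>h\<in>H. g = h \<otimes> r"
      using 1(1,2) q by meson
    have key: "\<exists>i<p. \<exists>h\<in>H. y = h \<otimes> s [^] i" if y: "y \<in> carrier G" "y [^] p \<in> H" for y
    proof (cases "y \<in> H")
      case True
      then show ?thesis using prime_gt_0_nat[OF p(1)] Hc by (intro exI[of _ 0]) auto
    next
      case False
      obtain l :: nat and h where l: "h \<in> H" "s = h \<otimes> y [^] l" using ess[OF y(1) False] by blast
      have powH: "y [^] (p * j) \<in> H" for j
        using subgroup_nat_pow_closed[OF H y(2)] y by (simp add: nat_pow_pow)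
      \<comment> \<open>Otherwise \<open>y [^] l\<close> would be a power of \<open>y [^] p\<close>,
        hence in \<open>H\<close>, and so would \<open>s\<close>. Thus \<open>l\<close> is
        invertible modulo \<open>p\<close>, and a suitable power of \<open>s\<close> recovers
        \<open>y\<close> up to a factor in \<open>H\<close>.\<close>
      have "\<not> p dvd l"
      proof
        assume "p dvd l"
        then obtain j where "l = p * j" by (auto simp: dvd_def)
        then have "s \<in> H" using l powH[of j] subgroup.m_closed[OF H] by simp
        then show False using 1(2) by simp
      qed
      then have "coprime l p" using p(1) prime_imp_coprime coprime_commute by metis
      then obtain i0 where "[l * i0 = 1] (mod p)" using cong_solve_coprime_nat by auto
      then have c: "[l * (i0 mod p) = 1] (mod p)" by (simp add: cong_def mod_mult_right_eq)
      define i where "i = i0 mod p"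
      have i: "i < p" using prime_gt_0_nat[OF p(1)] by (simp add: i_def)
      have "1 < p" using prime_gt_1_nat[OF p(1)] .
      then obtain j where j: "l * i = 1 + p * j"
        using c unfolding i_def[symmetric] cong_def
        by (metis div_mod_decomp mod_less mult.commute add.commute)
      have "s [^] i = h [^] i \<otimes> (y [^] l) [^] i"
        using l y Hc by (simp add: nat_pow_distrib)
      also have "(y [^] l) [^] i = y \<otimes> y [^] (p * j)"
        using y by (simp add: nat_pow_pow j nat_pow_mult[symmetric] m_comm)
      finally have si: "s [^] i = h [^] i \<otimes> (y \<otimes> y [^] (p * j))" .
      define w where "w = h [^] i \<otimes> y [^] (p * j)"
      have w: "w \<in> H" unfolding w_def
          using subgroup.m_closed[OF H subgroup_nat_pow_closed[OF H l(1)] powH] .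
      have "s [^] i = w \<otimes> y" unfolding si w_def using y Hc[OF l(1)]
        by (simp add: m_ac)
      then have "y = inv w \<otimes> s [^] i" using y Hc[OF w] by (simp add: inv_solve_left)
      then show ?thesis using i subgroup.m_inv_closed[OF H w] by blast
    qed
    \<comment> \<open>The elements \<open>g\<close> whose \<open>q\<close>-th power lies in the
      class of \<open>s [^] i\<close>. One such element \<open>c i\<close> is chosen for each
      exponent that is attained; its products with the representatives \<open>R\<close> of the
      kernel represent all the others.\<close>
    define good where "good i g \<longleftrightarrow> g \<in> carrier G \<and> (\<exists>h\<in>H. g [^] q = h \<otimes> s [^] i)" for i :: nat and g
    define c where "c i = (SOME g. good i g)" for i
    define I where "I = {i. i < p \<and> (\<exists>g. good i g)}"
    have c: "good i (c i)" if "i \<in> I" for i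
      using that unfolding c_def I_def by (auto intro: someI)
    define R' where "R' = (\<lambda>(r, i). r \<otimes> c i) ` (R \<times> I)"
    have I: "finite I" "card I \<le> p"
      using card_mono[of "{..<p}" I] unfolding I_def by auto
    have "finite R'" unfolding R'_def using R(1) I by simp
    moreover have "R' \<subseteq> carrier G" using R(2) c unfolding R'_def good_def by fastforce
    moreover have "card R' \<le> m"
    proof -
      have "card R' \<le> card (R \<times> I)" unfolding R'_def using R(1) I by (intro card_image_le) simp
      also have "\<dots> \<le> q * p" using R I by (simp add: mult_le_mono)
      finally show ?thesis using m by simp
    qed
    moreover have "\<exists>r\<in>R'. \<exists>h\<in>H. g = h \<otimes> r" if g: "g \<in> carrier G" "g [^] m \<in> H" for g
    proof -
      have "(g [^] q) [^] p \<in> H" using g by (simp add: nat_pow_pow m)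
      then obtain i h where i: "i < p" "h \<in> H" "g [^] q = h \<otimes> s [^] i"
        using key[of "g [^] q"] g by auto
      then have iI: "i \<in> I" unfolding I_def good_def using g by auto
      obtain h' where h': "h' \<in> H" "c i [^] q = h' \<otimes> s [^] i" and ci: "c i \<in> carrier G"
        using c[OF iI] unfolding good_def by auto
      have "(g \<otimes> inv (c i)) [^] q = g [^] q \<otimes> inv (c i [^] q)"
        using g ci by (simp add: nat_pow_distrib nat_pow_inv)
      also have "\<dots> = h \<otimes> s [^] i \<otimes> (inv (s [^] i) \<otimes> inv h')"
        using i h' s Hc by (simp add: inv_mult_group)
      also have "\<dots> = h \<otimes> inv h'" using i h' s Hc by (simp add: m_assoc flip: m_assoc[of "s [^] i"])
      also have "\<dots> \<in> H" using i h' H by (simp add: subgroup.m_closed subgroup.m_inv_closed)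
      finally obtain r k where r: "r \<in> R" "k \<in> H" "g \<otimes> inv (c i) = k \<otimes> r"
        using R(4)[of "g \<otimes> inv (c i)"] g ci by auto
      have "g = k \<otimes> r \<otimes> c i" using r g ci Hc R(2)
        by (metis inv_closed inv_solve_right m_closed subsetD)
      then have "g = k \<otimes> (r \<otimes> c i)" using r ci Hc R(2) by (simp add: m_assoc subset_iff)
      moreover have "r \<otimes> c i \<in> R'" using r iI unfolding R'_def by force
      ultimately show ?thesis using r by blast
    qed
    ultimately show ?thesis by (intro exI[of _ R']) auto
  qed
qed

text \<open>A subgroup that is maximal among those avoiding \<open>s\<close> has cyclic quotient; only its index is needed.\<close>

lemma avoiding_subgroup_cover:
  assumes fin: "finite (carrier G)" and s: "s \<in> carrier G" "s \<noteq> \<one>"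
    and e: "e \<ge> 1" "\<And>g. g \<in> carrier G \<Longrightarrow> g [^] e = \<one>"
  obtains H R where "subgroup H G" "s \<notin> H" "finite R" "R \<subseteq> carrier G" "card R \<le> e"
    "\<And>g. g \<in> carrier G \<Longrightarrow> \<exists>r\<in>R. \<exists>h\<in>H. g = h \<otimes> r"
proof -
  let ?S = "{H. subgroup H G \<and> s \<notin> H}"
  have "finite ?S" by (rule finite_subset[of _ "Pow (carrier G)"]) (use fin subgroup.subset in auto)
  moreover have "{\<one>} \<in> ?S" using s triv_subgroup by auto
  ultimately obtain H where H: "subgroup H G" "s \<notin> H"
    and max: "\<And>H'. subgroup H' G \<Longrightarrow> s \<notin> H' \<Longrightarrow> H \<subseteq> H' \<Longrightarrow> H = H'"
    using finite_has_maximal[of ?S] by auto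
  have Hc: "\<And>h. h \<in> H \<Longrightarrow> h \<in> carrier G" using H subgroup.mem_carrier by fast
  have ess: "\<exists>m::nat. \<exists>h\<in>H. s = h \<otimes> g [^] m" if g: "g \<in> carrier G" "g \<notin> H" for g
  proof (rule ccontr)
    assume no: "\<not> ?thesis"
    \<comment> \<open>The subgroup generated by \<open>H\<close> and \<open>g\<close>; it
      contradicts the maximality of \<open>H\<close> if it avoids \<open>s\<close>. Natural
      exponents suffice, because the relation \<open>g [^] e = \<one>\<close> turns inverses into
      powers.\<close>
    define H' where "H' = {h \<otimes> g [^] m | h (m::nat). h \<in> H}"
    have "subgroup H' G"
    proof (rule subgroupI)
      show "H' \<subseteq> carrier G" unfolding H'_def using Hc g by auto
      show "H' \<noteq> {}" unfolding H'_def using subgroup.one_closed[OF H(1)] by blast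
    next
      fix a assume "a \<in> H'"
      then obtain h m where a: "h \<in> H" "a = h \<otimes> g [^] (m::nat)" unfolding H'_def by auto
      have "g [^] m \<otimes> g [^] (m * (e - 1)) = g [^] (m * e)"
        using g e(1) by (simp add: nat_pow_mult flip: mult_Suc_right)
      also have "\<dots> = \<one>" using e(2)[of "g [^] m"] g by (simp add: nat_pow_pow)
      finally have 1: "inv (g [^] m) = g [^] (m * (e - 1))"
        using g by (metis inv_unique' m_comm nat_pow_closed)
      have "inv a = inv h \<otimes> g [^] (m * (e - 1))"
        unfolding a using a g Hc by (simp add: inv_mult 1)
      then show "inv a \<in> H'" unfolding H'_def using subgroup.m_inv_closed[OF H(1) a(1)] by blast
    next
      fix a b assume "a \<in> H'" "b \<in> H'"
      then obtain h m h' m' where a: "h \<in> H" "a = h \<otimes> g [^] (m::nat)"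
        and b: "h' \<in> H" "b = h' \<otimes> g [^] (m'::nat)" unfolding H'_def by auto
      have "a \<otimes> b = (h \<otimes> h') \<otimes> g [^] (m + m')"
        unfolding a b using a b g Hc by (simp add: m_ac flip: nat_pow_mult)
      then show "a \<otimes> b \<in> H'" unfolding H'_def using subgroup.m_closed[OF H(1) a(1) b(1)] by blast
    qed
    moreover have "s \<notin> H'" using no unfolding H'_def by blast
    moreover have "H \<subseteq> H'"
    proof
      fix h assume "h \<in> H"
      then have "h = h \<otimes> g [^] (0::nat)" using Hc by simp
      then show "h \<in> H'" unfolding H'_def using \<open>h \<in> H\<close> by blast
    qed
    ultimately have "H = H'" using max by blast
    moreover have "g \<in> H'" unfolding H'_def using subgroup.one_closed[OF H(1)] g
      by (auto intro!: exI[of _ \<one>] exI[of _ "1::nat"])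
    ultimately show False using g by simp
  qed
  from power_in_subgroup_cover[OF H(1) s(1) ess e(1) H(2)]
  obtain R where "finite R" "R \<subseteq> carrier G" "card R \<le> e"
    "\<forall>g\<in>carrier G. g [^] e \<in> H \<longrightarrow> (\<exists>r\<in>R. \<exists>h\<in>H. g = h \<otimes> r)" by blast
  then show ?thesis using that[OF H] e(2) subgroup.one_closed[OF H(1)] by metis
qed

end

section \<open>Valuation rings and integral closures\<close>

text \<open>A subring possibly without unit. Zorn's lemma is applied to such sets alone, as
  candidates for the maximal ideal of a valuation ring; the ring itself is recovered afterwards as
  the set of all \<open>x\<close> that multiply \<open>J\<close> into itself.\<close>

definition mult_closed_subgroup :: "('a, 'b) ring_scheme \<Rightarrow> 'a set \<Rightarrow> bool" where
  "mult_closed_subgroup R J \<longleftrightarrow>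
     subgroup J (add_monoid R) \<and> (\<forall>x\<in>J. \<forall>y\<in>J. x \<otimes>\<^bsub>R\<^esub> y \<in> J)"

text \<open>Values at \<open>u\<close> of polynomials of degree at most \<open>n\<close> with all
  coefficients in \<open>J\<close>, in Horner form. The degree bound is kept explicit because a
  descent on it follows.\<close>

fun (in ring) poly_values :: "'a set \<Rightarrow> 'a \<Rightarrow> nat \<Rightarrow> 'a set" where
  "poly_values J u 0 = J"
| "poly_values J u (Suc n) = {a \<oplus> u \<otimes> y | a y. a \<in> J \<and> y \<in> poly_values J u n}"

text \<open>Constants such as \<open>integral_over\<close> and \<open>gal_group\<close> take plain ring records, whereas \<open>field\<close>
  allows record extensions.\<close>

locale plain_field = field R for R :: "'a ring" (structure)
begin

lemma add_subgroup_props: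
  assumes J: "subgroup J (add_monoid R)"
  shows "x \<in> J \<Longrightarrow> x \<in> carrier R" "\<zero> \<in> J" "x \<in> J \<Longrightarrow> y \<in> J \<Longrightarrow> x \<oplus> y \<in> J" "x \<in> J \<Longrightarrow> \<ominus> x \<in> J"
  using J subgroup.mem_carrier[OF J] subgroup.one_closed[OF J] subgroup.m_closed[OF J]
    add.subgroupE(3)[OF J] by auto

context
  fixes J u assumes J: "subgroup J (add_monoid R)" and u: "u \<in> carrier R"
begin

private lemmas J_props = add_subgroup_props[OF J]

lemma poly_values_in_carrier: "y \<in> poly_values J u n \<Longrightarrow> y \<in> carrier R"
  by (induction n arbitrary: y) (use J_props u in auto)

lemma poly_values_add:
  "y \<in> poly_values J u n \<Longrightarrow> z \<in> poly_values J u n \<Longrightarrow> y \<oplus> z \<in> poly_values J u n"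
proof (induction n arbitrary: y z)
  case (Suc n)
  then obtain a y' b z' where y: "y = a \<oplus> u \<otimes> y'" "a \<in> J" "y' \<in> poly_values J u n"
    and z: "z = b \<oplus> u \<otimes> z'" "b \<in> J" "z' \<in> poly_values J u n" by auto
  have "y \<oplus> z = (a \<oplus> b) \<oplus> u \<otimes> (y' \<oplus> z')"
    using y z u J_props(1) poly_values_in_carrier by (simp add: r_distr a_ac)
  then show ?case using Suc.IH[OF y(3) z(3)] J_props(3)[OF y(2) z(2)] by auto
qed (use J_props in auto)

lemma poly_values_smult:
  assumes v: "v \<in> carrier R" "\<And>j. j \<in> J \<Longrightarrow> v \<otimes> j \<in> J"
  shows "y \<in> poly_values J u n \<Longrightarrow> v \<otimes> y \<in> poly_values J u n"
proof (induction n arbitrary: y)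
  case (Suc n)
  then obtain a y' where y: "y = a \<oplus> u \<otimes> y'" "a \<in> J" "y' \<in> poly_values J u n" by auto
  have "v \<otimes> y = v \<otimes> a \<oplus> u \<otimes> (v \<otimes> y')"
    using y u v J_props(1) poly_values_in_carrier by (simp add: r_distr m_ac)
  then show ?case using Suc.IH[OF y(3)] v(2)[OF y(2)] by auto
qed (use v in auto)

lemma poly_values_minus: "y \<in> poly_values J u n \<Longrightarrow> \<ominus> y \<in> poly_values J u n"
  using poly_values_smult[of "\<ominus> \<one>" y n] poly_values_in_carrier J_props by (simp add: l_minus)

lemma poly_values_Suc: "poly_values J u n \<subseteq> poly_values J u (Suc n)"
proof (induction n)
  case 0
  show ?case
  proof
    fix y assume "y \<in> poly_values J u 0"
    then have "y = y \<oplus> u \<otimes> \<zero>" "y \<in> J" using J_props(1) u by auto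
    then show "y \<in> poly_values J u (Suc 0)" using J_props(2) by auto
  qed
qed fastforce

lemma poly_values_mono: "m \<le> n \<Longrightarrow> poly_values J u m \<subseteq> poly_values J u n"
  using poly_values_Suc lift_Suc_mono_le[of "poly_values J u"] by blast

lemma poly_values_shift: "y \<in> poly_values J u n \<Longrightarrow> u \<otimes> y \<in> poly_values J u (Suc n)"
proof -
  assume y: "y \<in> poly_values J u n"
  then have "u \<otimes> y = \<zero> \<oplus> u \<otimes> y" using u poly_values_in_carrier by simp
  then show ?thesis using y J_props(2) by auto
qed

lemma poly_values_power: "a \<in> J \<Longrightarrow> a \<otimes> u [^] n \<in> poly_values J u n"
proof (induction n)
  case (Suc n)
  have "a \<otimes> u [^] Suc n = u \<otimes> (a \<otimes> u [^] n)" using Suc J_props(1) u by (simp add: m_ac)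
  then show ?case using poly_values_shift Suc by simp
qed (use J_props in auto)

text \<open>The recursion splits off the constant coefficient, whereas the descent has to remove the
  leading one.\<close>

lemma poly_values_top:
  "y \<in> poly_values J u (Suc n) \<Longrightarrow> \<exists>a\<in>J. \<exists>z\<in>poly_values J u n. y = z \<oplus> a \<otimes> u [^] Suc n"
proof (induction n arbitrary: y)
  case 0
  then obtain a z where "a \<in> J" "z \<in> J" "y = a \<oplus> u \<otimes> z" by auto
  then have "y = a \<oplus> z \<otimes> u [^] Suc 0"
    using u J_props(1) by (simp add: m_comm)
  then show ?case using \<open>a \<in> J\<close> \<open>z \<in> J\<close> by (metis poly_values.simps(1))
next
  case (Suc n)
  then obtain b y' where y: "y = b \<oplus> u \<otimes> y'" "b \<in> J" "y' \<in> poly_values J u (Suc n)"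
    by (auto simp del: poly_values.simps(2) simp: poly_values.simps(2)[of _ _ "Suc n"])
  obtain a z where az: "a \<in> J" "z \<in> poly_values J u n" "y' = z \<oplus> a \<otimes> u [^] Suc n"
    using Suc.IH[OF y(3)] by blast
  have "y = (b \<oplus> u \<otimes> z) \<oplus> a \<otimes> u [^] Suc (Suc n)"
    using y(1,2) az u J_props(1) poly_values_in_carrier by (simp add: r_distr m_ac a_ac)
  moreover have "b \<oplus> u \<otimes> z \<in> poly_values J u (Suc n)" using y az by auto
  ultimately show ?case using az by blast
qed

lemma poly_values_mult:
  assumes JJ: "\<And>x y. x \<in> J \<Longrightarrow> y \<in> J \<Longrightarrow> x \<otimes> y \<in> J"
  shows "y \<in> poly_values J u n \<Longrightarrow> z \<in> poly_values J u m \<Longrightarrow> y \<otimes> z \<in> poly_values J u (n + m)"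
proof (induction n arbitrary: y)
  case 0
  then show ?case using poly_values_smult JJ J_props(1) by simp
next
  case (Suc n)
  then obtain a y' where y: "y = a \<oplus> u \<otimes> y'" "a \<in> J" "y' \<in> poly_values J u n" by auto
  have "y \<otimes> z = a \<otimes> z \<oplus> u \<otimes> (y' \<otimes> z)"
    using y u J_props(1) poly_values_in_carrier Suc.prems by (simp add: l_distr m_assoc)
  moreover have "a \<otimes> z \<in> poly_values J u (Suc (n + m))"
    using poly_values_smult[OF _ JJ[OF y(2)] Suc.prems(2)] J_props(1) y(2) poly_values_mono[of m
        "Suc (n+m)"]
    by auto
  moreover have "u \<otimes> (y' \<otimes> z) \<in> poly_values J u (Suc (n + m))"
    using poly_values_shift[OF Suc.IH[OF y(3) Suc.prems(2)]] .
  ultimately show ?case using poly_values_add by (metis add_Suc)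
qed

end

lemma m_assoc_swap:
  "w \<in> carrier R \<Longrightarrow> y \<in> carrier R \<Longrightarrow> p \<in> carrier R \<Longrightarrow> u \<in> carrier R \<Longrightarrow>
     w \<otimes> y \<otimes> (p \<otimes> u) = (u \<otimes> w) \<otimes> (y \<otimes> p)"
  by (simp add: m_ac)

lemma mult_swap:
  "x \<in> carrier R \<Longrightarrow> y \<in> carrier R \<Longrightarrow> p \<in> carrier R \<Longrightarrow> q \<in> carrier R \<Longrightarrow>
     (x \<otimes> q) \<otimes> (y \<otimes> p) = (x \<otimes> p) \<otimes> (y \<otimes> q)"
  by (simp add: m_ac)

lemma smult_combination:
  "d \<in> carrier R \<Longrightarrow> z \<in> carrier R \<Longrightarrow> a \<in> carrier R \<Longrightarrow> p \<in> carrier R \<Longrightarrow>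
     d \<otimes> (z \<oplus> a \<otimes> p) = d \<otimes> z \<oplus> a \<otimes> (d \<otimes> p)"
  by (simp add: r_distr m_ac)

text \<open>Multiplication by \<open>u [^] n\<close> turns the \<open>j\<close>-th power of
  \<open>w\<close>, the inverse of \<open>u\<close>, into the power of \<open>u\<close> with
  exponent \<open>n - j\<close>; this is not negative as \<open>m \<le> n\<close>.\<close>

lemma poly_values_reverse:
  assumes J: "subgroup J (add_monoid R)" and u: "u \<in> carrier R" "w \<in> carrier R" "u \<otimes> w = \<one>"
  shows "y \<in> poly_values J w m \<Longrightarrow> m \<le> n \<Longrightarrow> y \<otimes> u [^] n \<in> poly_values J u n"
proof (induction m arbitrary: y n)
  case 0
  then show ?case using poly_values_power[OF J u(1)] by simp
next
  case (Suc m)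
  then obtain a y' where y: "y = a \<oplus> w \<otimes> y'" "a \<in> J" "y' \<in> poly_values J w m" by auto
  obtain n' where n: "n = Suc n'" "m \<le> n'" using Suc.prems(2) by (cases n) auto
  have c: "a \<in> carrier R" "y' \<in> carrier R"
    using y add_subgroup_props(1)[OF J] poly_values_in_carrier[OF J u(2)] by auto
  have "w \<otimes> y' \<otimes> u [^] n = (u \<otimes> w) \<otimes> (y' \<otimes> u [^] n')"
    unfolding n(1) nat_pow_Suc using c u(1,2) by (intro m_assoc_swap) auto
  then have "y \<otimes> u [^] n = a \<otimes> u [^] n \<oplus> y' \<otimes> u [^] n'"
    using c u y(1) by (simp add: l_distr)
  moreover have "y' \<otimes> u [^] n' \<in> poly_values J u n"
    using Suc.IH[OF y(3) n(2)] poly_values_Suc[OF J u(1), of n'] n by blast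
  ultimately show ?case
    using poly_values_add[OF J u(1) poly_values_power[OF J u(1) y(2), of n]] by simp
qed

text \<open>The two relations read \<open>1 = z + a u^n\<close>, with the leading term split off,
  and \<open>1 - b = w y'\<close>, with the constant term split off. Multiplying the first by
  \<open>1 - b\<close> replaces the leading term by \<open>a w y' u^n = a y' u^(n-1)\<close>, of
  smaller degree. As \<open>b\<close> lies in \<open>J\<close>, it can be added back, and
  \<open>1\<close> itself is expressed in degree \<open>n - 1\<close> without inverting
  \<open>1 - b\<close>.\<close>

lemma poly_values_descent:
  assumes J: "mult_closed_subgroup R J" "\<one> \<notin> J" and u: "u \<in> carrier R" "w \<in> carrier R" "u \<otimes> w = \<one>"
    and n: "\<one> \<in> poly_values J u n" "\<one> \<in> poly_values J w m" "m \<le> n"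
  shows "\<exists>n'<n. \<one> \<in> poly_values J u n'"
proof -
  have Js: "subgroup J (add_monoid R)" and JJ: "\<And>x y. x \<in> J \<Longrightarrow> y \<in> J \<Longrightarrow> x \<otimes> y \<in> J"
    using J(1) unfolding mult_closed_subgroup_def by auto
  have "m \<noteq> 0" using n(2) J(2) by (metis poly_values.simps(1))
  then obtain m' n' where mn: "m = Suc m'" "n = Suc n'" "m' \<le> n'"
    using n(3) by (cases m; cases n) auto
  obtain b y' where b: "b \<in> J" "y' \<in> poly_values J w m'" "\<one> = b \<oplus> w \<otimes> y'"
    using n(2) mn by auto
  obtain a z where a: "a \<in> J" "z \<in> poly_values J u n'" "\<one> = z \<oplus> a \<otimes> u [^] n"
    using poly_values_top[OF Js u(1)] n(1) mn by blast
  have c: "a \<in> carrier R" "b \<in> carrier R" "z \<in> carrier R" "y' \<in> carrier R"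
    using a(1,2) b(1,2) add_subgroup_props(1)[OF Js] poly_values_in_carrier[OF Js] u(1,2) by blast+
  note add = poly_values_add[OF Js u(1)] and minus = poly_values_minus[OF Js u(1)]
  have smult: "j \<otimes> y \<in> poly_values J u k" if "j \<in> J" "y \<in> poly_values J u k" for j y k
    using poly_values_smult[OF Js u(1) add_subgroup_props(1)[OF Js that(1)] JJ[OF that(1)] that(2)]
        .
  have y'u: "y' \<otimes> u [^] n' \<in> poly_values J u n'"
    using poly_values_reverse[OF Js u b(2)] mn by simp
  have "w \<otimes> y' \<otimes> u [^] n = (u \<otimes> w) \<otimes> (y' \<otimes> u [^] n')"
    unfolding mn(2) nat_pow_Suc using c u(1,2) by (intro m_assoc_swap) auto
  then have 1: "w \<otimes> y' \<otimes> u [^] n = y' \<otimes> u [^] n'" unfolding u(3) using u(1) c by simp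
  have "w \<otimes> y' = (b \<oplus> w \<otimes> y') \<ominus> b" using c u(2) by algebra
  then have w: "w \<otimes> y' = \<one> \<ominus> b" unfolding b(3)[symmetric] .
  have "\<one> \<ominus> b = (\<one> \<ominus> b) \<otimes> (z \<oplus> a \<otimes> u [^] n)" unfolding a(3)[symmetric] using c by simp
  also have "\<dots> = (\<one> \<ominus> b) \<otimes> z \<oplus> a \<otimes> ((\<one> \<ominus> b) \<otimes> u [^] n)"
    using c u by (intro smult_combination) auto
  also have "(\<one> \<ominus> b) \<otimes> u [^] n = y' \<otimes> u [^] n'" using 1 w by simp
  also have "(\<one> \<ominus> b) \<otimes> z = z \<oplus> \<ominus> (b \<otimes> z)" using c by (simp add: minus_eq l_distr l_minus)
  finally have "\<one> \<ominus> b = (z \<oplus> \<ominus> (b \<otimes> z)) \<oplus> a \<otimes> (y' \<otimes> u [^] n')" .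
  moreover have "(z \<oplus> \<ominus> (b \<otimes> z)) \<oplus> a \<otimes> (y' \<otimes> u [^] n') \<in> poly_values J u n'"
    using add[OF add[OF a(2) minus[OF smult[OF b(1) a(2)]]] smult[OF a(1) y'u]] .
  ultimately have "\<one> \<ominus> b \<in> poly_values J u n'" by simp
  moreover have "b \<in> poly_values J u n'"
    using poly_values_mono[OF Js u(1), of 0 n'] b(1) by auto
  moreover have "\<one> = (\<one> \<ominus> b) \<oplus> b" using c by (simp add: minus_eq a_assoc l_neg)
  ultimately have "\<one> \<in> poly_values J u n'" using add by metis
  then show ?thesis using mn by blast
qed

text \<open>The situation is symmetric in \<open>u\<close> and its inverse, so the larger of the two
  degrees can always be lowered: infinite descent on \<open>n + m\<close>.\<close>

lemma one_not_in_both_poly_values: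
  assumes J: "mult_closed_subgroup R J" "\<one> \<notin> J"
  shows "u \<in> carrier R \<Longrightarrow> w \<in> carrier R \<Longrightarrow> u \<otimes> w = \<one> \<Longrightarrow>
     \<one> \<in> poly_values J u n \<Longrightarrow> \<one> \<in> poly_values J w m \<Longrightarrow> False"
proof (induction "n + m" arbitrary: n m u w rule: less_induct)
  case less
  show ?case
  proof (cases "m \<le> n")
    case True
    then obtain n' where "n' < n" "\<one> \<in> poly_values J u n'"
      using poly_values_descent[OF J less.prems] by blast
    then show False using less.hyps[of n' m] less.prems by auto
  next
    case False
    have uw: "w \<otimes> u = \<one>" using less.prems m_comm by simp
    obtain m' where "m' < m" "\<one> \<in> poly_values J w m'"
      using poly_values_descent[OF J less.prems(2,1) uw less.prems(5,4)] False by auto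
    then show False using less.hyps[of n m'] less.prems by auto
  qed
qed

section \<open>Valuation subrings and Chevalley's extension theorem\<close>

definition valuation_subring :: "'a set \<Rightarrow> bool" where
  "valuation_subring V \<longleftrightarrow> subring V R \<and> (\<forall>x\<in>carrier R - {\<zero>}. x \<in> V \<or> inv x \<in> V)"

definition nonunits :: "'a set \<Rightarrow> 'a set" where
  "nonunits V = {x \<in> V. x \<noteq> \<zero> \<longrightarrow> inv x \<notin> V}"

text \<open>For a maximal \<open>J\<close>, the multipliers \<open>V\<close> of \<open>J\<close>
  form a valuation ring: of \<open>x\<close> and \<open>inv x\<close>, one is such that
  \<open>1\<close> is not a polynomial value over \<open>J\<close>, and adjoining it to
  \<open>J\<close> gives nothing new. An element of \<open>J\<close> with inverse in
  \<open>V\<close> would put \<open>1\<close> into \<open>J\<close>, so \<open>J\<close> consists of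
  nonunits.\<close>

lemma chevalley:
  assumes A: "A \<subseteq> carrier R" and J0: "mult_closed_subgroup R J0" "\<one> \<notin> J0"
    and AJ: "\<And>a j. a \<in> A \<Longrightarrow> j \<in> J0 \<Longrightarrow> a \<otimes> j \<in> J0"
  obtains V where "valuation_subring V" "A \<subseteq> V" "J0 \<subseteq> nonunits V"
proof -
  define S where "S = {J. mult_closed_subgroup R J \<and> \<one> \<notin> J \<and>
    (\<forall>a\<in>A. \<forall>j\<in>J. a \<otimes> j \<in> J) \<and> J0 \<subseteq> J}"
  have "\<exists>M\<in>S. \<forall>Z\<in>S. M \<subseteq> Z \<longrightarrow> Z = M"
  proof (rule subset_Zorn_nonempty)
    show "S \<noteq> {}" unfolding S_def using J0 AJ by auto
  next
    fix \<C> assume C: "\<C> \<noteq> {}" "subset.chain S \<C>"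
    have sub: "Z \<in> S" if "Z \<in> \<C>" for Z using C(2) that by (auto simp: subset.chain_def)
    have two: "\<exists>Z\<in>\<C>. x \<in> Z \<and> y \<in> Z" if xy: "x \<in> \<Union>\<C>" "y \<in> \<Union>\<C>" for x y
    proof -
      obtain Z Y where "Z \<in> \<C>" "x \<in> Z" "Y \<in> \<C>" "y \<in> Y" using xy by auto
      moreover from this have "Z \<subseteq> Y \<or> Y \<subseteq> Z" using C(2) by (auto simp: subset_chain_def)
      ultimately show ?thesis by auto
    qed
    have sg: "subgroup Z (add_monoid R)" if "Z \<in> \<C>" for Z
      using sub[OF that] by (auto simp: S_def mult_closed_subgroup_def)
    note p = add_subgroup_props[OF sg]
    have "subgroup (\<Union>\<C>) (add_monoid R)"
    proof (rule add.subgroupI)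
      show "\<Union>\<C> \<subseteq> carrier R" using p by auto
      show "\<Union>\<C> \<noteq> {}" using C(1) p(2) by auto
      show "\<ominus> a \<in> \<Union>\<C>" if "a \<in> \<Union>\<C>" for a using that p(4) by auto
      show "a \<oplus> b \<in> \<Union>\<C>" if "a \<in> \<Union>\<C>" "b \<in> \<Union>\<C>" for a b
        using two[OF that] p(3) by auto
    qed
    moreover have "x \<otimes> y \<in> \<Union>\<C>" if xy: "x \<in> \<Union>\<C>" "y \<in> \<Union>\<C>" for x y
    proof -
      obtain Z where Z: "Z \<in> \<C>" "x \<in> Z" "y \<in> Z" using two[OF xy] by blast
      then have "x \<otimes> y \<in> Z" using sub[OF Z(1)] by (auto simp: S_def mult_closed_subgroup_def)
      then show ?thesis using Z(1) by blast
    qed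
    moreover have "a \<otimes> j \<in> \<Union>\<C>" if "a \<in> A" "j \<in> \<Union>\<C>" for a j
      using that sub unfolding S_def by blast
    moreover have "\<one> \<notin> \<Union>\<C>" using sub unfolding S_def by blast
    moreover have "J0 \<subseteq> \<Union>\<C>" using sub C(1) unfolding S_def by blast
    ultimately show "\<Union>\<C> \<in> S" unfolding S_def mult_closed_subgroup_def by blast
  qed
  then obtain J where JS: "J \<in> S" and max: "\<And>Z. Z \<in> S \<Longrightarrow> J \<subseteq> Z \<Longrightarrow> Z = J" by blast
  have J: "mult_closed_subgroup R J" "\<one> \<notin> J" "\<And>a j. a \<in> A \<Longrightarrow> j \<in> J \<Longrightarrow> a \<otimes> j \<in> J" "J0 \<subseteq> J"
    using JS unfolding S_def by auto
  have Js: "subgroup J (add_monoid R)" and JJ: "\<And>x y. x \<in> J \<Longrightarrow> y \<in> J \<Longrightarrow> x \<otimes> y \<in> J"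
    using J(1) unfolding mult_closed_subgroup_def by auto
  note Jp = add_subgroup_props[OF Js]
  define V where "V = {x \<in> carrier R. \<forall>j\<in>J. x \<otimes> j \<in> J}"
  have "subring V R"
    by (rule subringI) (use Jp in \<open>auto simp: V_def m_assoc l_distr l_minus\<close>)
  \<comment> \<open>The values at \<open>u\<close> of all polynomials over \<open>J\<close> form a
    member of \<open>S\<close> containing \<open>J\<close>, hence equal to \<open>J\<close> by
    maximality. As \<open>u \<otimes> j\<close> is one of these values, \<open>u\<close> multiplies
    \<open>J\<close> into itself.\<close>
  moreover have V: "u \<in> V" if u: "u \<in> carrier R" "\<And>n. \<one> \<notin> poly_values J u n" for u
  proof -
    define N where "N = (\<Union>n. poly_values J u n)"
    have two: "\<exists>n. x \<in> poly_values J u n \<and> y \<in> poly_values J u n" if xy: "x \<in> N" "y \<in> N" for x y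
    proof -
      obtain n m where "x \<in> poly_values J u n" "y \<in> poly_values J u m" using xy
          by (auto simp: N_def)
      then show ?thesis using poly_values_mono[OF Js u(1), of n "max n m"]
        poly_values_mono[OF Js u(1), of m "max n m"] by (intro exI[of _ "max n m"]) auto
    qed
    have JN: "J \<subseteq> N" unfolding N_def by (metis UN_upper UNIV_I poly_values.simps(1))
    have "subgroup N (add_monoid R)"
    proof (rule add.subgroupI)
      show "N \<subseteq> carrier R" unfolding N_def using poly_values_in_carrier[OF Js u(1)] by auto
      show "N \<noteq> {}" using JN Jp(2) by auto
      show "\<ominus> a \<in> N" if "a \<in> N" for a using that poly_values_minus[OF Js u(1)] by (auto simp: N_def)
      show "a \<oplus> b \<in> N" if "a \<in> N" "b \<in> N" for a b
        using two[OF that] poly_values_add[OF Js u(1)] by (auto simp: N_def)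
    qed
    moreover have "x \<otimes> y \<in> N" if "x \<in> N" "y \<in> N" for x y
      using two[OF that] poly_values_mult[OF Js u(1) JJ] unfolding N_def by blast
    moreover have "a \<otimes> x \<in> N" if "a \<in> A" "x \<in> N" for a x
      using that A poly_values_smult[OF Js u(1) _ J(3)[OF that(1)]] by (auto simp: N_def)
    ultimately have "N \<in> S" unfolding S_def mult_closed_subgroup_def
      using JN J(4) u(2) by (auto simp: N_def)
    then have "N = J" using max JN by blast
    moreover have "u \<otimes> j \<in> N" if "j \<in> J" for j
      using poly_values_shift[OF Js u(1), of j 0] that unfolding N_def
          by (auto simp del: poly_values.simps(2))
    ultimately show ?thesis using u unfolding V_def by auto
  qed
  have "x \<in> V \<or> inv x \<in> V" if "x \<in> carrier R - {\<zero>}" for x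
    using V[of x] V[of "inv x"] one_not_in_both_poly_values[OF J(1,2), of x "inv x"] that
        field_Units
    by auto
  ultimately have "valuation_subring V" unfolding valuation_subring_def by blast
  moreover have "A \<subseteq> V" unfolding V_def using A J(3) by auto
  moreover have "j \<in> nonunits V" if j: "j \<in> J" for j
  proof -
    have "\<one> \<in> J" if "j \<noteq> \<zero>" "inv j \<in> V"
    proof -
      have "inv j \<otimes> j \<in> J" using that j unfolding V_def by auto
      moreover have "inv j \<otimes> j = \<one>" using Jp(1)[OF j] that field_Units by auto
      ultimately show ?thesis by simp
    qed
    then show ?thesis unfolding nonunits_def using j J(2) JJ Jp(1) by (auto simp: V_def)
  qed
  ultimately show thesis using that J(4) by blast
qed

context
  fixes V assumes V: "valuation_subring V"
begin

private lemma V_subring: "subring V R" and V_or: "x \<in> carrier R \<Longrightarrow> x \<noteq> \<zero> \<Longrightarrow> x \<in> V \<or> inv x \<in> V"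
  using V unfolding valuation_subring_def by auto

private lemmas V_props = subringE[OF V_subring]

lemma one_not_nonunit: "\<one> \<notin> nonunits V"
  unfolding nonunits_def using V_props(3) by auto

lemma nonunits_smult: assumes "v \<in> V" "x \<in> nonunits V" shows "v \<otimes> x \<in> nonunits V"
proof -
  have c: "v \<in> carrier R" "x \<in> carrier R" "x \<in> V" using assms V_props(1)
      by (auto simp: nonunits_def)
  have "inv x \<in> V" if "v \<otimes> x \<noteq> \<zero>" "inv (v \<otimes> x) \<in> V"
  proof -
    have nz: "v \<noteq> \<zero>" "x \<noteq> \<zero>" using that c by auto
    have i: "inv (v \<otimes> x) \<in> carrier R" "(v \<otimes> x) \<otimes> inv (v \<otimes> x) = \<one>"
      using that c field_Units by auto
    have "x \<otimes> (v \<otimes> inv (v \<otimes> x)) = (v \<otimes> x) \<otimes> inv (v \<otimes> x)" using c i(1) by (simp add: m_ac)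
    then have "inv x = v \<otimes> inv (v \<otimes> x)" using c i by (intro comm_inv_char) auto
    then show ?thesis using V_props(6)[OF assms(1) that(2)] by simp
  qed
  then show ?thesis using assms c V_props(6) unfolding nonunits_def by auto
qed

text \<open>For nonzero elements one of the two quotients lies in \<open>V\<close>, say
  \<open>x / y\<close>, and then \<open>x + y = (x / y + 1) y\<close> is a multiple of a
  nonunit.\<close>

lemma nonunits_add: assumes "x \<in> nonunits V" "y \<in> nonunits V" shows "x \<oplus> y \<in> nonunits V"
proof -
  have c: "x \<in> carrier R" "y \<in> carrier R" "x \<in> V" "y \<in> V" using assms V_props(1)
      by (auto simp: nonunits_def)
  have *: "a \<oplus> b \<in> nonunits V" if ab: "a \<in> nonunits V" "b \<in> nonunits V" "b \<noteq> \<zero>" "a \<otimes> inv b \<in> V"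
      for a b
  proof -
    have ca: "a \<in> carrier R" "b \<in> carrier R" using ab(1,2) V_props(1) by (auto simp: nonunits_def)
    have cc: "a \<in> carrier R" "b \<in> carrier R" "inv b \<in> carrier R" "inv b \<otimes> b = \<one>"
      using ca ab(3) field_Units by auto
    have "(a \<otimes> inv b \<oplus> \<one>) \<otimes> b = a \<otimes> (inv b \<otimes> b) \<oplus> b" using cc(1-3) by (simp add: l_distr m_assoc)
    then have "a \<oplus> b = (a \<otimes> inv b \<oplus> \<one>) \<otimes> b" unfolding cc(4) using cc(1) by simp
    then show ?thesis using nonunits_smult[OF V_props(7)[OF ab(4) V_props(3)] ab(2)] by simp
  qed
  show ?thesis
  proof (cases "x = \<zero> \<or> y = \<zero>")
    case True
    then show ?thesis using assms c(1,2) by (elim disjE) simp_all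
  next
    case False
    then have i: "inv x \<in> carrier R" "x \<otimes> inv x = \<one>" "inv y \<in> carrier R" "y \<otimes> inv y = \<one>"
      using c field_Units by auto
    have "(x \<otimes> inv y) \<otimes> (y \<otimes> inv x) = (x \<otimes> inv x) \<otimes> (y \<otimes> inv y)"
      using c(1,2) i(1,3) by (intro mult_swap)
    then have 1: "(x \<otimes> inv y) \<otimes> (y \<otimes> inv x) = \<one>" using i by simp
    then have "inv (x \<otimes> inv y) = y \<otimes> inv x"
      using c(1,2) i(1,3) by (intro comm_inv_char) auto
    moreover have "x \<otimes> inv y \<noteq> \<zero>" using 1 c i by auto
    ultimately have "x \<otimes> inv y \<in> V \<or> y \<otimes> inv x \<in> V"
      using V_or[of "x \<otimes> inv y"] c i by auto
    then show ?thesis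
      using *[of x y] *[of y x] assms False a_comm[OF c(1,2)] by metis
  qed
qed

lemma nonunits_prime:
  assumes "x \<in> V" "y \<in> V" "x \<otimes> y \<in> nonunits V" shows "x \<in> nonunits V \<or> y \<in> nonunits V"
proof (rule ccontr)
  assume "\<not> ?thesis"
  then have n: "x \<noteq> \<zero>" "y \<noteq> \<zero>" "inv x \<in> V" "inv y \<in> V" using assms by (auto simp: nonunits_def)
  have c: "x \<in> carrier R" "y \<in> carrier R" "inv x \<in> carrier R" "inv y \<in> carrier R" "inv x \<otimes> x = \<one>"
      "inv y \<otimes> y = \<one>"
    using assms n V_props(1) field_Units by auto
  have "(inv x \<otimes> inv y) \<otimes> (x \<otimes> y) = (inv x \<otimes> x) \<otimes> (inv y \<otimes> y)" using c(1-4) by (simp add: m_ac)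
  then show False using nonunits_smult[OF V_props(6)[OF n(3,4)] assms(3)] one_not_nonunit c by simp
qed

text \<open>If \<open>x\<close> is outside \<open>V\<close>, its inverse lies in \<open>V\<close>.
  Dividing the monic equation by the power of \<open>x\<close> of the same degree gives
  \<open>1 + v / x = 0\<close> with \<open>v\<close> in \<open>V\<close>, that is
  \<open>x = - v\<close>, which is in \<open>V\<close>.\<close>

lemma integral_in_valuation_subring:
  assumes A: "A \<subseteq> V" and x: "x \<in> carrier R" "integral_over R A x"
  shows "x \<in> V"
proof (rule ccontr)
  assume xV: "x \<notin> V"
  then have nz: "x \<noteq> \<zero>" and w: "inv x \<in> V" using V_or x V_props(2) by auto
  have wc: "inv x \<in> carrier R" "x \<otimes> inv x = \<one>" using nz x field_Units by auto
  \<comment> \<open>A coefficient list has degree less than its length, so dividing by the power of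
    \<open>x\<close> with exponent the length leaves at least one factor \<open>inv x\<close> in
    every term.\<close>
  have claim: "\<exists>v\<in>V. eval q x \<otimes> inv x [^] length q = inv x \<otimes> v" if "set q \<subseteq> V" for q
    using that
  proof (induction q)
    case Nil
    then show ?case using V_props(2) wc by (intro bexI[of _ \<zero>]) auto
  next
    case (Cons a q)
    then obtain v where v: "v \<in> V" "eval q x \<otimes> inv x [^] length q = inv x \<otimes> v" by auto
    have c: "a \<in> carrier R" "eval q x \<in> carrier R" "v \<in> carrier R"
      using Cons.prems v V_props(1) eval_in_carrier x by auto
    have "x [^] length q \<otimes> inv x [^] length q = \<one>"
      using x wc by (metis nat_pow_distrib nat_pow_one)
    moreover have "a \<otimes> x [^] length q \<otimes> inv x [^] Suc (length q) = inv x \<otimes> a \<otimes> (x [^] length q \<otimes> inv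
        x [^] length q)"
      using c x wc(1) by (simp add: m_ac)
    moreover have "eval q x \<otimes> inv x [^] Suc (length q) = inv x \<otimes> (v \<otimes> inv x)"
      using v(2) c wc x by (simp add: m_assoc[symmetric])
    ultimately have "eval (a # q) x \<otimes> inv x [^] length (a # q) = inv x \<otimes> (a \<oplus> v \<otimes> inv x)"
      using c x wc by (simp add: l_distr r_distr)
    then show ?case using v w Cons.prems V_props(6,7) by auto
  qed
  obtain p where p: "p \<in> carrier (univ_poly R A)" "p \<noteq> []" "lead_coeff p = \<one>" "eval p x = \<zero>"
    using x(2) unfolding integral_over_def by auto
  obtain q where q: "p = \<one> # q" using p by (cases p) auto
  have "set q \<subseteq> V" using p(1) A unfolding q univ_poly_carrier[symmetric] polynomial_def by auto
  then obtain v where v: "v \<in> V" "eval q x \<otimes> inv x [^] length q = inv x \<otimes> v" using claim by blast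
  have c: "v \<in> carrier R" "eval q x \<in> carrier R" using v V_props(1) eval_in_carrier \<open>set q \<subseteq> V\<close> x
      by auto
  have "x [^] length q \<otimes> inv x [^] length q = \<one>" using x wc by (metis nat_pow_distrib nat_pow_one)
  moreover have "(x [^] length q \<oplus> eval q x) \<otimes> inv x [^] length q = \<zero>"
    using p(4) wc x c unfolding q by simp
  ultimately have "\<one> \<oplus> inv x \<otimes> v = \<zero>" using v(2) x wc c by (simp add: l_distr)
  then have "x \<otimes> (\<one> \<oplus> inv x \<otimes> v) = \<zero>" using x by simp
  then have "x \<oplus> v = \<zero>" using x wc c by (simp add: r_distr m_assoc[symmetric])
  then have "x = \<ominus> v" using x c by (metis add.inv_equality)
  then show False using xV v V_props(5) by simp
qed

end

section \<open>Integral closures as intersections of valuation subrings\<close>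

lemma poly_values_eval:
  assumes "A \<subseteq> carrier R" "x \<in> carrier R" 
  shows "y \<in> poly_values A x n \<Longrightarrow> \<exists>p. set p \<subseteq> A \<and> length p = Suc n \<and> eval p x = y"
proof (induction n arbitrary: y)
  case 0
  then show ?case using assms by (intro exI[of _ "[y]"]) auto
next
  case (Suc n)
  then obtain a y' where y: "y = a \<oplus> x \<otimes> y'" "a \<in> A" "y' \<in> poly_values A x n" by auto
  obtain p where p: "set p \<subseteq> A" "length p = Suc n" "eval p x = y'" using Suc.IH[OF y(3)] by auto
  have "eval (p @ [a]) x = y" using eval_append_aux[of p a x] p y assms eval_in_carrier[of p x]
    by (auto simp: m_comm a_comm)
  then show ?case using p y by (intro exI[of _ "p @ [a]"]) auto
qed

lemma simple_extension_poly_values: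
    "y \<in> simple_extension A x \<Longrightarrow> A \<subseteq> carrier R \<Longrightarrow> x \<in> carrier R \<Longrightarrow> \<zero> \<in> A \<Longrightarrow> \<exists>n. y \<in> poly_values A x n"
proof (induction rule: simple_extension.induct)
  case zero
  then show ?case by (intro exI[of _ 0]) simp
next
  case (lin k1 k2)
  then obtain n where "k1 \<in> poly_values A x n" by auto
  moreover have "k1 \<in> carrier R" using lin simple_extension_in_carrier by auto
  moreover have "k2 \<in> carrier R" using lin by auto
  ultimately have "k1 \<otimes> x \<oplus> k2 = k2 \<oplus> x \<otimes> k1" using lin by (simp add: m_comm a_comm)
  then have "k1 \<otimes> x \<oplus> k2 \<in> poly_values A x (Suc n)"
    using lin \<open>k1 \<in> poly_values A x n\<close> by auto
  then show ?case by blast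
qed

lemma integral_over_self: assumes "subring A R" "a \<in> A" shows "integral_over R A a"
proof -
  note p = subringE[OF assms(1)]
  have "a \<in> carrier R" using assms p(1) by auto
  then have "eval [\<one>, \<ominus> a] a = \<zero>" by (simp add: r_neg)
  moreover have "[\<one>, \<ominus> a] \<in> carrier (univ_poly R A)"
    unfolding univ_poly_carrier[symmetric] polynomial_def using p(3) p(5)[OF assms(2)] by simp
  ultimately show ?thesis unfolding integral_over_def by (intro bexI[of _ "[\<one>, \<ominus> a]"]) simp_all
qed

text \<open>An expression of \<open>x\<close> as a polynomial of degree \<open>n\<close> in its
  inverse becomes, after multiplication by \<open>x [^] n\<close>, a monic equation of degree
  \<open>n + 1\<close>.\<close>

lemma integral_if_in_inverse_extension:
  assumes A: "subring A R" and x: "x \<in> carrier R" "x \<noteq> \<zero>" "x \<in> simple_extension A (inv x)"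
  shows "integral_over R A x"
proof -
  note p = subringE[OF A]
  have As: "subgroup A (add_monoid R)" using A subring.axioms(1) by blast
  have w: "inv x \<in> carrier R" "x \<otimes> inv x = \<one>" using x field_Units by auto
  obtain n where "x \<in> poly_values A (inv x) n"
    using simple_extension_poly_values[OF x(3)] p w by auto
  then have "x \<otimes> x [^] n \<in> poly_values A x n" using poly_values_reverse[OF As x(1) w] by blast
  then obtain q where q: "set q \<subseteq> A" "length q = Suc n" "eval q x = x \<otimes> x [^] n"
    using poly_values_eval[OF p(1) x(1)] by blast
  have neg: "eval (map (\<lambda>a. \<ominus> a) r) x = \<ominus> eval r x" if "set r \<subseteq> carrier R" for r
    using that by (induction r) (use x eval_in_carrier in \<open>auto simp: l_minus minus_add\<close>)
  let ?p = "\<one> # map (\<lambda>a. \<ominus> a) q"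
  have "eval ?p x = x [^] Suc n \<oplus> \<ominus> (x \<otimes> x [^] n)"
    using neg[of q] q p(1) x by auto
  then have "eval ?p x = \<zero>" using x by (simp add: r_neg m_comm)
  moreover have "set (map (\<lambda>a. \<ominus> a) q) \<subseteq> A" using p(5) q(1) by auto
  then have "?p \<in> carrier (univ_poly R A)"
    unfolding univ_poly_carrier[symmetric] polynomial_def using p(3) by simp
  ultimately show ?thesis unfolding integral_over_def by (intro bexI[of _ ?p]) simp_all
qed

text \<open>In \<open>A[1/x]\<close> the element \<open>1/x\<close> is not invertible, since
  \<open>x\<close> would otherwise lie in this ring and be integral. Its multiples therefore avoid
  \<open>1\<close>, and Chevalley's theorem makes \<open>1/x\<close> a nonunit of some
  \<open>V\<close>, which then cannot contain \<open>x\<close>.\<close>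

lemma non_integral_valuation_subring:
  assumes A: "subring A R" and x: "x \<in> carrier R" "\<not> integral_over R A x"
  obtains V where "valuation_subring V" "A \<subseteq> V" "x \<notin> V"
proof -
  note p = subringE[OF A]
  have nz: "x \<noteq> \<zero>" using integral_over_self[OF A p(2)] x by auto
  have w: "inv x \<in> carrier R" "x \<otimes> inv x = \<one>" using x nz field_Units by auto
  define B where "B = simple_extension A (inv x)"
  have B: "subring B R" unfolding B_def using simple_extension_is_subring[OF A w(1)] .
  note b = subringE[OF B]
  have AB: "A \<subseteq> B" "inv x \<in> B" unfolding B_def
    using simple_extension_incl[OF p(1) w(1)] simple_extension_mem[OF A w(1)] by auto
  define J where "J = {inv x \<otimes> y | y. y \<in> B}"
  have J_in: "y \<otimes> j \<in> J" if y: "y \<in> B" "j \<in> J" for y j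
  proof -
    obtain z where z: "z \<in> B" "j = inv x \<otimes> z" using y unfolding J_def by auto
    have "y \<otimes> j = inv x \<otimes> (y \<otimes> z)" using z y b(1) w by (auto simp: m_ac subset_iff)
    then show ?thesis unfolding J_def using b(6)[OF y(1) z(1)] by blast
  qed
  have JB: "J \<subseteq> B" unfolding J_def using AB b(6) by auto
  have "subgroup J (add_monoid R)"
  proof (rule add.subgroupI)
    show "J \<subseteq> carrier R" using JB b(1) by auto
    show "J \<noteq> {}" unfolding J_def using b(3) by auto
  next
    fix a assume a: "a \<in> J"
    have "\<ominus> \<one> \<otimes> a \<in> J" using J_in[OF _ a] b(3,5) by auto
    then show "\<ominus> a \<in> J" using a JB b(1) by (simp add: l_minus subset_iff)
  next
    fix c d assume "c \<in> J" "d \<in> J"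
    then obtain y z where yz: "y \<in> B" "z \<in> B" "c = inv x \<otimes> y" "d = inv x \<otimes> z" unfolding J_def
        by auto
    have "c \<oplus> d = inv x \<otimes> (y \<oplus> z)" using yz b(1) w by (auto simp: r_distr subset_iff)
    then show "c \<oplus> d \<in> J" unfolding J_def using b(7)[OF yz(1,2)] by blast
  qed
  then have J: "mult_closed_subgroup R J" unfolding mult_closed_subgroup_def using J_in JB by blast
  have "\<one> \<notin> J"
  proof
    assume "\<one> \<in> J"
    then obtain y where y: "y \<in> B" "\<one> = inv x \<otimes> y" unfolding J_def by auto
    have "x = x \<otimes> (inv x \<otimes> y)" unfolding y(2)[symmetric] using x by simp
    also have "\<dots> = y" using w x(1) subsetD[OF b(1) y(1)] by (simp add: m_assoc[symmetric])
    finally have "x \<in> B" using y by simp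
    then show False using integral_if_in_inverse_extension[OF A x(1) nz] x unfolding B_def by blast
  qed
  then obtain V where V: "valuation_subring V" "A \<subseteq> V" "J \<subseteq> nonunits V"
    using chevalley[OF p(1) J] J_in AB by blast
  have "inv x \<otimes> \<one> \<in> J" unfolding J_def using b(3) by blast
  then have "inv x \<in> nonunits V" using V w by auto
  moreover have "inv x \<noteq> \<zero>" using w x by auto
  moreover have "inv (inv x) = x" using x nz field_Units by auto
  ultimately have "x \<notin> V" unfolding nonunits_def by auto
  then show thesis using that V by blast
qed

text \<open>By \<open>integral_in_valuation_subring\<close> and
  \<open>non_integral_valuation_subring\<close> the integral closure is the intersection of
  \<open>E\<close> with all valuation subrings containing \<open>A\<close>, and an intersection of
  subrings is a subring.\<close>

lemma integral_closure_subring: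
  assumes A: "subring A R" and E: "subring E R"
  shows "subring (integral_closure R A E) R"
proof -
  have "integral_closure R A E = \<Inter> (insert E {V. valuation_subring V \<and> A \<subseteq> V})"
  proof (intro equalityI subsetI)
    fix x assume "x \<in> integral_closure R A E"
    then show "x \<in> \<Inter> (insert E {V. valuation_subring V \<and> A \<subseteq> V})"
      using integral_in_valuation_subring subringE(1)[OF E] unfolding integral_closure_def by auto
  next
    fix x assume x: "x \<in> \<Inter> (insert E {V. valuation_subring V \<and> A \<subseteq> V})"
    then have "x \<in> carrier R" using subringE(1)[OF E] by auto
    then show "x \<in> integral_closure R A E"
      using x non_integral_valuation_subring[OF A, of x] unfolding integral_closure_def by auto
  qed
  then show ?thesis using subring_Inter[of "insert E {V. valuation_subring V \<and> A \<subseteq> V}"] E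
    unfolding valuation_subring_def by auto
qed

text \<open>Chevalley's theorem gives a valuation ring containing \<open>B\<close> whose nonunits
  contain \<open>P\<close>. It contains everything integral over \<open>A\<close>, so its nonunits
  cut out a prime \<open>P'\<close> of the larger integral closure. This yields only that
  \<open>P\<close> is contained in \<open>P'\<close>; the hypothesis \<open>max\<close>, which says
  that \<open>B/P\<close> is a field, turns the inclusion on \<open>B\<close> into an
  equality.\<close>

lemma lying_over:
  assumes A: "subring A R" and E: "subring E' R" "E \<subseteq> E'" "A \<subseteq> integral_closure R A E"
    and P: "primeideal P (R\<lparr>carrier := integral_closure R A E\<rparr>)"
    and max: "\<And>x. x \<in> integral_closure R A E \<Longrightarrow> x \<notin> P \<Longrightarrow> \<exists>y\<in>integral_closure R A E. x \<otimes> y \<ominus> \<one> \<in> P"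
  obtains P' where "primeideal P' (R\<lparr>carrier := integral_closure R A E'\<rparr>)"
    "P' \<inter> integral_closure R A E = P"
proof -
  define B B' where "B = integral_closure R A E" and "B' = integral_closure R A E'"
  interpret P: primeideal P "R\<lparr>carrier := B\<rparr>" using P unfolding B_def .
  have B': "subring B' R" unfolding B'_def by (rule integral_closure_subring[OF A E(1)])
  have BB': "B \<subseteq> B'" unfolding B_def B'_def integral_closure_def using E(2) by auto
  note b' = subringE[OF B']
  have Bc: "B \<subseteq> carrier R" using BB' b'(1) by auto
  have PB: "P \<subseteq> B" using P.a_subset by simp
  have smult: "b \<otimes> j \<in> P" if "b \<in> B" "j \<in> P" for b j using P.I_l_closed[OF that(2)] that by simp
  have oneB: "\<one> \<in> B" using P.one_closed by simp
  have oneP: "\<one> \<notin> P" using P.one_imp_carrier P.I_notcarr by auto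
  have negoneB: "\<ominus> \<one> \<in> B" using E(3) subringE(3,5)[OF A] unfolding B_def by auto
  have zP: "\<zero> \<in> P" using additive_subgroup.zero_closed[OF P.additive_subgroup_axioms] by simp
  have "subgroup P (add_monoid R)"
  proof (rule add.subgroupI)
    show "P \<subseteq> carrier R" "P \<noteq> {}" using PB Bc zP by auto
    show "a \<oplus> b \<in> P" if "a \<in> P" "b \<in> P" for a b
      using additive_subgroup.a_closed[OF P.additive_subgroup_axioms that] by simp
    show "\<ominus> a \<in> P" if "a \<in> P" for a using smult[OF negoneB that] that PB Bc
        by (auto simp: l_minus subset_iff)
  qed
  then have "mult_closed_subgroup R P" unfolding mult_closed_subgroup_def using smult PB by auto
  then obtain V where V: "valuation_subring V" "B \<subseteq> V" "P \<subseteq> nonunits V"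
    using chevalley[OF Bc _ oneP smult] by blast
  have B'V: "B' \<subseteq> V"
  proof
    fix x assume "x \<in> B'"
    then show "x \<in> V" using integral_in_valuation_subring[OF V(1), of A x] E(3) V(2) b'(1)
      unfolding B_def B'_def integral_closure_def by auto
  qed
  define P' where "P' = nonunits V \<inter> B'"
  interpret B': domain "R\<lparr>carrier := B'\<rparr>" using subring_is_domain[OF B'] .
  have sm: "b \<otimes> j \<in> P'" if "b \<in> B'" "j \<in> P'" for b j
    using that nonunits_smult[OF V(1)] B'V b'(6) unfolding P'_def by auto
  have id: "ideal P' (R\<lparr>carrier := B'\<rparr>)"
  proof (rule idealI[OF B'.ring_axioms])
    show "subgroup P' (add_monoid (R\<lparr>carrier := B'\<rparr>))"
    proof (rule B'.add.subgroupI)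
      show "P' \<subseteq> carrier (R\<lparr>carrier := B'\<rparr>)" unfolding P'_def by auto
      have "\<zero> \<in> nonunits V" using V(3) zP by auto
      then show "P' \<noteq> {}" unfolding P'_def using b'(2) by auto
      show "a \<oplus>\<^bsub>R\<lparr>carrier := B'\<rparr>\<^esub> b \<in> P'" if "a \<in> P'" "b \<in> P'" for a b
        using that nonunits_add[OF V(1)] b'(7) unfolding P'_def by auto
      show "\<ominus>\<^bsub>R\<lparr>carrier := B'\<rparr>\<^esub> a \<in> P'" if "a \<in> P'" for a
      proof -
        have a: "a \<in> B'" using that unfolding P'_def by auto
        have "\<ominus>\<^bsub>R\<lparr>carrier := B'\<rparr>\<^esub> a = \<ominus> a" 
          using a b'(1,5) by (intro B'.minus_equality) (auto simp: l_neg subset_iff)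
        also have "\<dots> = \<ominus> \<one> \<otimes> a" using a b'(1) by (auto simp: l_minus subset_iff)
        finally show ?thesis using sm[of "\<ominus> \<one>" a] that b'(3,5) by simp
      qed
    qed
  next
    fix a x assume ax: "a \<in> P'" "x \<in> carrier (R\<lparr>carrier := B'\<rparr>)"
    then show "x \<otimes>\<^bsub>R\<lparr>carrier := B'\<rparr>\<^esub> a \<in> P'" using sm by simp
    moreover have "x \<otimes> a = a \<otimes> x" using ax b'(1) unfolding P'_def by (auto intro: m_comm)
    ultimately show "a \<otimes>\<^bsub>R\<lparr>carrier := B'\<rparr>\<^esub> x \<in> P'" by simp
  qed
  have "primeideal P' (R\<lparr>carrier := B'\<rparr>)"
  proof (rule primeidealI[OF id B'.is_cring])
    show "carrier (R\<lparr>carrier := B'\<rparr>) \<noteq> P'"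
      using one_not_nonunit[OF V(1)] b'(3) unfolding P'_def by auto
    fix a b assume "a \<in> carrier (R\<lparr>carrier := B'\<rparr>)" "b \<in> carrier (R\<lparr>carrier := B'\<rparr>)"
      "a \<otimes>\<^bsub>R\<lparr>carrier := B'\<rparr>\<^esub> b \<in> P'"
    then show "a \<in> P' \<or> b \<in> P'" using nonunits_prime[OF V(1), of a b] B'V unfolding P'_def by auto
  qed
  moreover have "P' \<inter> B = P"
  proof
    show "P \<subseteq> P' \<inter> B" unfolding P'_def using PB BB' V(3) by auto
    show "P' \<inter> B \<subseteq> P"
    proof
      fix x assume x: "x \<in> P' \<inter> B"
      show "x \<in> P"
      proof (rule ccontr)
        assume "x \<notin> P"
        then obtain y where y: "y \<in> B" "x \<otimes> y \<ominus> \<one> \<in> P" using max x unfolding B_def by auto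
        have c: "x \<in> carrier R" "y \<in> carrier R" using x y Bc by auto
        have "y \<otimes> x \<in> nonunits V" using x y V(2) nonunits_smult[OF V(1)] unfolding P'_def by auto
        moreover have "\<ominus> \<one> \<otimes> (x \<otimes> y \<ominus> \<one>) \<in> nonunits V"
          using smult[OF negoneB y(2)] V(3) by auto
        ultimately have "y \<otimes> x \<oplus> \<ominus> \<one> \<otimes> (x \<otimes> y \<ominus> \<one>) \<in> nonunits V"
          using nonunits_add[OF V(1)] by blast
        moreover have "y \<otimes> x \<oplus> \<ominus> \<one> \<otimes> (x \<otimes> y \<ominus> \<one>) = \<one>" using c by algebra
        ultimately show False using one_not_nonunit[OF V(1)] by simp
      qed
    qed
  qed
  ultimately show thesis using that unfolding B_def B'_def by blast
qed


section \<open>Coordinate rings of affine charts\<close>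

lemma mult_interchange:
  "a \<in> carrier R \<Longrightarrow> b \<in> carrier R \<Longrightarrow> c \<in> carrier R \<Longrightarrow> d \<in> carrier R \<Longrightarrow>
     (a \<otimes> b) \<otimes> (c \<otimes> d) = (a \<otimes> c) \<otimes> (b \<otimes> d)"
  by (simp add: m_ac)

lemma finsum_in:
  assumes "T \<subseteq> carrier R" "\<zero> \<in> T" "\<And>a b. a \<in> T \<Longrightarrow> b \<in> T \<Longrightarrow> a \<oplus> b \<in> T"
    and "finite S" "\<And>m. m \<in> S \<Longrightarrow> f m \<in> T"
  shows "finsum R f S \<in> T"
  using assms(4,5)
proof (induction S)
  case (insert m S)
  then have "f \<in> S \<rightarrow> carrier R" "f m \<in> carrier R" using assms(1) by auto
  then show ?case using insert assms(3) by simp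
qed (use assms(2) in simp)

section \<open>Values of monomials and of homogeneous polynomials\<close>

definition monom_eval :: "(nat \<Rightarrow> 'a) \<Rightarrow> nat multiset \<Rightarrow> 'a" where
  "monom_eval x m = (\<Otimes>i\<in>set_mset m. x i [^] count m i)"

definition mpoly_single :: "'a \<Rightarrow> nat multiset \<Rightarrow> nat multiset \<Rightarrow> 'a" where
  "mpoly_single c m = (\<lambda>m'. if m' = m then c else \<zero>)"

lemma indexed_pset_support:
  assumes "p \<in> indexed_pset {..n} k" "subring k R"
  shows "p m \<in> k" "finite {m. p m \<noteq> \<zero>}" "p m \<noteq> \<zero> \<Longrightarrow> set_mset m \<subseteq> {..n}"
proof -
  note k = subringE[OF assms(2)]
  have "(\<forall>m. p m \<in> k) \<and> finite {m. p m \<noteq> \<zero>} \<and> (\<forall>m. p m \<noteq> \<zero> \<longrightarrow> set_mset m \<subseteq> {..n})"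
    using assms(1)
  proof induction
    case (indexed_const c)
    then show ?case using k(2) unfolding indexed_const_def by auto
  next
    case (indexed_padd p q)
    have "{m. indexed_padd p q m \<noteq> \<zero>} \<subseteq> {m. p m \<noteq> \<zero>} \<union> {m. q m \<noteq> \<zero>}"
      unfolding indexed_padd_def by auto
    moreover have "p m \<noteq> \<zero> \<or> q m \<noteq> \<zero>" if "indexed_padd p q m \<noteq> \<zero>" for m
      using that unfolding indexed_padd_def by auto
    ultimately show ?case using indexed_padd.IH k(7)
      by (metis (mono_tags, lifting) finite_Un finite_subset indexed_padd_def)
  next
    case (indexed_pmult p i)
    have "{m. indexed_pmult p i m \<noteq> \<zero>} \<subseteq> add_mset i ` {m. p m \<noteq> \<zero>}"
    proof
      fix m assume "m \<in> {m. indexed_pmult p i m \<noteq> \<zero>}"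
      then have "i \<in># m" "p (m - {#i#}) \<noteq> \<zero>" unfolding indexed_pmult_def by (auto split: if_splits)
      then show "m \<in> add_mset i ` {m. p m \<noteq> \<zero>}" by (intro image_eqI[of _ _ "m - {#i#}"]) auto
    qed
    then have "finite {m. indexed_pmult p i m \<noteq> \<zero>}" using indexed_pmult.IH finite_surj by blast
    moreover have "set_mset m \<subseteq> {..n}" if "indexed_pmult p i m \<noteq> \<zero>" for m
    proof -
      have "i \<in># m" "p (m - {#i#}) \<noteq> \<zero>"
        using that unfolding indexed_pmult_def by (auto split: if_splits)
      then have "set_mset (m - {#i#}) \<subseteq> {..n}" "m = add_mset i (m - {#i#})"
        using indexed_pmult.IH by auto
      then show ?thesis using indexed_pmult.hyps(2)
          by (metis insert_subset set_mset_add_mset_insert)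
    qed
    moreover have "indexed_pmult p i m \<in> k" for m
      using indexed_pmult.IH k(2) unfolding indexed_pmult_def by auto
    ultimately show ?case by blast
  qed
  then show "p m \<in> k" "finite {m. p m \<noteq> \<zero>}" "p m \<noteq> \<zero> \<Longrightarrow> set_mset m \<subseteq> {..n}" by auto
qed

lemma homogD:
  assumes "p \<in> homog R k n d" "subring k R"
  shows "p m \<in> k" "p m \<in> carrier R" "finite {m. p m \<noteq> \<zero>}" "p m \<noteq> \<zero> \<Longrightarrow> set_mset m \<subseteq> {..n}"
    "p m \<noteq> \<zero> \<Longrightarrow> size m = d"
proof -
  have "p \<in> indexed_pset {..n} k" using assms(1) unfolding homog_def mpoly_ring_def by simp
  note s = indexed_pset_support[OF this assms(2)]
  show "p m \<in> k" "finite {m. p m \<noteq> \<zero>}" "p m \<noteq> \<zero> \<Longrightarrow> set_mset m \<subseteq> {..n}" by (fact s)+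
  show "p m \<in> carrier R" using s(1) subringE(1)[OF assms(2)] by auto
  show "p m \<noteq> \<zero> \<Longrightarrow> size m = d" using assms(1) unfolding homog_def by auto
qed

lemma homog_padd:
  assumes "p \<in> homog R k n d" "q \<in> homog R k n d" "subring k R"
  shows "indexed_padd p q \<in> homog R k n d"
proof -
  have "indexed_padd p q m \<noteq> \<zero> \<Longrightarrow> size m = d" for m
    using homogD(5)[OF assms(1,3), of m] homogD(5)[OF assms(2,3), of m]
    unfolding indexed_padd_def by (metis r_zero zero_closed)
  then show ?thesis using assms indexed_pset.indexed_padd
    unfolding homog_def mpoly_ring_def by auto
qed

lemma mpoly_single_in_pset:
  assumes "c \<in> k" shows "set_mset m \<subseteq> I \<Longrightarrow> mpoly_single c m \<in> indexed_pset I k"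
proof (induction m)
  case empty
  have "mpoly_single c {#} = indexed_const c" unfolding mpoly_single_def indexed_const_def by auto
  moreover have "indexed_const c \<in> indexed_pset I k"
      by (rule indexed_pset.indexed_const) (fact assms)
  ultimately show ?case by simp
next
  case (add i m)
  have "mpoly_single c (add_mset i m) = indexed_pmult (mpoly_single c m) i"
    unfolding mpoly_single_def indexed_pmult_def by (auto simp: fun_eq_iff dest: insert_DiffM)
  moreover have "indexed_pmult (mpoly_single c m) i \<in> indexed_pset I k"
    by (rule indexed_pset.indexed_pmult) (use add in auto)
  ultimately show ?case by simp
qed

lemma mpoly_single_homog:
  assumes "c \<in> k" "set_mset m \<subseteq> {..n}" "size m = d" shows "mpoly_single c m \<in> homog R k n d"
  using mpoly_single_in_pset[OF assms(1,2)] assms(3)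
  unfolding homog_def mpoly_ring_def by (auto simp: mpoly_single_def split: if_splits)

context
  fixes x :: "nat \<Rightarrow> 'a" and n :: nat assumes x: "\<And>i. i \<le> n \<Longrightarrow> x i \<in> carrier R"
begin

lemma monom_eval_closed: "set_mset m \<subseteq> {..n} \<Longrightarrow> monom_eval x m \<in> carrier R"
  unfolding monom_eval_def using x by (intro finprod_closed) auto

text \<open>Over one common index set the exponents of two monomials can be added factor by factor;
  absent variables contribute the factor \<open>\<one>\<close>.\<close>

lemma monom_eval_superset:
  assumes "set_mset m \<subseteq> {..n}" shows "monom_eval x m = (\<Otimes>i\<in>{..n}. x i [^] count m i)"
  unfolding monom_eval_def using x assms
  by (intro finprod_mono_neutral_cong_left) (auto simp: not_in_iff)

lemma monom_eval_add:
  assumes "set_mset m \<subseteq> {..n}" "set_mset m' \<subseteq> {..n}"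
  shows "monom_eval x (m + m') = monom_eval x m \<otimes> monom_eval x m'"
proof -
  have 1: "(\<Otimes>i\<in>{..n}. x i [^] count (m + m') i) =
      (\<Otimes>i\<in>{..n}. x i [^] count m i \<otimes> x i [^] count m' i)"
    by (intro finprod_cong') (auto simp: x nat_pow_mult)
  have 2: "set_mset (m + m') \<subseteq> {..n}" using assms by auto
  show ?thesis unfolding monom_eval_superset[OF assms(1)] monom_eval_superset[OF assms(2)]
      monom_eval_superset[OF 2] 1
    using x by (intro finprod_multf) auto
qed

lemma monom_eval_replicate: "i \<le> n \<Longrightarrow> monom_eval x (replicate_mset d i) = x i [^] d"
  unfolding monom_eval_def using x by (cases "d = 0") auto

lemma meval_superset:
  assumes "\<And>m. p m \<in> carrier R" "\<And>m. p m \<noteq> \<zero> \<Longrightarrow> set_mset m \<subseteq> {..n}"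
    and "finite S" "{m. p m \<noteq> \<zero>} \<subseteq> S" "\<And>m. m \<in> S \<Longrightarrow> set_mset m \<subseteq> {..n}"
  shows "meval R p x = (\<Oplus>m\<in>S. p m \<otimes> monom_eval x m)"
  unfolding meval_def monom_eval_def[symmetric]
  using assms monom_eval_closed by (intro add.finprod_mono_neutral_cong_left) auto

lemma meval_single:
  assumes "c \<in> carrier R" "set_mset m \<subseteq> {..n}"
  shows "meval R (mpoly_single c m) x = c \<otimes> monom_eval x m"
proof -
  have "meval R (mpoly_single c m) x = (\<Oplus>m'\<in>{m}. mpoly_single c m m' \<otimes> monom_eval x m')"
    by (rule meval_superset) (use assms in \<open>auto simp: mpoly_single_def split: if_splits\<close>)
  then show ?thesis using assms monom_eval_closed by (simp add: mpoly_single_def)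
qed

context
  fixes k assumes k: "subring k R"
begin

lemma meval_closed: "f \<in> homog R k n d \<Longrightarrow> meval R f x \<in> carrier R"
  unfolding meval_def monom_eval_def[symmetric]
  using homogD[OF _ k] monom_eval_closed by (intro finsum_closed) (auto simp: Pi_def)

lemma meval_padd:
  assumes p: "p \<in> homog R k n d" and q: "q \<in> homog R k n d"
  shows "meval R (indexed_padd p q) x = meval R p x \<oplus> meval R q x"
proof -
  let ?S = "{m. p m \<noteq> \<zero>} \<union> {m. q m \<noteq> \<zero>}"
  note P = homogD[OF p k] and Q = homogD[OF q k]
  note PQ = homogD[OF homog_padd[OF p q k] k]
  have S: "finite ?S" "\<And>m. m \<in> ?S \<Longrightarrow> set_mset m \<subseteq> {..n}"
    using P(3) Q(3) P(4) Q(4) by blast+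
  have "meval R (indexed_padd p q) x = (\<Oplus>m\<in>?S. indexed_padd p q m \<otimes> monom_eval x m)"
    by (rule meval_superset[OF PQ(2) PQ(4) S(1) _ S(2)]) (auto simp: indexed_padd_def)
  also have "\<dots> = (\<Oplus>m\<in>?S. p m \<otimes> monom_eval x m \<oplus> q m \<otimes> monom_eval x m)"
    using P(2) Q(2) S(2) monom_eval_closed unfolding indexed_padd_def
    by (intro finsum_cong') (auto simp: l_distr)
  also have "\<dots> = (\<Oplus>m\<in>?S. p m \<otimes> monom_eval x m) \<oplus> (\<Oplus>m\<in>?S. q m \<otimes> monom_eval x m)"
    using P(2) Q(2) S(2) monom_eval_closed by (intro finsum_addf) auto
  also have "(\<Oplus>m\<in>?S. p m \<otimes> monom_eval x m) = meval R p x"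
    by (rule meval_superset[OF P(2) P(4) S(1) _ S(2), symmetric]) auto
  also have "(\<Oplus>m\<in>?S. q m \<otimes> monom_eval x m) = meval R q x"
    by (rule meval_superset[OF Q(2) Q(4) S(1) _ S(2), symmetric]) auto
  finally show ?thesis .
qed

text \<open>The numerators of the chart ring. These values are the sums of elements of
  \<open>k\<close> times values of monomials of degree \<open>d\<close>; working with values instead
  of polynomials reduces all products to products of monomials.\<close>

definition meval_set :: "nat \<Rightarrow> 'a set" where
  "meval_set d = (\<lambda>f. meval R f x) ` homog R k n d"

lemma meval_set_closed: "w \<in> meval_set d \<Longrightarrow> w \<in> carrier R"
  unfolding meval_set_def using meval_closed by auto

lemma meval_set_monom:
  assumes "c \<in> k" "set_mset m \<subseteq> {..n}" "size m = d" shows "c \<otimes> monom_eval x m \<in> meval_set d"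
proof -
  have "c \<in> carrier R" using assms(1) subringE(1)[OF k] by auto
  then show ?thesis unfolding meval_set_def
    using meval_single[OF _ assms(2)] mpoly_single_homog[OF assms] by (metis image_eqI)
qed

lemma meval_set_zero: "\<zero> \<in> meval_set d"
proof -
  have "\<zero> \<otimes> monom_eval x (replicate_mset d 0) \<in> meval_set d"
    by (rule meval_set_monom) (use subringE(2)[OF k] in auto)
  then show ?thesis using monom_eval_closed[of "replicate_mset d 0"] by (auto split: if_splits)
qed

lemma meval_set_add: "w \<in> meval_set d \<Longrightarrow> w' \<in> meval_set d \<Longrightarrow> w \<oplus> w' \<in> meval_set d"
proof -
  assume "w \<in> meval_set d" "w' \<in> meval_set d"
  then obtain f g where f: "f \<in> homog R k n d" "w = meval R f x"
      and g: "g \<in> homog R k n d" "w' = meval R g x"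
    unfolding meval_set_def by auto
  show ?thesis unfolding meval_set_def f(2) g(2)
    using meval_padd[OF f(1) g(1)] homog_padd[OF f(1) g(1) k]
        by (intro image_eqI[of _ _ "indexed_padd f g"]) simp_all
qed

lemma meval_set_span:
  assumes "T \<subseteq> carrier R" "\<zero> \<in> T" "\<And>a b. a \<in> T \<Longrightarrow> b \<in> T \<Longrightarrow> a \<oplus> b \<in> T"
    and "\<And>c m. c \<in> k \<Longrightarrow> set_mset m \<subseteq> {..n} \<Longrightarrow> size m = d \<Longrightarrow> c \<otimes> monom_eval x m \<in> T"
    and "w \<in> meval_set d"
  shows "w \<in> T"
proof -
  obtain f where f: "f \<in> homog R k n d" "w = meval R f x" using assms(5) unfolding meval_set_def
      by auto
  show ?thesis unfolding f(2) meval_def monom_eval_def[symmetric]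
    using homogD[OF f(1) k] assms(4) by (intro finsum_in[OF assms(1,2,3)]) auto
qed

text \<open>The elements whose product with a fixed value lies in degree \<open>d + e\<close> form
  an additive set, so it is enough to test them on monomials. \<open>meval_set_span\<close> is used
  in this way for each of the two factors.\<close>

lemma meval_set_mult:
  assumes "w \<in> meval_set d" "w' \<in> meval_set e" shows "w \<otimes> w' \<in> meval_set (d + e)"
proof -
  have kc: "\<And>c. c \<in> k \<Longrightarrow> c \<in> carrier R" using subringE(1)[OF k] by auto
  have 1: "c \<otimes> monom_eval x m \<otimes> v \<in> meval_set (d + e)"
    if c: "c \<in> k" "set_mset m \<subseteq> {..n}" "size m = d" and v: "v \<in> meval_set e" for c m v
  proof -
    have cm: "c \<otimes> monom_eval x m \<in> carrier R" using c kc monom_eval_closed by auto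
    have "v \<in> {v \<in> carrier R. c \<otimes> monom_eval x m \<otimes> v \<in> meval_set (d + e)}"
    proof (rule meval_set_span[OF _ _ _ _ v])
      fix c' m' assume c': "c' \<in> k" "set_mset m' \<subseteq> {..n}" "size m' = e"
      have "c \<otimes> monom_eval x m \<otimes> (c' \<otimes> monom_eval x m') = (c \<otimes> c') \<otimes> monom_eval x (m + m')"
        unfolding monom_eval_add[OF c(2) c'(2)]
        using c c' kc monom_eval_closed by (simp add: m_ac)
      moreover have "(c \<otimes> c') \<otimes> monom_eval x (m + m') \<in> meval_set (d + e)"
        by (rule meval_set_monom) (use c c' subringE(6)[OF k] in auto)
      ultimately show "c' \<otimes> monom_eval x m' \<in> {v \<in> carrier R. c \<otimes> monom_eval x m \<otimes> v \<in> meval_set (d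
          + e)}"
        using c' kc monom_eval_closed by auto
    qed (use cm meval_set_zero meval_set_add in \<open>auto simp: r_distr\<close>)
    then show ?thesis by simp
  qed
  have w': "w' \<in> carrier R" using meval_set_closed assms(2) by simp
  have "w \<in> {w \<in> carrier R. w \<otimes> w' \<in> meval_set (d + e)}"
    by (rule meval_set_span[OF _ _ _ _ assms(1)])
      (use 1 assms(2) w' kc monom_eval_closed meval_set_zero meval_set_add in \<open>auto simp: l_distr\<close>)
  then show ?thesis by simp
qed

lemma meval_set_power: "i \<le> n \<Longrightarrow> x i [^] d \<in> meval_set d"
  using meval_set_monom[of \<one> "replicate_mset d i" d] subringE(3)[OF k] monom_eval_replicate[of i d]
      x
  by (auto split: if_splits)

context
  fixes i assumes i: "i \<le> n" "x i \<noteq> \<zero>"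
begin

lemma chart_ring_alt: "chart_ring R k n x i = {w \<otimes> inv (x i [^] d) | w d. w \<in> meval_set d}"
  unfolding chart_ring_def meval_set_def by blast

lemma inv_power_props:
  "inv (x i [^] (d::nat)) \<in> carrier R" "x i [^] d \<otimes> inv (x i [^] d) = \<one>"
  "inv (x i [^] (d + e)) = inv (x i [^] d) \<otimes> inv (x i [^] e)"
proof -
  have nz: "x i [^] d \<in> carrier R - {\<zero>}" for d :: nat
    using x i by (induction d) (auto simp: integral_iff)
  show *: "inv (x i [^] d) \<in> carrier R" "x i [^] d \<otimes> inv (x i [^] d) = \<one>" for d :: nat
    using nz field_Units by auto
  have "x i [^] (d + e) \<otimes> (inv (x i [^] d) \<otimes> inv (x i [^] e)) =
      (x i [^] d \<otimes> inv (x i [^] d)) \<otimes> (x i [^] e \<otimes> inv (x i [^] e))"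
    unfolding nat_pow_mult[OF x[OF i(1)], symmetric] using nz * by (intro mult_interchange) auto
  then show "inv (x i [^] (d + e)) = inv (x i [^] d) \<otimes> inv (x i [^] e)"
    using * nz by (intro comm_inv_char) auto
qed

lemma base_in_chart_ring: "k \<subseteq> chart_ring R k n x i"
proof
  fix c assume c: "c \<in> k"
  have "c \<in> carrier R" using c subringE(1)[OF k] by auto
  moreover have "c \<otimes> monom_eval x {#} \<in> meval_set 0" by (rule meval_set_monom) (use c in auto)
  ultimately have "c = c \<otimes> inv (x i [^] (0::nat))" "c \<in> meval_set 0"
    by (auto simp: monom_eval_def)
  then show "c \<in> chart_ring R k n x i" unfolding chart_ring_alt by blast
qed

lemma chart_ring_subring: "subring (chart_ring R k n x i) R"
proof -
  let ?A = "chart_ring R k n x i"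
  have xi: "x i \<in> carrier R" using x i by auto
  have c: "?A \<subseteq> carrier R" unfolding chart_ring_alt using meval_set_closed inv_power_props by auto
  have mult: "a \<otimes> b \<in> ?A" if ab: "a \<in> ?A" "b \<in> ?A" for a b
  proof -
    obtain w d w' e where w: "a = w \<otimes> inv (x i [^] d)" "w \<in> meval_set d"
      "b = w' \<otimes> inv (x i [^] e)" "w' \<in> meval_set e"
      using ab unfolding chart_ring_alt by blast
    have "a \<otimes> b = (w \<otimes> w') \<otimes> inv (x i [^] (d + e))"
      unfolding w(1,3) inv_power_props(3)
      using meval_set_closed[OF w(2)] meval_set_closed[OF w(4)] inv_power_props(1)
          by (simp add: m_ac)
    then show ?thesis unfolding chart_ring_alt using meval_set_mult[OF w(2,4)] by blast
  qed
  show ?thesis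
  proof (rule subringI[OF c])
    show "\<one> \<in> ?A" using base_in_chart_ring subringE(3)[OF k] by auto
    fix a b assume ab: "a \<in> ?A" "b \<in> ?A"
    show "a \<otimes> b \<in> ?A" using mult[OF ab] .
    have "\<ominus> \<one> \<otimes> a \<in> ?A"
      using mult[of "\<ominus> \<one>"] ab base_in_chart_ring subringE(3,5)[OF k] by auto
    then show "\<ominus> a \<in> ?A" using ab c by (simp add: l_minus subset_iff)
    obtain w d w' e where w: "a = w \<otimes> inv (x i [^] d)" "w \<in> meval_set d"
      "b = w' \<otimes> inv (x i [^] e)" "w' \<in> meval_set e"
      using ab unfolding chart_ring_alt by blast
    let ?s = "w \<otimes> x i [^] e \<oplus> w' \<otimes> x i [^] d"
    have wc: "w \<in> carrier R" "w' \<in> carrier R" using meval_set_closed w(2,4) by auto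
    have "?s \<otimes> inv (x i [^] (d + e)) =
       (w \<otimes> x i [^] e) \<otimes> (inv (x i [^] d) \<otimes> inv (x i [^] e)) \<oplus> (w' \<otimes> x i [^] d) \<otimes> (inv (x i [^] d) \<otimes>
           inv (x i [^] e))"
      unfolding inv_power_props(3) using wc xi inv_power_props(1) by (intro l_distr) auto
    also have "(w \<otimes> x i [^] e) \<otimes> (inv (x i [^] d) \<otimes> inv (x i [^] e)) = (w \<otimes> inv (x i [^] d)) \<otimes> (x i
        [^] e \<otimes> inv (x i [^] e))"
      using wc xi inv_power_props(1) by (intro mult_interchange) auto
    also have "(w' \<otimes> x i [^] d) \<otimes> (inv (x i [^] d) \<otimes> inv (x i [^] e)) = (x i [^] d \<otimes> inv (x i [^]
        d)) \<otimes> (w' \<otimes> inv (x i [^] e))"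
      using wc xi inv_power_props(1) by (simp add: m_ac)
    finally have "a \<oplus> b = ?s \<otimes> inv (x i [^] (d + e))"
      unfolding inv_power_props(2) w(1,3) using wc inv_power_props(1) by simp
    moreover have "?s \<in> meval_set (d + e)"
      using meval_set_add[OF meval_set_mult[OF w(2) meval_set_power[OF i(1), of e]]]
        meval_set_mult[OF w(4) meval_set_power[OF i(1), of d]] by (simp add: add.commute)
    ultimately show "a \<oplus> b \<in> ?A" unfolding chart_ring_alt by blast
  qed
qed

end

end

end

text \<open>If \<open>a\<close> is \<open>f(x) / x_i^d\<close>, the constant is the value
  \<open>c = f(t) / t_i^d\<close> at the point: \<open>a - c\<close> has the numerator
  \<open>f - c X_i^d\<close>, which is homogeneous of degree \<open>d\<close> and vanishes at
  \<open>t\<close>. So a point with coordinates in \<open>k\<close> has residue field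
  \<open>k\<close>.\<close>

lemma chart_ring_residue:
  assumes k: "subfield k R" and x: "\<And>i. i \<le> n \<Longrightarrow> x i \<in> carrier R" and i: "i \<le> n" "x i \<noteq> \<zero>"
    and t: "\<And>i. i \<le> n \<Longrightarrow> t i \<in> k" "t i \<noteq> \<zero>"
    and a: "a \<in> chart_ring R k n x i"
  shows "\<exists>c\<in>k. a \<ominus> c \<in> chart_max_ideal R k n x i t"
proof -
  note kr = subfieldE(1)[OF k]
  note ks = subringE[OF kr]
  have tc: "t i \<in> carrier R" if "i \<le> n" for i using t(1)[OF that] ks(1) by auto
  obtain f d where f: "a = meval R f x \<otimes> inv (x i [^] d)" "f \<in> homog R k n d"
    using a unfolding chart_ring_def by blast
  have pw: "s [^] m \<in> k" if "s \<in> k" for s and m :: nat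
    by (induction m) (use ks that in auto)
  have monk: "monom_eval t m \<in> k" if "set_mset m \<subseteq> {..n}" for m
  proof -
    have "finite A \<Longrightarrow> A \<subseteq> {..n} \<Longrightarrow> (\<Otimes>i\<in>A. t i [^] count m i) \<in> k" for A
    proof (induction A rule: finite_induct)
      case (insert j A)
      then show ?case using t tc pw ks(6) by (subst finprod_insert) auto
    qed (use ks in simp)
    then show ?thesis unfolding monom_eval_def using that by simp
  qed
  have ftk: "meval R f t \<in> k"
    unfolding meval_def monom_eval_def[symmetric]
    using homogD[OF f(2) kr] monk ks by (intro finsum_in) auto
  have T: "inv (t i [^] d) \<in> k" "inv (t i [^] d) \<otimes> t i [^] d = \<one>"
  proof -
    have "t i [^] d \<noteq> \<zero>" using tc[OF i(1)] t(2) by (induction d) (auto simp: integral_iff)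
    then have "t i [^] d \<in> k - {\<zero>}" using pw[OF t(1)[OF i(1)]] by auto
    then show "inv (t i [^] d) \<in> k" "inv (t i [^] d) \<otimes> t i [^] d = \<one>" using subfield_m_inv[OF k]
        by auto
  qed
  define c where "c = meval R f t \<otimes> inv (t i [^] d)"
  have ck: "c \<in> k" "\<ominus> c \<in> k" "c \<in> carrier R" unfolding c_def using ftk T ks by auto
  \<comment> \<open>The polynomial \<open>- c X_i^d\<close>, homogeneous of the same degree as
    \<open>f\<close>.\<close>
  let ?s = "mpoly_single (\<ominus> c) (replicate_mset d i)"
  let ?f = "indexed_padd f ?s"
  have s: "?s \<in> homog R k n d" using ck i by (intro mpoly_single_homog) (auto split: if_splits)
  have ev: "meval R ?f y = meval R f y \<oplus> \<ominus> c \<otimes> y i [^] d" if y: "\<And>i. i \<le> n \<Longrightarrow> y i \<in> carrier R" for y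
    using meval_padd[of n y k f d ?s, OF y kr f(2) s] meval_single[of n y "\<ominus> c"
        "replicate_mset d i", OF y]
      monom_eval_replicate[of n y i d, OF y i(1)] ck i by (auto split: if_splits)
  have "c \<otimes> t i [^] d = meval R f t \<otimes> (inv (t i [^] d) \<otimes> t i [^] d)"
    unfolding c_def using ftk T(1) ks(1) tc[OF i(1)] by (intro m_assoc) auto
  then have ct: "c \<otimes> t i [^] d = meval R f t" unfolding T(2) using ftk ks(1) by auto
  have "meval R ?f t = meval R f t \<oplus> \<ominus> c \<otimes> t i [^] d" by (rule ev) (rule tc)
  also have "\<dots> = meval R f t \<oplus> \<ominus> meval R f t"
    unfolding ct[symmetric] using tc[OF i(1)] ck(3) by (simp add: l_minus)
  also have "\<dots> = \<zero>" using ftk ks(1) by (auto simp: r_neg)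
  finally have ft: "meval R ?f t = \<zero>" .
  have fh: "?f \<in> homog R k n d" using homog_padd[OF f(2) s kr] .
  have fx: "meval R ?f x \<otimes> inv (x i [^] d) = a \<ominus> c"
  proof -
    note ip = inv_power_props[of n x k i, OF x kr i]
    have fx: "meval R f x \<in> carrier R" using meval_closed[of n x k f d, OF x kr f(2)] .
    have "meval R ?f x \<otimes> inv (x i [^] d) = meval R f x \<otimes> inv (x i [^] d) \<oplus> \<ominus> c \<otimes> (x i [^] d \<otimes> inv (x
        i [^] d))"
      using ev[of x] fx ck ip(1) x x[OF i(1)] by (simp add: l_distr m_assoc)
    also have "x i [^] d \<otimes> inv (x i [^] d) = \<one>" by (rule ip(2))
    also have "meval R f x \<otimes> inv (x i [^] d) \<oplus> \<ominus> c \<otimes> \<one> = a \<ominus> c" unfolding f(1) minus_eq using ck(3)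
        by simp
    finally show ?thesis .
  qed
  have "a \<ominus> c \<in> chart_max_ideal R k n x i t"
    unfolding chart_max_ideal_def fx[symmetric] using fh ft by blast
  then show ?thesis using ck by blast
qed

text \<open>If this coordinate of the generic point were zero, the linear form \<open>X_i\<close>
  would belong to the ideal and would vanish at \<open>t\<close> as well.\<close>

lemma generic_point_nonzero:
  assumes k: "subfield k R" and g: "generic_point R k n J x" and t: "proj_point R k n J t"
      and i: "i \<le> n" "t i \<noteq> \<zero>"
  shows "x i \<noteq> \<zero>"
proof
  assume xi: "x i = \<zero>"
  note ks = subringE[OF subfieldE(1)[OF k]]
  have x: "\<And>i. i \<le> n \<Longrightarrow> x i \<in> carrier R" using g unfolding generic_point_def by auto
  have tc: "\<And>i. i \<le> n \<Longrightarrow> t i \<in> carrier R" using t ks(1) unfolding proj_point_def by auto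
  let ?f = "mpoly_single \<one> {#i#}"
  have f: "?f \<in> homog R k n 1" by (rule mpoly_single_homog) (use ks i in auto)
  have ev: "meval R ?f y = y i" if "\<And>i. i \<le> n \<Longrightarrow> y i \<in> carrier R" for y
    using meval_single[of n y \<one> "{#i#}", OF that] that[OF i(1)] i by (auto simp: monom_eval_def)
  have "meval R ?f x = \<zero> \<longleftrightarrow> ?f \<in> J" using g f unfolding generic_point_def by blast
  then have "?f \<in> J" using ev[OF x] xi by simp
  then have "meval R ?f t = \<zero>" using t f unfolding proj_point_def by blast
  then show False using ev[OF tc] i by simp
qed

text \<open>Used to see that the chart ring lies in its integral closure \<open>B\<close> inside the
  compositum: an element of \<open>A\<close> differs from a constant by an element of
  \<open>P\<close>, which is a subset of \<open>B\<close>. The position of the function field inside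
  the compositum need not be examined.\<close>

lemma residue_subset:
  assumes "A \<subseteq> carrier R" "subring B R" "k \<subseteq> B" "P \<subseteq> B"
    and res: "\<And>a. a \<in> A \<Longrightarrow> \<exists>c\<in>k. a \<ominus> c \<in> P"
  shows "A \<subseteq> B"
proof
  fix a assume a: "a \<in> A"
  note b = subringE[OF assms(2)]
  obtain c where c: "c \<in> k" "a \<ominus> c \<in> P" using res a by blast
  have ac: "a \<in> carrier R" "c \<in> carrier R" using a c assms(1,3) b(1) by auto
  have "a = (a \<ominus> c) \<oplus> c" using ac by (simp add: minus_eq a_assoc l_neg)
  then show "a \<in> B" using b(7)[of "a \<ominus> c" c] c assms(3,4) by auto
qed

text \<open>Modulo \<open>P\<close> the ring \<open>A\<close> reduces to the field \<open>k\<close>,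
  so \<open>B/P\<close> is a domain whose elements are algebraic over a field, hence is itself a
  field. The conclusion is the form in which \<open>lying_over\<close> asks for maximality of
  \<open>P\<close>.\<close>

lemma residue_integral_inverse:
  assumes A: "subring A R" and E: "subring E R" and k: "subfield k R" "k \<subseteq> B"
    and B: "B = integral_closure R A E" and P: "primeideal P (R\<lparr>carrier := B\<rparr>)"
    and res: "\<And>a. a \<in> A \<Longrightarrow> \<exists>c\<in>k. a \<ominus> c \<in> P"
    and x: "x \<in> B" "x \<notin> P"
  shows "\<exists>y\<in>B. x \<otimes> y \<ominus> \<one> \<in> P"
proof -
  interpret P: primeideal P "R\<lparr>carrier := B\<rparr>" by fact
  have Bs: "subring B R" unfolding B by (rule integral_closure_subring[OF A E])
  note b = subringE[OF Bs] and ks = subringE[OF subfieldE(1)[OF k(1)]] and as = subringE[OF A]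
  have PB: "P \<subseteq> B" using P.a_subset by simp
  have smult: "u \<otimes> j \<in> P" if "u \<in> B" "j \<in> P" for u j using P.I_l_closed[OF that(2)] that by simp
  have add: "u \<oplus> j \<in> P" if "u \<in> P" "j \<in> P" for u j
    using additive_subgroup.a_closed[OF P.additive_subgroup_axioms that] by simp
  have neg: "\<ominus> j \<in> P" if "j \<in> P" for j
    using smult[OF _ that, of "\<ominus> \<one>"] b(1,3,5) that PB by (auto simp: l_minus subset_iff)
  have sub: "u \<ominus> j \<in> P" if "u \<in> P" "j \<in> P" for u j
    unfolding minus_eq using add neg that by blast
  have oneP: "\<one> \<notin> P" using P.one_imp_carrier P.I_notcarr by auto
  have AB: "A \<subseteq> B" by (rule residue_subset[OF as(1) Bs k(2) PB res])
  have xc: "x \<in> carrier R" using x b(1) by auto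
  have evB: "eval q x \<in> B" if "set q \<subseteq> B" for q
  proof -
    have pw: "x [^] m \<in> B" for m :: nat by (induction m) (use x b in auto)
    show ?thesis using that by (induction q) (use b pw in auto)
  qed
  \<comment> \<open>A monic equation that holds only modulo \<open>P\<close> survives the induction.
    Its constant term is congruent to some \<open>c\<close> in \<open>k\<close>. If \<open>c\<close>
    is zero, the term is dropped and a factor \<open>x\<close> is cancelled because \<open>P\<close>
    is prime; otherwise solving the equation for \<open>c\<close> exhibits an inverse of
    \<open>x\<close>.\<close>
  have main: "\<exists>y\<in>B. x \<otimes> y \<ominus> \<one> \<in> P"
    if "set p \<subseteq> A" "p \<noteq> []" "hd p = \<one>" "eval p x \<in> P" for p
    using that
  proof (induction p rule: rev_induct)
    case (snoc a q)
    have a: "a \<in> A" "set q \<subseteq> A" using snoc.prems by auto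
    then obtain c where c: "c \<in> k" "a \<ominus> c \<in> P" using res by blast
    have ac: "a \<in> carrier R" "c \<in> carrier R" "eval q x \<in> carrier R"
      using a c as(1) ks(1) eval_in_carrier[of q x] xc by auto
    have ev: "eval (q @ [a]) x = eval q x \<otimes> x \<oplus> a"
      using eval_append_aux[of q a x] a as(1) xc by auto
    show ?case
    proof (cases "c = \<zero>")
      case True
      then have aP: "a \<in> P" using c ac by (simp add: minus_eq)
      have "q \<noteq> []"
      proof
        assume "q = []"
        then show False using snoc.prems oneP aP by simp
      qed
      have "(eval q x \<otimes> x \<oplus> a) \<ominus> a \<in> P" using sub[OF _ aP] snoc.prems(4) ev by simp
      moreover have "(eval q x \<otimes> x \<oplus> a) \<ominus> a = eval q x \<otimes> x"
        using ac xc by (simp add: minus_eq a_assoc r_neg)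
      ultimately have "eval q x \<in> P" 
        using P.I_prime[of "eval q x" x] evB[of q] a AB x by auto
      then show ?thesis using snoc.IH a \<open>q \<noteq> []\<close> snoc.prems(3) by simp
    next
      case False
      then have ic: "inv c \<in> k" "inv c \<otimes> c = \<one>" using subfield_m_inv[OF k(1)] c by auto
      have icc: "inv c \<in> carrier R" using ic ks(1) by auto
      define y where "y = \<ominus> (inv c) \<otimes> eval q x"
      have yB: "y \<in> B" unfolding y_def using b(5,6) ic k(2) evB[of q] a AB by auto
      have "\<ominus> (inv c) \<otimes> (eval (q @ [a]) x \<ominus> (a \<ominus> c)) \<in> P"
        using smult sub c(2) snoc.prems(4) b(5) ic k(2) by auto
      moreover have "eval (q @ [a]) x \<ominus> (a \<ominus> c) = eval q x \<otimes> x \<oplus> c"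
        unfolding ev using ac xc by algebra
      moreover have "\<ominus> (inv c) \<otimes> (eval q x \<otimes> x \<oplus> c) = x \<otimes> y \<ominus> (inv c) \<otimes> c"
        unfolding y_def using ac xc icc by algebra
      ultimately show ?thesis using yB ic(2) by auto
    qed
  qed simp
  obtain p where p: "p \<in> carrier (univ_poly R A)" "p \<noteq> []" "lead_coeff p = \<one>" "eval p x = \<zero>"
    using x(1) unfolding B integral_closure_def integral_over_def by auto
  have "set p \<subseteq> A" using p(1) unfolding univ_poly_carrier[symmetric] polynomial_def by auto
  moreover have "\<zero> \<in> P" using additive_subgroup.zero_closed[OF P.additive_subgroup_axioms] by simp
  ultimately show ?thesis using main p by simp
qed


section \<open>Extending field embeddings\<close>

abbreviation restricted_hom :: "'a set \<Rightarrow> ('a \<Rightarrow> 'a) \<Rightarrow> bool" where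
  "restricted_hom D f \<equiv> f \<in> ring_hom (R\<lparr>carrier := D\<rparr>) R"

lemma restricted_homI:
  assumes "\<And>x. x \<in> D \<Longrightarrow> f x \<in> carrier R"
    "\<And>x y. x \<in> D \<Longrightarrow> y \<in> D \<Longrightarrow> f (x \<otimes> y) = f x \<otimes> f y"
    "\<And>x y. x \<in> D \<Longrightarrow> y \<in> D \<Longrightarrow> f (x \<oplus> y) = f x \<oplus> f y" "f \<one> = \<one>"
  shows "restricted_hom D f"
  using assms by (intro ring_hom_memI) auto

lemma restricted_homD:
  assumes "restricted_hom D f"
  shows "\<And>x. x \<in> D \<Longrightarrow> f x \<in> carrier R"
    "\<And>x y. x \<in> D \<Longrightarrow> y \<in> D \<Longrightarrow> f (x \<otimes> y) = f x \<otimes> f y"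
    "\<And>x y. x \<in> D \<Longrightarrow> y \<in> D \<Longrightarrow> f (x \<oplus> y) = f x \<oplus> f y" "f \<one> = \<one>"
  using ring_hom_memE[OF assms] by auto

lemma restricted_hom_ring:
  assumes "subring D R" "restricted_hom D f" shows "ring_hom_ring (R\<lparr>carrier := D\<rparr>) R f"
  using ring_hom_ringI2[OF subring_is_ring[OF assms(1)] ring_axioms assms(2)] .

lemma restricted_hom_zero:
  assumes "subring D R" "restricted_hom D f" shows "f \<zero> = \<zero>"
proof -
  interpret H: ring_hom_ring "R\<lparr>carrier := D\<rparr>" R f by (rule restricted_hom_ring[OF assms])
  show ?thesis using H.hom_zero by simp
qed

lemma restricted_hom_eval:
  assumes D: "subring D R" and f: "restricted_hom D f" and "set p \<subseteq> D" "x \<in> D"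
  shows "f (eval p x) = eval (map f p) (f x)"
proof -
  interpret H: ring_hom_ring "R\<lparr>carrier := D\<rparr>" R f by (rule restricted_hom_ring[OF D f])
  show ?thesis using H.eval_hom'[of x p] assms(3,4) eval_consistent[OF D] by simp
qed

lemma poly_set: "p \<in> carrier (univ_poly R D) \<Longrightarrow> set p \<subseteq> D"
  unfolding univ_poly_carrier[symmetric] polynomial_def by auto

text \<open>Mapping the coefficients may create leading zeros, so the lists agree only after
  normalization, which does not affect evaluation.\<close>

lemma mapped_eval_hom:
  assumes D: "subring D R" and f: "restricted_hom D f" and y: "y \<in> carrier R"
    and p: "p \<in> carrier (univ_poly R D)" and q: "q \<in> carrier (univ_poly R D)"
  shows "eval (map f (p \<oplus>\<^bsub>univ_poly R D\<^esub> q)) y = eval (map f p) y \<oplus> eval (map f q) y"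
    and "eval (map f (p \<otimes>\<^bsub>univ_poly R D\<^esub> q)) y = eval (map f p) y \<otimes> eval (map f q) y"
proof -
  interpret H: ring_hom_ring "R\<lparr>carrier := D\<rparr>" R f by (rule restricted_hom_ring[OF D f])
  interpret UP: ring "univ_poly R D" using univ_poly_is_ring[OF D] .
  have sp: "set p \<subseteq> D" "set q \<subseteq> D" using p q poly_set by auto
  have mc: "set (map f r) \<subseteq> carrier R" if "set r \<subseteq> D" for r using that restricted_homD(1)[OF f]
      by auto
  have "eval (map f (p \<oplus>\<^bsub>univ_poly R D\<^esub> q)) y = eval (normalize (map f (p \<oplus>\<^bsub>univ_poly R D\<^esub> q))) y"
    using eval_normalize[OF mc[OF poly_set[OF UP.a_closed[OF p q]]] y] by simp
  also have "normalize (map f (p \<oplus>\<^bsub>univ_poly R D\<^esub> q)) = poly_add (map f p) (map f q)"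
    using H.poly_add_hom'[of p q] sp unfolding univ_poly_add poly_add_consistent[OF D] by simp
  also have "eval (poly_add (map f p) (map f q)) y = eval (map f p) y \<oplus> eval (map f q) y"
    by (rule eval_poly_add[OF mc[OF sp(1)] mc[OF sp(2)] y])
  finally show "eval (map f (p \<oplus>\<^bsub>univ_poly R D\<^esub> q)) y = eval (map f p) y \<oplus> eval (map f q) y" .
  have "eval (map f (p \<otimes>\<^bsub>univ_poly R D\<^esub> q)) y = eval (normalize (map f (p \<otimes>\<^bsub>univ_poly R D\<^esub> q))) y"
    using eval_normalize[OF mc[OF poly_set[OF UP.m_closed[OF p q]]] y] by simp
  also have "normalize (map f (p \<otimes>\<^bsub>univ_poly R D\<^esub> q)) = poly_mult (map f p) (map f q)"
    using H.poly_mult_hom'[of p q] sp unfolding univ_poly_mult poly_mult_consistent[OF D] by simp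
  also have "eval (poly_mult (map f p) (map f q)) y = eval (map f p) y \<otimes> eval (map f q) y"
    by (rule eval_poly_mult[OF mc[OF sp(1)] mc[OF sp(2)] y])
  finally show "eval (map f (p \<otimes>\<^bsub>univ_poly R D\<^esub> q)) y = eval (map f p) y \<otimes> eval (map f q) y" .
qed

text \<open>Two polynomials with the same value at \<open>x\<close> differ by a multiple of
  \<open>Irr D x\<close>. After application of \<open>f\<close> to the coefficients, such a multiple
  vanishes at \<open>y\<close>, so the assignment of \<open>eval (map f p) y\<close> to
  \<open>eval p x\<close> is well defined.\<close>

lemma extend_hom_simple:
  assumes D: "subfield D R" and x: "x \<in> carrier R" "(algebraic over D) x"
    and f: "restricted_hom D f" and y: "y \<in> carrier R" "eval (map f (Irr D x)) y = \<zero>"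
  obtains g where "restricted_hom (simple_extension D x) g" "\<And>d. d \<in> D \<Longrightarrow> g d = f d" "g x = y"
proof -
  note Dr = subfieldE(1)[OF D]
  note d = subringE[OF Dr]
  let ?P = "univ_poly R D"
  interpret UP: domain ?P using univ_poly_is_domain[OF Dr] .
  interpret ev: ring_hom_ring ?P R "\<lambda>p. eval p x" using eval_ring_hom[OF Dr x(1)] .
  note irr = IrrE[OF D x]
  note hom = mapped_eval_hom[OF Dr f y(1)]
  have fc: "eval (map f p) y \<in> carrier R" if "p \<in> carrier ?P" for p
  proof -
    have "set (map f p) \<subseteq> carrier R" using poly_set[OF that] restricted_homD(1)[OF f] by auto
    then show ?thesis by (rule eval_in_carrier[OF _ y(1)])
  qed
  have wd: "eval (map f p) y = eval (map f q) y"
    if pq: "p \<in> carrier ?P" "q \<in> carrier ?P" "eval p x = eval q x" for p q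
  proof -
    let ?r = "p \<ominus>\<^bsub>?P\<^esub> q"
    have r: "?r \<in> carrier ?P" using pq by simp
    have ex: "eval p x \<in> carrier R" "eval q x \<in> carrier R" using pq ev.hom_closed by auto
    have "eval ?r x = \<zero>" unfolding UP.minus_eq using pq ex by (simp add: r_neg)
    then have "?r \<in> a_kernel ?P R (\<lambda>p. eval p x)" using r unfolding a_kernel_def' by auto
    then have "?r \<in> PIdl\<^bsub>?P\<^esub> (Irr D x)" using Irr_generates_ker[OF D x] by simp
    then obtain s where s: "s \<in> carrier ?P" "?r = s \<otimes>\<^bsub>?P\<^esub> Irr D x" unfolding cgenideal_def by auto
    have "p = ?r \<oplus>\<^bsub>?P\<^esub> q" using pq by (simp add: UP.minus_eq UP.a_assoc UP.l_neg)
    then have "eval (map f p) y = eval (map f ?r) y \<oplus> eval (map f q) y"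
      using hom(1)[OF r pq(2)] by simp
    also have "eval (map f ?r) y = eval (map f s) y \<otimes> eval (map f (Irr D x)) y"
      unfolding s(2) using hom(2)[OF s(1) irr(1)] .
    also have "\<dots> = \<zero>" unfolding y(2) using fc[OF s(1)] by simp
    finally show ?thesis using fc[OF pq(2)] by simp
  qed
  define g where "g z = eval (map f (SOME p. p \<in> carrier ?P \<and> eval p x = z)) y" for z
  have g: "g (eval p x) = eval (map f p) y" if "p \<in> carrier ?P" for p
  proof -
    have "\<exists>q. q \<in> carrier ?P \<and> eval q x = eval p x" using that by blast
    then have "(SOME q. q \<in> carrier ?P \<and> eval q x = eval p x) \<in> carrier ?P \<and>
       eval (SOME q. q \<in> carrier ?P \<and> eval q x = eval p x) x = eval p x" by (rule someI_ex)
    then show ?thesis unfolding g_def using wd that by blast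
  qed
  have img: "\<exists>p\<in>carrier ?P. z = eval p x" if "z \<in> simple_extension D x" for z
    using that simple_extension_as_eval_img[OF d(1) x(1)] by auto
  have gD: "g a = f a" if a: "a \<in> D" for a
  proof -
    have ac: "a \<in> carrier R" "f a \<in> carrier R" using a d(1) restricted_homD(1)[OF f a] by auto
    show ?thesis
    proof (cases "a = \<zero>")
      case True
      have "[] \<in> carrier ?P" by (rule univ_poly_zero_closed)
      then show ?thesis using g[of "[]"] True restricted_hom_zero[OF Dr f] by simp
    next
      case False
      then have "[a] \<in> carrier ?P" unfolding univ_poly_carrier[symmetric] polynomial_def using a
          by simp
      then show ?thesis using g[of "[a]"] ac by simp
    qed
  qed
  have "restricted_hom (simple_extension D x) g"
  proof (rule restricted_homI)
    fix a assume "a \<in> simple_extension D x"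
    then show "g a \<in> carrier R" using img[of a] g fc by auto
  next
    fix a b assume ab: "a \<in> simple_extension D x" "b \<in> simple_extension D x"
    obtain p q where p: "p \<in> carrier ?P" "a = eval p x" and q: "q \<in> carrier ?P" "b = eval q x"
      using img[OF ab(1)] img[OF ab(2)] by blast
    have "a \<otimes> b = eval (p \<otimes>\<^bsub>?P\<^esub> q) x" unfolding p(2) q(2) using ev.hom_mult[OF p(1) q(1)] by simp
    then show "g (a \<otimes> b) = g a \<otimes> g b"
      using g[OF UP.m_closed[OF p(1) q(1)]] hom(2)[OF p(1) q(1)] g[OF p(1)] g[OF q(1)] p(2) q(2)
          by simp
    have "a \<oplus> b = eval (p \<oplus>\<^bsub>?P\<^esub> q) x" unfolding p(2) q(2) using ev.hom_add[OF p(1) q(1)] by simp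
    then show "g (a \<oplus> b) = g a \<oplus> g b"
      using g[OF UP.a_closed[OF p(1) q(1)]] hom(1)[OF p(1) q(1)] g[OF p(1)] g[OF q(1)] p(2) q(2)
          by simp
  next
    show "g \<one> = \<one>" using gD[OF d(3)] restricted_homD(4)[OF f] by simp
  qed
  moreover have "g x = y"
  proof -
    have "[\<one>, \<zero>] \<in> carrier ?P" unfolding univ_poly_carrier[symmetric] polynomial_def using d(2,3)
        by simp
    moreover have "eval [\<one>, \<zero>] x = x" using x by simp
    ultimately have "g x = eval (map f [\<one>, \<zero>]) y" using g[of "[\<one>, \<zero>]"] by simp
    then show ?thesis using y restricted_homD(4)[OF f] restricted_hom_zero[OF Dr f] by simp
  qed
  ultimately show thesis using that gD by blast
qed

lemma algebraically_closed_root: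
  assumes "algebraically_closed R" "p \<in> carrier (poly_ring R)" "degree p \<ge> 1"
  shows "\<exists>y\<in>carrier R. eval p y = \<zero>"
proof -
  have "splitted p" using algebraically_closed.roots_over_carrier[OF assms(1,2)] .
  then have "roots p \<noteq> {#}" using assms(3) unfolding splitted_def by auto
  then obtain y where "y \<in># roots p" by auto
  then have "is_root p y" using roots_mem_iff_is_root[OF assms(2)] by simp
  then show ?thesis unfolding is_root_def by auto
qed

text \<open>Mapping the coefficients of \<open>Irr E x\<close> by a field homomorphism preserves the
  degree, so the result is not constant and has a root in the algebraically closed ambient
  field.\<close>

lemma extend_hom_step:
  assumes ac: "algebraically_closed R" and E: "subfield E R" and g: "restricted_hom E g"
    and x: "x \<in> carrier R" "(algebraic over E) x"
  obtains g' where "restricted_hom (simple_extension E x) g'" "\<And>d. d \<in> E \<Longrightarrow> g' d = g d"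
proof -
  note irr = IrrE[OF E x]
  have "Irr E x \<in> carrier (poly_ring (R\<lparr>carrier := E\<rparr>))"
    using irr(1) univ_poly_consistent[OF subfieldE(1)[OF E]] by simp
  then have "map g (Irr E x) \<in> carrier (poly_ring R)"
    using polynomial_hom[OF g] subfield_iff(2)[OF E] field_axioms by simp
  moreover have "degree (map g (Irr E x)) \<ge> 1"
    using pirreducible_degree[OF E irr(1,2)] by simp
  ultimately obtain y where "y \<in> carrier R" "eval (map g (Irr E x)) y = \<zero>"
    using algebraically_closed_root[OF ac] by blast
  then show thesis using extend_hom_simple[OF E x g] that by metis
qed

text \<open>Zorn's lemma on partial extensions. They are encoded by their graphs, so that extending
  a map means enlarging a set. A maximal one is defined on all of \<open>F\<close>, since any
  further element is algebraic and could be adjoined.\<close>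

lemma extend_hom:
  assumes ac: "algebraically_closed R" and D: "subfield D R" and F: "subfield F R" "D \<subseteq> F"
    and alg: "\<And>x. x \<in> F \<Longrightarrow> (algebraic over D) x" and f: "restricted_hom D f"
  obtains g where "restricted_hom F g" "\<And>d. d \<in> D \<Longrightarrow> g d = f d"
proof -
  define P where "P E g \<longleftrightarrow> subfield E R \<and> D \<subseteq> E \<and> E \<subseteq> F \<and> restricted_hom E g \<and> (\<forall>d\<in>D. g d = f d)"
      for E g
  define S where "S = {(\<lambda>x. (x, g x)) ` E | E g. P E g}"
  have "\<exists>M\<in>S. \<forall>Z\<in>S. M \<subseteq> Z \<longrightarrow> Z = M"
  proof (rule subset_Zorn_nonempty)
    have "P D f" unfolding P_def using D F f by auto
    then show "S \<noteq> {}" unfolding S_def by blast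
  next
    fix \<C> assume C: "\<C> \<noteq> {}" "subset.chain S \<C>"
    have cmp: "Y \<subseteq> Z \<or> Z \<subseteq> Y" if "Y \<in> \<C>" "Z \<in> \<C>" for Y Z
      using C(2) that by (auto simp: subset_chain_def)
    have mem: "\<exists>E g. P E g \<and> Z = (\<lambda>x. (x, g x)) ` E" if "Z \<in> \<C>" for Z
      using C(2) that unfolding subset_chain_def S_def by blast
    \<comment> \<open>Domain and map of the union of the chain, read off from the union of the
      graphs. Any two graphs in the chain are comparable, which makes the union single-valued
      (\<open>sv\<close>).\<close>
    define E' where "E' = fst ` \<Union>\<C>"
    define g' where "g' x = (THE a. (x, a) \<in> \<Union>\<C>)" for x
    have sv: "a = b" if ab: "(x, a) \<in> \<Union>\<C>" "(x, b) \<in> \<Union>\<C>" for x a b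
    proof -
      obtain Y Z where YZ: "Y \<in> \<C>" "(x, a) \<in> Y" "Z \<in> \<C>" "(x, b) \<in> Z" using ab by blast
      then obtain W where W: "W \<in> \<C>" "(x, a) \<in> W" "(x, b) \<in> W" using cmp[of Y Z] by blast
      then show ?thesis using mem[OF W(1)] by auto
    qed
    have g': "g' x = a" if "(x, a) \<in> \<Union>\<C>" for x a
      unfolding g'_def using sv that by (intro the_equality) auto
    have Un: "\<Union>\<C> = (\<lambda>x. (x, g' x)) ` E'"
      unfolding E'_def using g' by force
    have two: "\<exists>E g. P E g \<and> a \<in> E \<and> b \<in> E \<and> E \<subseteq> E' \<and> (\<forall>x\<in>E. g' x = g x)"
      if ab: "a \<in> E'" "b \<in> E'" for a b
    proof -
      obtain a' b' Y Z where YZ: "Y \<in> \<C>" "(a, a') \<in> Y" "Z \<in> \<C>" "(b, b') \<in> Z"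
        using ab unfolding E'_def by auto
      then obtain W where W: "W \<in> \<C>" "(a, a') \<in> W" "(b, b') \<in> W" using cmp[of Y Z] by blast
      obtain E g where Eg: "P E g" "W = (\<lambda>x. (x, g x)) ` E" using mem[OF W(1)] by blast
      have "a \<in> E" "b \<in> E" using W Eg by auto
      moreover have "E \<subseteq> E'" unfolding E'_def using W(1) Eg(2) by force
      moreover have "g' x = g x" if "x \<in> E" for x using that W(1) Eg(2) by (intro g') auto
      ultimately show ?thesis using Eg(1) by (intro exI[of _ E] exI[of _ g]) simp
    qed
    \<comment> \<open>A single member of the nonempty chain already contains \<open>D\<close> and
      agrees with \<open>f\<close> there; the union inherits both.\<close>
    obtain W where W: "W \<in> \<C>" using C(1) by (meson ex_in_conv)
    obtain E0 g0 where E0: "P E0 g0" "W = (\<lambda>x. (x, g0 x)) ` E0" using mem[OF W] by blast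
    have E0E': "E0 \<subseteq> E'" unfolding E'_def using W E0(2) by force
    have g0: "g' x = g0 x" if "x \<in> E0" for x using that W E0(2) by (intro g') auto
    have DE': "D \<subseteq> E'" using E0 E0E' unfolding P_def by auto
    have gD: "\<forall>d\<in>D. g' d = f d" using E0 g0 unfolding P_def by auto
    have E'F: "E' \<subseteq> F"
    proof
      fix a assume a: "a \<in> E'"
      obtain E g where "P E g" "a \<in> E" using two[OF a a] by (elim exE conjE)
      then show "a \<in> F" unfolding P_def by auto
    qed
    have E'c: "E' \<subseteq> carrier R" using E'F subfieldE(3)[OF F(1)] by blast
    have sf: "subfield E' R"
    proof (rule subfieldI'[OF subringI])
      show "E' \<subseteq> carrier R" by (rule E'c)
      show "\<one> \<in> E'" using DE' subringE(3)[OF subfieldE(1)[OF D]] by auto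
    next
      fix a assume a: "a \<in> E'"
      obtain E g where E: "P E g" "a \<in> E" "E \<subseteq> E'" using two[OF a a] by (elim exE conjE)
      then have "subfield E R" unfolding P_def by blast
      then show "\<ominus> a \<in> E'" using subringE(5)[OF subfieldE(1) E(2)] E(3) by blast
    next
      fix a b assume ab: "a \<in> E'" "b \<in> E'"
      obtain E g where E: "P E g" "a \<in> E" "b \<in> E" "E \<subseteq> E'" using two[OF ab] by (elim exE conjE)
      have "subring E R" using E(1) subfieldE(1) unfolding P_def by blast
      then show "a \<otimes> b \<in> E'" "a \<oplus> b \<in> E'"
        using subringE(6)[OF _ E(2,3)] subringE(7)[OF _ E(2,3)] E(4) by blast+
    next
      fix a assume a: "a \<in> E' - {\<zero>}"
      then have a': "a \<in> E'" by simp
      obtain E g where E: "P E g" "a \<in> E" "E \<subseteq> E'" using two[OF a' a'] by (elim exE conjE)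
      then have "subfield E R" unfolding P_def by simp
      then show "inv a \<in> E'" using subfield_m_inv(1)[of E a] a E(2,3) by blast
    qed
    have "restricted_hom E' g'"
    proof (rule restricted_homI)
      fix a assume a: "a \<in> E'"
      obtain E g where E: "P E g" "a \<in> E" "\<forall>x\<in>E. g' x = g x" using two[OF a a] by (elim exE conjE)
      have "restricted_hom E g" using E(1) unfolding P_def by blast
      then have "g a \<in> carrier R" using restricted_homD(1)[of g E a] E(2) by simp
      then show "g' a \<in> carrier R" using E by simp
    next
      fix a b assume ab: "a \<in> E'" "b \<in> E'"
      obtain E g where E: "P E g" "a \<in> E" "b \<in> E" "\<forall>x\<in>E. g' x = g x" using two[OF ab]
          by (elim exE conjE)
      have h: "restricted_hom E g" and r: "subring E R" using E(1) subfieldE(1) unfolding P_def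
          by blast+
      show "g' (a \<otimes> b) = g' a \<otimes> g' b"
        using restricted_homD(2)[OF h E(2,3)] subringE(6)[OF r E(2,3)] E(2-4) by simp
      show "g' (a \<oplus> b) = g' a \<oplus> g' b"
        using restricted_homD(3)[OF h E(2,3)] subringE(7)[OF r E(2,3)] E(2-4) by simp
    next
      show "g' \<one> = \<one>" using gD subringE(3)[OF subfieldE(1)[OF D]] restricted_homD(4)[OF f] by simp
    qed
    then have "P E' g'" unfolding P_def using sf DE' E'F gD by simp
    then show "\<Union>\<C> \<in> S" unfolding S_def Un by (intro CollectI exI[of _ E'] exI[of _ g']) simp
  qed
  then obtain M where M: "M \<in> S" "\<And>Z. Z \<in> S \<Longrightarrow> M \<subseteq> Z \<Longrightarrow> Z = M" by (elim bexE) simp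
  obtain E g where Eg: "P E g" "M = (\<lambda>x. (x, g x)) ` E" using M(1) unfolding S_def
      by (elim CollectE exE conjE)
  note max = M(2)[unfolded Eg(2)]
  have E: "subfield E R" "D \<subseteq> E" "E \<subseteq> F" "restricted_hom E g" "\<forall>d\<in>D. g d = f d"
    using Eg unfolding P_def by auto
  have "F \<subseteq> E"
  proof
    fix x assume x: "x \<in> F"
    have xc: "x \<in> carrier R" using x subfieldE(3)[OF F(1)] by blast
    have xa: "(algebraic over E) x" using algebraic_mono[OF E(2) alg[OF x]] .
    obtain g' where g': "restricted_hom (simple_extension E x) g'" "\<And>d. d \<in> E \<Longrightarrow> g' d = g d"
      using extend_hom_step[OF ac E(1,4) xc xa] by blast
    let ?E = "simple_extension E x"
    have inc: "E \<subseteq> ?E" "x \<in> ?E"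
      using simple_extension_incl[OF subfieldE(3)[OF E(1)] xc] simple_extension_mem[OF
          subfieldE(1)[OF E(1)] xc] by auto
    have "subfield ?E R" using simple_extension_is_subfield[OF E(1) xc] xa by simp
    moreover have "?E \<subseteq> F" using simple_extension_subring_incl[OF subfieldE(1)[OF F(1)] E(3) x] .
    ultimately have "P ?E g'" unfolding P_def using g' E inc by auto
    then have "(\<lambda>x. (x, g' x)) ` ?E \<in> S" unfolding S_def
        by (intro CollectI exI[of _ ?E] exI[of _ g']) simp
    moreover have "(\<lambda>x. (x, g x)) ` E \<subseteq> (\<lambda>x. (x, g' x)) ` ?E" using g'(2) inc(1) by force
    ultimately have "(\<lambda>x. (x, g' x)) ` ?E = (\<lambda>x. (x, g x)) ` E" using max by blast
    then have "fst ` (\<lambda>x. (x, g' x)) ` ?E = fst ` (\<lambda>x. (x, g x)) ` E" by simp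
    then have "?E = E" by (simp add: image_image)
    then show "x \<in> E" using inc by simp
  qed
  then have "E = F" using E(3) by blast
  then show thesis using that E by blast
qed


section \<open>Galois groups\<close>

lemma card_roots_le:
  assumes "p \<in> carrier (poly_ring R)" "p \<noteq> []"
  shows "finite {y \<in> carrier R. eval p y = \<zero>}" "card {y \<in> carrier R. eval p y = \<zero>} \<le> degree p"
proof -
  have *: "{y \<in> carrier R. eval p y = \<zero>} = set_mset (roots p)"
    using roots_mem_iff_is_root[OF assms(1)] assms(2) unfolding is_root_def by auto
  show "finite {y \<in> carrier R. eval p y = \<zero>}" unfolding * by simp
  have c: "card (set_mset A) \<le> size A" for A :: "'a multiset"
    by (induction A) (auto simp: card_insert_if)
  show "card {y \<in> carrier R. eval p y = \<zero>} \<le> degree p"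
    unfolding * using le_trans[OF c size_roots_le_degree[OF assms(1)]] .
qed

section \<open>Automorphism groups and their size\<close>

lemma gal_group_carrier:
  "carrier (gal_group R L k) = {\<phi>. \<phi> \<in> extensional L \<and> bij_betw \<phi> L L \<and>
     \<phi> \<in> ring_hom (R\<lparr>carrier := L\<rparr>) (R\<lparr>carrier := L\<rparr>) \<and> (\<forall>x\<in>k. \<phi> x = x)}"
  unfolding gal_group_def Bij_def by auto

lemma gal_groupD:
  assumes "\<phi> \<in> carrier (gal_group R L k)"
  shows "\<phi> \<in> extensional L" "bij_betw \<phi> L L" "\<And>x. x \<in> L \<Longrightarrow> \<phi> x \<in> L"
    "\<And>x y. x \<in> L \<Longrightarrow> y \<in> L \<Longrightarrow> \<phi> (x \<otimes> y) = \<phi> x \<otimes> \<phi> y"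
    "\<And>x y. x \<in> L \<Longrightarrow> y \<in> L \<Longrightarrow> \<phi> (x \<oplus> y) = \<phi> x \<oplus> \<phi> y" "\<phi> \<one> = \<one>"
    "\<And>x. x \<in> k \<Longrightarrow> \<phi> x = x" "\<phi> \<in> Bij L"
proof -
  have h: "\<phi> \<in> ring_hom (R\<lparr>carrier := L\<rparr>) (R\<lparr>carrier := L\<rparr>)"
    using assms unfolding gal_group_carrier by simp
  show "\<phi> \<in> extensional L" "bij_betw \<phi> L L" "\<And>x. x \<in> k \<Longrightarrow> \<phi> x = x" "\<phi> \<in> Bij L"
    using assms unfolding gal_group_carrier Bij_def by auto
  show "\<And>x. x \<in> L \<Longrightarrow> \<phi> x \<in> L"
    "\<And>x y. x \<in> L \<Longrightarrow> y \<in> L \<Longrightarrow> \<phi> (x \<otimes> y) = \<phi> x \<otimes> \<phi> y"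
    "\<And>x y. x \<in> L \<Longrightarrow> y \<in> L \<Longrightarrow> \<phi> (x \<oplus> y) = \<phi> x \<oplus> \<phi> y" "\<phi> \<one> = \<one>"
    using ring_hom_memE[OF h] by auto
qed

lemma gal_groupI:
  assumes "\<phi> \<in> extensional L" "bij_betw \<phi> L L"
    "\<And>x y. x \<in> L \<Longrightarrow> y \<in> L \<Longrightarrow> \<phi> (x \<otimes> y) = \<phi> x \<otimes> \<phi> y"
    "\<And>x y. x \<in> L \<Longrightarrow> y \<in> L \<Longrightarrow> \<phi> (x \<oplus> y) = \<phi> x \<oplus> \<phi> y" "\<phi> \<one> = \<one>"
    "\<And>x. x \<in> k \<Longrightarrow> \<phi> x = x"
  shows "\<phi> \<in> carrier (gal_group R L k)"
  unfolding gal_group_carrier using assms bij_betwE[OF assms(2)]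
  by (auto intro!: ring_hom_memI)

lemma gal_group_restricted_hom:
  assumes "L \<subseteq> carrier R" "\<phi> \<in> carrier (gal_group R L k)" shows "restricted_hom L \<phi>"
  by (rule restricted_homI) (use gal_groupD[OF assms(2)] assms(1) in auto)

lemma gal_group_mult:
  assumes "\<phi> \<in> carrier (gal_group R L k)" "\<tau> \<in> carrier (gal_group R L k)"
  shows "\<phi> \<otimes>\<^bsub>gal_group R L k\<^esub> \<tau> = compose L \<phi> \<tau>"
  using gal_groupD(8)[OF assms(1)] gal_groupD(8)[OF assms(2)] unfolding gal_group_def BijGroup_def
      by simp

lemma gal_group_one: "\<one>\<^bsub>gal_group R L k\<^esub> = (\<lambda>x\<in>L. x)"
  unfolding gal_group_def BijGroup_def by simp

lemma group_gal_group:
  assumes L: "subring L R" and k: "k \<subseteq> L"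
  shows "group (gal_group R L k)"
proof (rule groupI)
  let ?G = "gal_group R L k"
  note l = subringE[OF L]
  have comp: "compose L \<phi> \<tau> \<in> carrier ?G" if "\<phi> \<in> carrier ?G" "\<tau> \<in> carrier ?G" for \<phi> \<tau>
  proof -
    note s = gal_groupD[OF that(1)] and t = gal_groupD[OF that(2)]
    show ?thesis
    proof (rule gal_groupI)
      show "bij_betw (compose L \<phi> \<tau>) L L" using bij_betw_compose[OF t(2) s(2)] .
    qed (use s(3-7) t(3-7) l k in \<open>auto simp: compose_def\<close>)
  qed
  show one: "\<one>\<^bsub>?G\<^esub> \<in> carrier ?G"
    unfolding gal_group_one
    by (rule gal_groupI) (use l k in \<open>auto simp: bij_betw_def inj_on_def\<close>)
  fix \<phi> assume s0: "\<phi> \<in> carrier ?G"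
  note s = gal_groupD[OF s0]
  show "\<one>\<^bsub>?G\<^esub> \<otimes>\<^bsub>?G\<^esub> \<phi> = \<phi>"
    using gal_group_mult[OF one s0] s(1,3) unfolding gal_group_one
    by (auto simp: compose_def extensional_def fun_eq_iff)
  define \<tau> where "\<tau> = (\<lambda>x\<in>L. inv_into L \<phi> x)"
  have st: "\<phi> (\<tau> x) = x" "\<tau> x \<in> L" if "x \<in> L" for x
    using that s(2) unfolding \<tau>_def
        by (auto simp: bij_betw_inv_into_right bij_betw_def inv_into_into)
  have ts: "\<tau> (\<phi> x) = x" if "x \<in> L" for x
    using that s(2,3) unfolding \<tau>_def by (auto simp: bij_betw_inv_into_left)
  have "\<tau> \<in> carrier ?G"
  proof (rule gal_groupI)
    show "\<tau> \<in> extensional L" unfolding \<tau>_def by simp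
    show "bij_betw \<tau> L L" unfolding \<tau>_def using bij_betw_inv_into[OF s(2)]
      by (simp add: bij_betw_restrict_eq)
    show "\<tau> (x \<otimes> y) = \<tau> x \<otimes> \<tau> y" if "x \<in> L" "y \<in> L" for x y
      using ts[of "\<tau> x \<otimes> \<tau> y"] s(4) st that l(6) by simp
    show "\<tau> (x \<oplus> y) = \<tau> x \<oplus> \<tau> y" if "x \<in> L" "y \<in> L" for x y
      using ts[of "\<tau> x \<oplus> \<tau> y"] s(5) st that l(7) by simp
    show "\<tau> \<one> = \<one>" using ts[of \<one>] s(6) l(3) by simp
    show "\<tau> x = x" if "x \<in> k" for x using ts[of x] s(7) that k by auto
  qed
  moreover have "\<tau> \<otimes>\<^bsub>?G\<^esub> \<phi> = \<one>\<^bsub>?G\<^esub>"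
    unfolding gal_group_mult[OF calculation s0] gal_group_one
    using ts by (intro ext) (auto simp: compose_def)
  ultimately show "\<exists>\<tau>\<in>carrier ?G. \<tau> \<otimes>\<^bsub>?G\<^esub> \<phi> = \<one>\<^bsub>?G\<^esub>" by blast
  fix \<tau> assume t0: "\<tau> \<in> carrier ?G"
  show st_in: "\<phi> \<otimes>\<^bsub>?G\<^esub> \<tau> \<in> carrier ?G" unfolding gal_group_mult[OF s0 t0] by (rule comp[OF s0 t0])
  fix \<rho> assume r0: "\<rho> \<in> carrier ?G"
  have tr: "\<tau> \<otimes>\<^bsub>?G\<^esub> \<rho> \<in> carrier ?G" unfolding gal_group_mult[OF t0 r0] by (rule comp[OF t0 r0])
  have "\<phi> \<otimes>\<^bsub>?G\<^esub> \<tau> \<otimes>\<^bsub>?G\<^esub> \<rho> = compose L (compose L \<phi> \<tau>) \<rho>"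
    using gal_group_mult[OF st_in r0] gal_group_mult[OF s0 t0] by simp
  also have "\<dots> = compose L \<phi> (compose L \<tau> \<rho>)"
    using gal_groupD(3)[OF r0] by (intro compose_assoc[symmetric]) auto
  also have "\<dots> = \<phi> \<otimes>\<^bsub>?G\<^esub> (\<tau> \<otimes>\<^bsub>?G\<^esub> \<rho>)"
    using gal_group_mult[OF s0 tr] gal_group_mult[OF t0 r0] by simp
  finally show "\<phi> \<otimes>\<^bsub>?G\<^esub> \<tau> \<otimes>\<^bsub>?G\<^esub> \<rho> = \<phi> \<otimes>\<^bsub>?G\<^esub> (\<tau> \<otimes>\<^bsub>?G\<^esub> \<rho>)" .
qed

lemma gal_group_root:
  assumes L: "subring L R" and k: "k \<subseteq> L" and s: "\<phi> \<in> carrier (gal_group R L k)"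
    and p: "set p \<subseteq> k" and x: "x \<in> L" "eval p x = \<zero>"
  shows "eval p (\<phi> x) = \<zero>"
proof -
  note l = subringE[OF L]
  have h: "restricted_hom L \<phi>" by (rule gal_group_restricted_hom[OF l(1) s])
  have "map \<phi> p = p" using p gal_groupD(7)[OF s] by (intro map_idI) auto
  moreover have "set p \<subseteq> L" using p k by auto
  ultimately have "\<phi> (eval p x) = eval p (\<phi> x)" using restricted_hom_eval[OF L h _ x(1)] by metis
  then show ?thesis using x(2) restricted_hom_zero[OF L h] by simp
qed

text \<open>An automorphism is determined by the images of a basis, and each of these is a root of a
  polynomial of degree at most \<open>n\<close>.\<close>

lemma gal_group_card:
  assumes k: "subfield k R" and L: "subring L R" "k \<subseteq> L" and dim: "dimension n k L"
  shows "finite (carrier (gal_group R L k))" "card (carrier (gal_group R L k)) \<le> (n * n) ^ n"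
proof -
  note l = subringE[OF L(1)]
  let ?G = "carrier (gal_group R L k)"
  obtain Us where Us: "set Us \<subseteq> carrier R" "independent k Us" "length Us = n" "Span k Us = L"
    using exists_base[OF k dim] by blast
  have UsL: "set Us \<subseteq> L" using Span_base_incl[OF k Us(1)] Us(4) by simp
  \<comment> \<open>The conjugates of all basis elements: at most \<open>n\<close> roots for each of
    \<open>n\<close> minimal polynomials, whence the base \<open>n * n\<close> of the bound. The
    exponent counts the basis elements whose images have to be chosen.\<close>
  define Z where "Z = (\<Union>u\<in>set Us. {y \<in> carrier R. eval (Irr k u) y = \<zero>})"
  have alg: "(algebraic over k) u" if "u \<in> L" for u
    using finite_dimension_imp_algebraic[OF k L(1) finite_dimensionI[OF dim] that] .
  \<comment> \<open>The powers of \<open>u\<close> below the degree of its minimal polynomial are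
    linearly independent, so the dimension bounds this degree.\<close>
  have Irr_deg: "degree (Irr k u) \<le> n" if "u \<in> L" for u
  proof -
    have uc: "u \<in> carrier R" using that l(1) by auto
    have "u [^] i \<in> L" for i :: nat by (induction i) (use l that in auto)
    then have "set (exp_base u (degree (Irr k u))) \<subseteq> L" unfolding exp_base_def by auto
    then have "length (exp_base u (degree (Irr k u))) \<le> n"
      using independent_length_le_dimension[OF k dim exp_base_independent[OF k uc alg[OF that]]]
          by simp
    then show ?thesis by (simp add: exp_base_def)
  qed
  have Irr_poly: "Irr k u \<in> carrier (poly_ring R)" "Irr k u \<noteq> []" if "u \<in> L" for u
  proof -
    have uc: "u \<in> carrier R" using that l(1) by auto
    show "Irr k u \<in> carrier (poly_ring R)"
      using IrrE(1)[OF k uc alg[OF that]] carrier_polynomial_shell[OF subfieldE(1)[OF k]] by simp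
    show "Irr k u \<noteq> []"
      using pirreducible_degree[OF k IrrE(1,2)[OF k uc alg[OF that]]] by auto
  qed
  have finZ: "finite Z" unfolding Z_def using card_roots_le(1)[OF Irr_poly] UsL by auto
  have "card Z \<le> (\<Sum>u\<in>set Us. card {y \<in> carrier R. eval (Irr k u) y = \<zero>})"
    unfolding Z_def by (rule card_UN_le) simp
  also have "\<dots> \<le> (\<Sum>u\<in>set Us. n)"
    using card_roots_le(2)[OF Irr_poly] Irr_deg UsL by (intro sum_mono) (meson le_trans subsetD)
  also have "\<dots> \<le> n * n" using card_length[of Us] Us(3) by simp
  finally have cardZ: "card Z \<le> n * n" .
  let ?T = "{xs. set xs \<subseteq> Z \<and> length xs = n}"
  have maps: "(\<lambda>\<phi>. map \<phi> Us) ` ?G \<subseteq> ?T"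
  proof
    fix xs assume "xs \<in> (\<lambda>\<phi>. map \<phi> Us) ` ?G"
    then obtain \<phi> where s: "\<phi> \<in> ?G" "xs = map \<phi> Us" by auto
    have "\<phi> u \<in> Z" if u: "u \<in> set Us" for u
    proof -
      have uL: "u \<in> L" "u \<in> carrier R" using u UsL l(1) by auto
      note irr = IrrE[OF k uL(2) alg[OF uL(1)]]
      have "eval (Irr k u) (\<phi> u) = \<zero>"
        by (rule gal_group_root[OF L s(1) poly_set[OF irr(1)] uL(1) irr(4)])
      moreover have "\<phi> u \<in> carrier R" using gal_groupD(3)[OF s(1) uL(1)] l(1) by auto
      ultimately show ?thesis unfolding Z_def using u by auto
    qed
    then show "xs \<in> ?T" using s(2) Us(3) by auto
  qed
  have inj: "inj_on (\<lambda>\<phi>. map \<phi> Us) ?G"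
  proof (rule inj_onI)
    fix \<phi> \<tau> assume s: "\<phi> \<in> ?G" and t: "\<tau> \<in> ?G" and eq: "map \<phi> Us = map \<tau> Us"
    have *: "set Ks \<subseteq> k \<Longrightarrow> set Vs \<subseteq> L \<Longrightarrow> map \<phi> Vs = map \<tau> Vs \<Longrightarrow>
        combine Ks Vs \<in> L \<and> \<phi> (combine Ks Vs) = \<tau> (combine Ks Vs)" for Ks Vs
    proof (induction Ks Vs rule: combine.induct)
      case (1 c Ks u Vs)
      have c: "c \<in> L" "u \<in> L" "c \<otimes> u \<in> L" using 1(2,3) L(2) l(6) by auto
      have IH: "combine Ks Vs \<in> L" "\<phi> (combine Ks Vs) = \<tau> (combine Ks Vs)" using 1 by auto
      have "\<phi> (c \<otimes> u) = \<tau> (c \<otimes> u)"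
        using gal_groupD(4)[OF s c(1,2)] gal_groupD(4)[OF t c(1,2)] 1(2,4) gal_groupD(7)[OF s, of c]
            gal_groupD(7)[OF t, of c] by simp
      then show ?case
        using IH gal_groupD(5)[OF s c(3) IH(1)] gal_groupD(5)[OF t c(3) IH(1)] l(7)[OF c(3) IH(1)]
            by simp
    qed (use l(2) restricted_hom_zero[OF L(1) gal_group_restricted_hom[OF l(1) s]]
       restricted_hom_zero[OF L(1) gal_group_restricted_hom[OF l(1) t]] in auto)
    show "\<phi> = \<tau>"
    proof (rule extensionalityI[OF gal_groupD(1)[OF s] gal_groupD(1)[OF t]])
      fix x assume "x \<in> L"
      then obtain Ks where "set Ks \<subseteq> k" "x = combine Ks Us"
        using Span_eq_combine_set[OF k Us(1)] Us(4) by auto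
      then show "\<phi> x = \<tau> x" using *[of Ks Us] UsL eq by simp
    qed
  qed
  have finT: "finite ?T" by (rule finite_lists_length_eq[OF finZ])
  show "finite ?G" using finite_subset[OF maps finT] finite_imageD[OF _ inj] by blast
  have "card ?G = card ((\<lambda>\<phi>. map \<phi> Us) ` ?G)" using card_image[OF inj] by simp
  also have "\<dots> \<le> card ?T" by (rule card_mono[OF finT maps])
  also have "\<dots> = card Z ^ n" by (rule card_lists_length_eq[OF finZ])
  also have "\<dots> \<le> (n * n) ^ n" by (rule power_mono[OF cardZ]) simp
  finally show "card ?G \<le> (n * n) ^ n" .
qed

lemma galois_extD:
  assumes "galois_ext R N F"
  shows "subfield N R" "subfield F R" "N \<subseteq> F" "\<And>x. x \<in> F \<Longrightarrow> (algebraic over N) x"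
    "\<And>x. x \<in> F \<Longrightarrow> alg_mult (Irr N x) x = 1"
    "\<And>x y. x \<in> F \<Longrightarrow> y \<in> carrier R \<Longrightarrow> eval (Irr N x) y = \<zero> \<Longrightarrow> y \<in> F"
  using assms unfolding galois_ext_def separable_over_def by auto

text \<open>Normality keeps the values in \<open>F\<close>. As \<open>F\<close> may be infinite over
  \<open>N\<close>, surjectivity cannot come from counting dimensions; instead the injective
  \<open>g\<close> maps the finite root set of each minimal polynomial into itself and so permutes
  it.\<close>

lemma normal_hom_gal_group:
  assumes F: "galois_ext R N F" and g: "restricted_hom F g" "\<And>x. x \<in> N \<Longrightarrow> g x = x"
  shows "(\<lambda>x\<in>F. g x) \<in> carrier (gal_group R F N)"
proof -
  note f = galois_extD[OF F]
  have Fr: "subring F R" using f(2) subfieldE(1) by blast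
  note s = subringE[OF Fr]
  have Nr: "subring N R" using f(1) subfieldE(1) by blast
  have root: "eval (Irr N y) (g x) = \<zero>" if "x \<in> F" "y \<in> F" "eval (Irr N y) x = \<zero>" for x y
  proof -
    have yc: "y \<in> carrier R" using that s(1) by auto
    have p: "set (Irr N y) \<subseteq> N" using poly_set[OF IrrE(1)[OF f(1) yc f(4)[OF that(2)]]] .
    have "map g (Irr N y) = Irr N y" using p g(2) by (intro map_idI) auto
    moreover have "set (Irr N y) \<subseteq> F" using p f(3) by auto
    ultimately have "g (eval (Irr N y) x) = eval (Irr N y) (g x)"
      using restricted_hom_eval[OF Fr g(1) _ that(1)] by metis
    then show ?thesis using that(3) restricted_hom_zero[OF Fr g(1)] by simp
  qed
  have irr0: "eval (Irr N y) y = \<zero>" if "y \<in> F" for y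
    using IrrE(4)[OF f(1) _ f(4)[OF that]] that s(1) by auto
  have gF: "g x \<in> F" if "x \<in> F" for x
    using f(6)[OF that _ root[OF that that irr0[OF that]]] restricted_homD(1)[OF g(1) that] by simp
  have inj: "inj_on g F"
  proof (rule inj_onI)
    have "field (R\<lparr>carrier := F\<rparr>)" using subfield_iff(2)[OF f(2)] .
    then have "inj_on g (carrier (R\<lparr>carrier := F\<rparr>))"
      using non_trivial_field_hom_is_inj[OF g(1) _ field_axioms] by simp
    then show "x = y" if "x \<in> F" "y \<in> F" "g x = g y" for x y using that by (simp add: inj_on_def)
  qed
  have surj: "y \<in> g ` F" if y: "y \<in> F" for y
  proof -
    let ?Z = "{x \<in> carrier R. eval (Irr N y) x = \<zero>}"
    have yc: "y \<in> carrier R" using y s(1) by auto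
    note irr = IrrE[OF f(1) yc f(4)[OF y]]
    have "Irr N y \<noteq> []" using pirreducible_degree[OF f(1) irr(1,2)] by auto
    then have "finite ?Z"
      using card_roots_le(1)[of "Irr N y"] carrier_polynomial_shell[OF Nr irr(1)] by simp
    moreover have ZF: "?Z \<subseteq> F" using f(6)[OF y] by auto
    moreover have "g ` ?Z \<subseteq> ?Z"
    proof
      fix b assume "b \<in> g ` ?Z"
      then obtain a where a: "a \<in> ?Z" "b = g a" by auto
      then have "a \<in> F" using ZF by auto
      then show "b \<in> ?Z" using root[of a y] a y gF[of a] s(1) by auto
    qed
    moreover have "inj_on g ?Z" using inj_on_subset[OF inj ZF] .
    ultimately have "g ` ?Z = ?Z" using endo_inj_surj by blast
    moreover have "y \<in> ?Z" using yc irr0[OF y] by auto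
    ultimately show ?thesis using ZF by blast
  qed
  show ?thesis
  proof (rule gal_groupI)
    have "g ` F = F" using gF surj by blast
    then show "bij_betw (\<lambda>x\<in>F. g x) F F" using inj by (simp add: bij_betw_def inj_on_restrict_eq)
  qed (use restricted_homD[OF g(1)] s g(2) f(3) in auto)
qed

lemma gal_group_lift:
  assumes ac: "algebraically_closed R" and F: "galois_ext R N F"
    and D: "subfield D R" "N \<subseteq> D" "D \<subseteq> F" and f: "restricted_hom D f" "\<And>x. x \<in> N \<Longrightarrow> f x = x"
  obtains \<phi> where "\<phi> \<in> carrier (gal_group R F N)" "\<And>d. d \<in> D \<Longrightarrow> \<phi> d = f d"
proof -
  note ff = galois_extD[OF F]
  have alg: "(algebraic over D) x" if "x \<in> F" for x using algebraic_mono[OF D(2) ff(4)[OF that]] .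
  obtain g where g: "restricted_hom F g" "\<And>d. d \<in> D \<Longrightarrow> g d = f d"
    using extend_hom[OF ac D(1) ff(2) D(3) alg f(1)] by blast
  have gN: "g x = x" if "x \<in> N" for x using g(2)[of x] f(2)[OF that] that D(2) by auto
  show thesis
    by (rule that[OF normal_hom_gal_group[OF F g(1) gN]]) (use g(2) D(3) in auto)
qed

lemma gal_group_moves_root:
  assumes ac: "algebraically_closed R" and F: "galois_ext R N F"
    and D: "subfield D R" "N \<subseteq> D" "D \<subseteq> F" and x: "x \<in> F"
        and y: "y \<in> carrier R" "eval (Irr D x) y = \<zero>"
  obtains \<phi> where "\<phi> \<in> carrier (gal_group R F N)" "\<And>d. d \<in> D \<Longrightarrow> \<phi> d = d" "\<phi> x = y"
proof -
  note ff = galois_extD[OF F]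
  have xc: "x \<in> carrier R" using x subfieldE(3)[OF ff(2)] by auto
  have xa: "(algebraic over D) x" using algebraic_mono[OF D(2) ff(4)[OF x]] .
  note Dc = subfieldE(3)[OF D(1)]
  have idh: "restricted_hom D (\<lambda>z. z)" by (rule restricted_homI) (use Dc in auto)
  have y': "eval (map (\<lambda>z. z) (Irr D x)) y = \<zero>" using y(2) by simp
  obtain g where g: "restricted_hom (simple_extension D x) g" "\<And>d. d \<in> D \<Longrightarrow> g d = d" "g x = y"
    using extend_hom_simple[OF D(1) xc xa idh y(1) y'] by metis
  let ?D = "simple_extension D x"
  have inc: "D \<subseteq> ?D" "x \<in> ?D"
    using simple_extension_incl[OF Dc xc] simple_extension_mem[OF subfieldE(1)[OF D(1)] xc] by auto
  have 1: "subfield ?D R" using simple_extension_is_subfield[OF D(1) xc] xa by simp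
  have 2: "?D \<subseteq> F" using simple_extension_subring_incl[OF subfieldE(1)[OF ff(2)] D(3) x] .
  have 3: "N \<subseteq> ?D" using D(2) inc(1) by auto
  have 4: "g z = z" if "z \<in> N" for z using g(2)[of z] that D(2) by auto
  obtain \<phi> where s: "\<phi> \<in> carrier (gal_group R F N)" "\<And>d. d \<in> ?D \<Longrightarrow> \<phi> d = g d"
    using gal_group_lift[OF ac F 1 3 2 g(1) 4] by metis
  show thesis
  proof (rule that[OF s(1)])
    show "\<phi> d = d" if "d \<in> D" for d using s(2)[of d] g(2)[OF that] that inc(1) by auto
    show "\<phi> x = y" using s(2)[OF inc(2)] g(3) by simp
  qed
qed


text \<open>The minimal polynomial splits and its roots are simple, so its degree is the number of
  distinct roots, and each of them is the image of \<open>z\<close> under some automorphism.\<close>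

lemma degree_le_conjugates:
  assumes ac: "algebraically_closed R" and F: "galois_ext R N F" and z: "z \<in> F"
    and fin: "finite Z" and Z: "\<And>\<phi>. \<phi> \<in> carrier (gal_group R F N) \<Longrightarrow> \<phi> z \<in> Z"
  shows "degree (Irr N z) \<le> card Z"
proof -
  note ff = galois_extD[OF F]
  have Fc: "F \<subseteq> carrier R" using subfieldE(3)[OF ff(2)] .
  have zc: "z \<in> carrier R" using z Fc by auto
  note irr = IrrE[OF ff(1) zc ff(4)[OF z]]
  have p: "Irr N z \<in> carrier (poly_ring R)"
    using carrier_polynomial_shell[OF subfieldE(1)[OF ff(1)] irr(1)] .
  have mult: "y \<in> Z \<and> count (roots (Irr N z)) y = 1" if "y \<in># roots (Irr N z)" for y
  proof -
    have y: "y \<in> carrier R" "eval (Irr N z) y = \<zero>"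
      using that roots_mem_iff_is_root[OF p] unfolding is_root_def by auto
    have yF: "y \<in> F" using ff(6)[OF z y] .
    obtain \<phi> where "\<phi> \<in> carrier (gal_group R F N)" "\<phi> z = y"
      using gal_group_moves_root[OF ac F ff(1) order_refl ff(3) z y] by metis
    then have "y \<in> Z" using Z by auto
    \<comment> \<open>Separability says that an element is a simple root of its own minimal
      polynomial; as a conjugate of \<open>z\<close>, the element \<open>y\<close> has the same
      one.\<close>
    moreover have "Irr N y = Irr N z"
      using minimal_polynomial_is_unique[OF ff(1) y(1) ff(4)[OF yF]]
        IrrE[OF ff(1) y(1) ff(4)[OF yF]] irr(1-3) y(2) by blast
    then have "count (roots (Irr N z)) y = 1"
      using ff(5)[OF yF] alg_mult_eq_count_roots[OF p] by simp
    ultimately show ?thesis by simp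
  qed
  have "degree (Irr N z) = size (roots (Irr N z))"
    using algebraically_closed.roots_over_carrier[OF ac p] unfolding splitted_def by simp
  also have "\<dots> = (\<Sum>y\<in>set_mset (roots (Irr N z)). count (roots (Irr N z)) y)"
    by (rule size_multiset_overloaded_eq)
  also have "\<dots> = card (set_mset (roots (Irr N z)))" using mult by simp
  also have "\<dots> \<le> card Z" using mult by (intro card_mono[OF fin]) auto
  finally show ?thesis .
qed

text \<open>As \<open>x\<close> is not in \<open>Q\<close>, its minimal polynomial over
  \<open>Q\<close> has degree at least two. It divides the one over \<open>N\<close>, of which
  \<open>x\<close> is a simple root, so it has another root, and some automorphism over
  \<open>Q\<close> moves \<open>x\<close> there.\<close>

lemma fixed_field_of_fixing_group:
  assumes ac: "algebraically_closed R" and F: "galois_ext R N F"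
    and Q: "subfield Q R" "N \<subseteq> Q" "Q \<subseteq> F" and x: "x \<in> F" "x \<notin> Q"
  obtains \<phi> where "\<phi> \<in> carrier (gal_group R F N)" "\<And>d. d \<in> Q \<Longrightarrow> \<phi> d = d" "\<phi> x \<noteq> x"
proof -
  note ff = galois_extD[OF F]
  have xc: "x \<in> carrier R" using x subfieldE(3)[OF ff(2)] by auto
  have xa: "(algebraic over Q) x" using algebraic_mono[OF Q(2) ff(4)[OF x(1)]] .
  note irr = IrrE[OF Q(1) xc xa] and irrN = IrrE[OF ff(1) xc ff(4)[OF x(1)]]
  note q = subringE[OF subfieldE(1)[OF Q(1)]]
  have p: "Irr Q x \<in> carrier (poly_ring R)" "Irr N x \<in> carrier (poly_ring R)"
    using carrier_polynomial_shell[OF subfieldE(1)] Q(1) ff(1) irr(1) irrN(1) by auto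
  have deg1: "degree (Irr Q x) \<ge> 1" using pirreducible_degree[OF Q(1) irr(1,2)] .
  have "degree (Irr Q x) \<noteq> 1"
  proof
    assume "degree (Irr Q x) = 1"
    then have "length (Irr Q x) = 2" by simp
    then obtain a b where ab: "Irr Q x = [a, b]" by (auto simp: numeral_2_eq_2 length_Suc_conv)
    have "a = \<one>" "b \<in> Q" using irr(3) poly_set[OF irr(1)] ab by auto
    moreover have bc: "b \<in> carrier R" using \<open>b \<in> Q\<close> q(1) by auto
    ultimately have "x \<oplus> b = \<zero>" using irr(4) ab xc by simp
    then have "x = \<ominus> b" using xc bc minus_equality by metis
    then show False using x(2) q(5)[OF \<open>b \<in> Q\<close>] by simp
  qed
  then have deg: "degree (Irr Q x) \<ge> 2" using deg1 by simp
  have "map (\<lambda>z. z) (Irr N x) \<in> carrier (univ_poly R Q)"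
    using irrN(1) Q(2) unfolding univ_poly_carrier[symmetric] polynomial_def by auto
  then have "Irr N x \<in> carrier (univ_poly R Q)" by simp
  then have "(Irr Q x) pdivides (Irr N x)" using Irr_minimal[OF Q(1) xc xa _ irrN(4)] by blast
  moreover have "Irr N x \<noteq> []" using pirreducible_degree[OF ff(1) irrN(1,2)] by auto
  ultimately have "roots (Irr Q x) \<subseteq># roots (Irr N x)" using pdivides_imp_roots_incl[OF p] by blast
  then have "count (roots (Irr Q x)) x \<le> count (roots (Irr N x)) x" by (rule mset_subset_eq_count)
  also have "\<dots> = 1" using ff(5)[OF x(1)] alg_mult_eq_count_roots[OF p(2)] by simp
  finally have c1: "count (roots (Irr Q x)) x \<le> 1" .
  have "\<exists>y. y \<in># roots (Irr Q x) \<and> y \<noteq> x"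
  proof (rule ccontr)
    assume "\<not> ?thesis"
    then have "set_mset (roots (Irr Q x)) \<subseteq> {x}" by auto
    then have "roots (Irr Q x) = replicate_mset (count (roots (Irr Q x)) x) x"
      by (intro multiset_eqI) (auto simp: not_in_iff subset_iff)
    then have "size (roots (Irr Q x)) \<le> 1" using c1 by (metis size_replicate_mset)
    moreover have "size (roots (Irr Q x)) = degree (Irr Q x)"
      using algebraically_closed.roots_over_carrier[OF ac p(1)] unfolding splitted_def by simp
    ultimately show False using deg by simp
  qed
  then obtain y where "y \<in># roots (Irr Q x)" and yx: "y \<noteq> x" by blast
  then have y: "y \<in> carrier R" "eval (Irr Q x) y = \<zero>"
    using roots_mem_iff_is_root[OF p(1)] unfolding is_root_def by auto
  obtain \<phi> where "\<phi> \<in> carrier (gal_group R F N)" "\<And>d. d \<in> Q \<Longrightarrow> \<phi> d = d" "\<phi> x = y"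
    using gal_group_moves_root[OF ac F Q x(1) y] by metis
  then show thesis using that yx by metis
qed

section \<open>Independence of characters and elements fixed by a subgroup\<close>

lemma neg_of_sum_zero: "u \<oplus> s = \<zero> \<Longrightarrow> u \<in> carrier R \<Longrightarrow> s \<in> carrier R \<Longrightarrow> s = \<ominus> u"
  using minus_equality[of u s] by auto

text \<open>The relation at \<open>y \<otimes> x\<close> minus \<open>\<tau> y\<close> times the
  relation at \<open>x\<close> eliminates \<open>\<tau>\<close> and leaves a shorter relation with
  coefficients \<open>c \<rho> \<otimes> (\<rho> y \<ominus> \<tau> y)\<close>. Extensionality
  ensures that different characters differ at some \<open>y\<close> in \<open>E\<close>.\<close>

lemma dedekind_independence:
  assumes "finite S" and E: "\<one> \<in> E" "\<And>x y. x \<in> E \<Longrightarrow> y \<in> E \<Longrightarrow> x \<otimes> y \<in> E"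
  shows "(\<And>\<phi>. \<phi> \<in> S \<Longrightarrow> \<phi> \<in> extensional E \<and> \<phi> \<one> = \<one> \<and> (\<forall>x\<in>E. \<phi> x \<in> carrier R) \<and>
          (\<forall>x\<in>E. \<forall>y\<in>E. \<phi> (x \<otimes> y) = \<phi> x \<otimes> \<phi> y)) \<Longrightarrow>
    (\<And>\<phi>. \<phi> \<in> S \<Longrightarrow> c \<phi> \<in> carrier R) \<Longrightarrow>
    (\<And>x. x \<in> E \<Longrightarrow> (\<Oplus>\<phi>\<in>S. c \<phi> \<otimes> \<phi> x) = \<zero>) \<Longrightarrow> \<forall>\<phi>\<in>S. c \<phi> = \<zero>"
  using assms(1)
proof (induction S arbitrary: c rule: finite_induct)
  case (insert \<tau> S)
  note chi = insert.prems(1) and cc = insert.prems(2)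
  have cl: "\<phi> x \<in> carrier R" if "\<phi> \<in> insert \<tau> S" "x \<in> E" for \<phi> x using chi[OF that(1)] that(2)
      by blast
  have ml: "\<phi> (x \<otimes> y) = \<phi> x \<otimes> \<phi> y" if "\<phi> \<in> insert \<tau> S" "x \<in> E" "y \<in> E" for \<phi> x y
    using chi[OF that(1)] that(2,3) by blast
  have tS: "\<phi> \<in> insert \<tau> S" if "\<phi> \<in> S" for \<phi> using that by simp
  have tt: "\<tau> \<in> insert \<tau> S" by simp
  have rel: "c \<tau> \<otimes> \<tau> x \<oplus> (\<Oplus>\<phi>\<in>S. c \<phi> \<otimes> \<phi> x) = \<zero>" if x: "x \<in> E" for x
  proof -
    have "(\<Oplus>\<phi>\<in>insert \<tau> S. c \<phi> \<otimes> \<phi> x) = c \<tau> \<otimes> \<tau> x \<oplus> (\<Oplus>\<phi>\<in>S. c \<phi> \<otimes> \<phi> x)"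
      using insert.hyps cc cl x by (intro finsum_insert) auto
    then show ?thesis using insert.prems(3)[OF x] by simp
  qed
  have S0: "c \<phi> = \<zero>" if s: "\<phi> \<in> S" for \<phi>
  proof -
    have "\<exists>y\<in>E. \<phi> y \<noteq> \<tau> y"
    proof (rule ccontr)
      assume "\<not> ?thesis"
      then have "\<phi> = \<tau>" using chi[OF tS[OF s]] chi[OF tt] by (intro extensionalityI[of \<phi> E]) auto
      then show False using s insert.hyps by simp
    qed
    then obtain y where y: "y \<in> E" "\<phi> y \<noteq> \<tau> y" by blast
    have ty: "\<tau> y \<in> carrier R" using cl[OF tt y(1)] .
    let ?c = "\<lambda>\<rho>. c \<rho> \<otimes> (\<rho> y \<ominus> \<tau> y)"
    have cS: "?c \<rho> \<in> carrier R" if "\<rho> \<in> S" for \<rho>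
      using cc[OF tS[OF that]] cl[OF tS[OF that] y(1)] ty by simp
    have "\<forall>\<rho>\<in>S. ?c \<rho> = \<zero>"
    proof (rule insert.IH[OF chi[OF tS] cS])
      fix x assume x: "x \<in> E"
      have xy: "y \<otimes> x \<in> E" using E(2)[OF y(1) x] .
      have A: "(\<Oplus>\<phi>\<in>S. c \<phi> \<otimes> \<phi> x) \<in> carrier R" "(\<Oplus>\<phi>\<in>S. c \<phi> \<otimes> \<phi> (y \<otimes> x)) \<in> carrier R"
        using cc[OF tS] cl[OF tS x] cl[OF tS xy] by (auto intro!: finsum_closed)
      have ct: "c \<tau> \<in> carrier R" "\<tau> x \<in> carrier R" using cc[OF tt] cl[OF tt x] by auto
      have "(\<Oplus>\<rho>\<in>S. ?c \<rho> \<otimes> \<rho> x) = (\<Oplus>\<rho>\<in>S. c \<rho> \<otimes> \<rho> (y \<otimes> x) \<oplus> (\<ominus> \<tau> y) \<otimes> (c \<rho> \<otimes> \<rho> x))"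
      proof (rule finsum_cong'[OF refl])
        fix \<rho> assume r: "\<rho> \<in> S"
        have rc: "c \<rho> \<in> carrier R" "\<rho> y \<in> carrier R" "\<rho> x \<in> carrier R"
          using cc[OF tS[OF r]] cl[OF tS[OF r]] y(1) x by auto
        show "?c \<rho> \<otimes> \<rho> x = c \<rho> \<otimes> \<rho> (y \<otimes> x) \<oplus> (\<ominus> \<tau> y) \<otimes> (c \<rho> \<otimes> \<rho> x)"
          unfolding ml[OF tS[OF r] y(1) x] using rc ty by algebra
      qed (use cc[OF tS] cl[OF tS x] cl[OF tS xy] ty in auto)
      also have "\<dots> = (\<Oplus>\<rho>\<in>S. c \<rho> \<otimes> \<rho> (y \<otimes> x)) \<oplus> (\<Oplus>\<rho>\<in>S. (\<ominus> \<tau> y) \<otimes> (c \<rho> \<otimes> \<rho> x))"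
        using cc[OF tS] cl[OF tS x] cl[OF tS xy] ty by (intro finsum_addf) auto
      also have "(\<Oplus>\<rho>\<in>S. (\<ominus> \<tau> y) \<otimes> (c \<rho> \<otimes> \<rho> x)) = (\<ominus> \<tau> y) \<otimes> (\<Oplus>\<rho>\<in>S. c \<rho> \<otimes> \<rho> x)"
        using cc[OF tS] cl[OF tS x] ty insert.hyps(1) by (intro finsum_rdistr[symmetric]) auto
      also have "(\<Oplus>\<rho>\<in>S. c \<rho> \<otimes> \<rho> (y \<otimes> x)) = \<ominus> (c \<tau> \<otimes> (\<tau> y \<otimes> \<tau> x))"
        using neg_of_sum_zero[OF rel[OF xy] _ A(2)] ct ty ml[OF tt y(1) x] by simp
      also have "(\<Oplus>\<rho>\<in>S. c \<rho> \<otimes> \<rho> x) = \<ominus> (c \<tau> \<otimes> \<tau> x)"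
        using neg_of_sum_zero[OF rel[OF x] _ A(1)] ct by simp
      also have "\<ominus> (c \<tau> \<otimes> (\<tau> y \<otimes> \<tau> x)) \<oplus> (\<ominus> \<tau> y) \<otimes> (\<ominus> (c \<tau> \<otimes> \<tau> x)) = \<zero>"
        using ct ty by algebra
      finally show "(\<Oplus>\<rho>\<in>S. ?c \<rho> \<otimes> \<rho> x) = \<zero>" .
    qed
    then have z: "?c \<phi> = \<zero>" using s by blast
    have sy: "c \<phi> \<in> carrier R" "\<phi> y \<in> carrier R" using cc[OF tS[OF s]] cl[OF tS[OF s] y(1)] by auto
    have "\<phi> y \<ominus> \<tau> y \<noteq> \<zero>" using y(2) sy ty by simp
    then show ?thesis using z integral_iff[OF sy(1) minus_closed[OF sy(2) ty]] by simp
  qed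
  have "(\<Oplus>\<phi>\<in>S. c \<phi> \<otimes> \<phi> \<one>) = (\<Oplus>\<phi>\<in>S. \<zero>)"
    using S0 cl[OF tS E(1)] by (intro finsum_cong') auto
  then have "c \<tau> \<otimes> \<tau> \<one> = \<zero>" using rel[OF E(1)] cc[OF tt] cl[OF tt E(1)] by simp
  then have "c \<tau> = \<zero>" using chi[OF tt] cc[OF tt] by simp
  then show ?case using S0 by blast
qed simp

lemma gal_group_finsum:
  assumes L: "subring L R" and s: "\<phi> \<in> carrier (gal_group R L k)"
    and "finite A" "\<And>a. a \<in> A \<Longrightarrow> f a \<in> L"
  shows "finsum R f A \<in> L \<and> \<phi> (finsum R f A) = (\<Oplus>a\<in>A. \<phi> (f a))"
  using assms(3,4)
proof (induction A)
  case empty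
  then show ?case using restricted_hom_zero[OF L gal_group_restricted_hom[OF subringE(1)[OF L] s]]
      subringE(2)[OF L] by simp
next
  case (insert a A)
  note l = subringE[OF L] and g = gal_groupD[OF s]
  have fa: "f a \<in> L" "\<And>b. b \<in> A \<Longrightarrow> f b \<in> L" using insert.prems by auto
  have IH: "finsum R f A \<in> L" "\<phi> (finsum R f A) = (\<Oplus>a\<in>A. \<phi> (f a))" using insert.IH fa by auto
  have 1: "finsum R f (insert a A) = f a \<oplus> finsum R f A"
    using insert.hyps fa l(1) by (intro finsum_insert) auto
  have 2: "(\<Oplus>a\<in>insert a A. \<phi> (f a)) = \<phi> (f a) \<oplus> (\<Oplus>a\<in>A. \<phi> (f a))"
    using insert.hyps fa l(1) g(3) by (intro finsum_insert) (auto intro: subsetD[OF l(1)])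
  show ?case unfolding 1 2 using l(7)[OF fa(1) IH(1)] g(5)[OF fa(1) IH(1)] IH(2) by simp
qed

text \<open>The trace over \<open>H\<close> of a suitable element separates \<open>s\<close> from \<open>H\<close>, since the automorphisms
  in \<open>H\<close> and in \<open>s H\<close> are linearly independent.\<close>

lemma fixed_element_moved:
  assumes L: "subring L R" "k \<subseteq> L" and fin: "finite (carrier (gal_group R L k))"
    and H: "subgroup H (gal_group R L k)" and s: "s \<in> carrier (gal_group R L k)" "s \<notin> H"
  obtains z where "z \<in> L" "\<And>h. h \<in> H \<Longrightarrow> h z = z" "s z \<noteq> z"
proof -
  let ?G = "gal_group R L k"
  interpret G: group ?G by (rule group_gal_group[OF L])
  note l = subringE[OF L(1)]
  have HG: "h \<in> carrier ?G" if "h \<in> H" for h using subgroup.mem_carrier[OF H that] .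
  have finH: "finite H" by (rule finite_subset[OF subgroup.subset[OF H] fin])
  have ap: "(\<phi> \<otimes>\<^bsub>?G\<^esub> \<tau>) x = \<phi> (\<tau> x)" if "\<phi> \<in> carrier ?G" "\<tau> \<in> carrier ?G" "x \<in> L" for \<phi> \<tau> x
    using gal_group_mult[OF that(1,2)] that(3) by (simp add: compose_eq)
  define S where "S = (\<lambda>h. s \<otimes>\<^bsub>?G\<^esub> h) ` H"
  have SG: "\<phi> \<in> carrier ?G" if "\<phi> \<in> S" for \<phi> using that s(1) HG unfolding S_def by auto
  have inj: "inj_on (\<lambda>h. s \<otimes>\<^bsub>?G\<^esub> h) H" by (rule inj_onI) (use s(1) HG in simp)
  have disj: "H \<inter> S = {}"
  proof (rule ccontr)
    assume "H \<inter> S \<noteq> {}"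
    then obtain h where h: "h \<in> H" "s \<otimes>\<^bsub>?G\<^esub> h \<in> H" unfolding S_def by auto
    have "s = (s \<otimes>\<^bsub>?G\<^esub> h) \<otimes>\<^bsub>?G\<^esub> inv\<^bsub>?G\<^esub> h" using s(1) HG[OF h(1)] by (simp add: G.m_assoc)
    also have "\<dots> \<in> H" using subgroup.m_closed[OF H h(2) subgroup.m_inv_closed[OF H h(1)]] .
    finally show False using s(2) by simp
  qed
  have cl: "\<phi> x \<in> carrier R" if "\<phi> \<in> carrier ?G" "x \<in> L" for \<phi> x
    using gal_groupD(3)[OF that] l(1) by auto
  have "\<exists>\<theta>\<in>L. (\<Oplus>h\<in>H. h \<theta>) \<noteq> (\<Oplus>h\<in>S. h \<theta>)"
  proof (rule ccontr)
    assume no: "\<not> ?thesis"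
    \<comment> \<open>Coefficient \<open>1\<close> on \<open>H\<close> and \<open>-1\<close> on the
      coset \<open>S\<close>. If the two sums agreed for every element, this would be a nontrivial
      relation between distinct automorphisms, \<open>H\<close> and \<open>S\<close> being
      disjoint.\<close>
    let ?c = "\<lambda>\<phi>. if \<phi> \<in> H then \<one> else \<ominus> \<one>"
    have "\<forall>\<phi>\<in>H \<union> S. ?c \<phi> = \<zero>"
    proof (rule dedekind_independence[of "H \<union> S" L])
      show "finite (H \<union> S)" unfolding S_def using finH by simp
      show "\<one> \<in> L" by (rule l(3))
      show "x \<otimes> y \<in> L" if "x \<in> L" "y \<in> L" for x y by (rule l(6)[OF that])
      show "\<phi> \<in> extensional L \<and> \<phi> \<one> = \<one> \<and> (\<forall>x\<in>L. \<phi> x \<in> carrier R) \<and>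
          (\<forall>x\<in>L. \<forall>y\<in>L. \<phi> (x \<otimes> y) = \<phi> x \<otimes> \<phi> y)" if "\<phi> \<in> H \<union> S" for \<phi>
      proof -
        have "\<phi> \<in> carrier ?G" using that HG SG by auto
        then show ?thesis using gal_groupD[of \<phi> L k] cl[of \<phi>] by simp
      qed
      show "?c \<phi> \<in> carrier R" if "\<phi> \<in> H \<union> S" for \<phi> by simp
      fix x assume x: "x \<in> L"
      have Hc: "(\<Oplus>h\<in>H. h x) \<in> carrier R" using cl[OF HG x] by (intro finsum_closed) auto
      have "(\<Oplus>\<phi>\<in>H \<union> S. ?c \<phi> \<otimes> \<phi> x) = (\<Oplus>\<phi>\<in>H. ?c \<phi> \<otimes> \<phi> x) \<oplus> (\<Oplus>\<phi>\<in>S. ?c \<phi> \<otimes> \<phi> x)"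
        using finH disj cl[OF HG x] cl[OF SG x] unfolding S_def[symmetric]
        by (intro finsum_Un_disjoint) (auto simp: S_def)
      also have "(\<Oplus>\<phi>\<in>H. ?c \<phi> \<otimes> \<phi> x) = (\<Oplus>\<phi>\<in>H. \<phi> x)"
        using cl[OF HG x] by (intro finsum_cong') auto
      also have "(\<Oplus>\<phi>\<in>S. ?c \<phi> \<otimes> \<phi> x) = (\<Oplus>\<phi>\<in>S. \<ominus> \<one> \<otimes> \<phi> x)"
        using cl[OF SG x] disj by (intro finsum_cong') auto
      also have "\<dots> = \<ominus> \<one> \<otimes> (\<Oplus>\<phi>\<in>S. \<phi> x)"
        using cl[OF SG x] finH by (intro finsum_rdistr[symmetric]) (auto simp: S_def)
      also have "(\<Oplus>\<phi>\<in>S. \<phi> x) = (\<Oplus>h\<in>H. h x)" using no x by simp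
      finally show "(\<Oplus>\<phi>\<in>H \<union> S. ?c \<phi> \<otimes> \<phi> x) = \<zero>" using Hc by (simp add: l_minus r_neg)
    qed
    then show False using subgroup.one_closed[OF H] by force
  qed
  then obtain \<theta> where t: "\<theta> \<in> L" "(\<Oplus>h\<in>H. h \<theta>) \<noteq> (\<Oplus>h\<in>S. h \<theta>)" by blast
  define z where "z = (\<Oplus>h\<in>H. h \<theta>)"
  have hL: "h \<theta> \<in> L" if "h \<in> H" for h using gal_groupD(3)[OF HG[OF that] t(1)] .
  \<comment> \<open>An automorphism turns the sum over \<open>H\<close> into the sum over its left
    coset of \<open>H\<close>. For elements of \<open>H\<close> this coset is \<open>H\<close>
    again; for \<open>s\<close> it is \<open>S\<close>.\<close>
  have tr: "z \<in> L \<and> \<phi> z = (\<Oplus>h\<in>(\<lambda>h. \<phi> \<otimes>\<^bsub>?G\<^esub> h) ` H. h \<theta>)" if s': "\<phi> \<in> carrier ?G" for \<phi>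
  proof -
    have "inj_on (\<lambda>h. \<phi> \<otimes>\<^bsub>?G\<^esub> h) H" by (rule inj_onI) (use s' HG in simp)
    then have "(\<Oplus>h\<in>(\<lambda>h. \<phi> \<otimes>\<^bsub>?G\<^esub> h) ` H. h \<theta>) = (\<Oplus>h\<in>H. (\<phi> \<otimes>\<^bsub>?G\<^esub> h) \<theta>)"
      using cl[OF _ t(1)] s' HG by (intro finsum_reindex) auto
    also have "\<dots> = (\<Oplus>h\<in>H. \<phi> (h \<theta>))"
      using ap[OF s' HG t(1)] cl[OF s'] hL by (intro finsum_cong') auto
    finally show ?thesis unfolding z_def using gal_group_finsum[OF L(1) s' finH hL] by simp
  qed
  show thesis
  proof (rule that)
    show "z \<in> L" using tr[OF s(1)] by simp
    show "s z \<noteq> z" using tr[OF s(1)] t(2) unfolding S_def z_def by auto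
    fix h assume h: "h \<in> H"
    have "(\<lambda>g. h \<otimes>\<^bsub>?G\<^esub> g) ` H = H"
    proof
      show "(\<lambda>g. h \<otimes>\<^bsub>?G\<^esub> g) ` H \<subseteq> H" using subgroup.m_closed[OF H h] by auto
      show "H \<subseteq> (\<lambda>g. h \<otimes>\<^bsub>?G\<^esub> g) ` H"
      proof
        fix g assume g: "g \<in> H"
        have "g = h \<otimes>\<^bsub>?G\<^esub> (inv\<^bsub>?G\<^esub> h \<otimes>\<^bsub>?G\<^esub> g)"
          using HG[OF h] HG[OF g] by (simp flip: G.m_assoc)
        then show "g \<in> (\<lambda>g. h \<otimes>\<^bsub>?G\<^esub> g) ` H"
          using subgroup.m_closed[OF H subgroup.m_inv_closed[OF H h] g] by blast
      qed
    qed
    then show "h z = z" using tr[OF HG[OF h]] unfolding z_def by simp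
  qed
qed

section \<open>The compositum of the extensions of bounded degree\<close>

lemma simple_extension_in_compositum:
  assumes N: "subfield N R" and z: "z \<in> carrier R" "(algebraic over N) z" "degree (Irr N z) \<le> d"
  shows "z \<in> bounded_degree_compositum R N d"
proof -
  let ?E = "simple_extension N z"
  have "subfield ?E R" using simple_extension_is_subfield[OF N z(1)] z(2) by simp
  moreover have "N \<subseteq> ?E" "z \<in> ?E"
    using simple_extension_incl[OF subfieldE(3)[OF N] z(1)] simple_extension_mem[OF subfieldE(1)[OF
        N] z(1)] by auto
  moreover have "(finite_dimension over N) ?E"
    using finite_dimension_simple_extension[OF N z(1)] z(2) unfolding over_def by simp
  moreover have "(dim over N) ?E \<le> d" using simple_extension_dim[OF N z(1,2)] z(3) by simp
  ultimately show ?thesis unfolding bounded_degree_compositum_def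
      by (intro generate_field.incl) blast
qed

lemma compositum_subfield: "subfield (bounded_degree_compositum R N d) R"
  unfolding bounded_degree_compositum_def
  by (intro generate_field_is_subfield) (use subfieldE(3) in blast)

lemma base_in_compositum:
  assumes N: "subfield N R" and d: "d \<ge> 1" shows "N \<subseteq> bounded_degree_compositum R N d"
proof
  fix x assume x: "x \<in> N"
  have 1: "dimension 1 N N" using dimension_one[OF N] .
  have "(finite_dimension over N) N" unfolding over_def using finite_dimensionI[OF 1] .
  moreover have "(dim over N) N \<le> d" using dimI[OF N 1] d by simp
  ultimately show "x \<in> bounded_degree_compositum R N d"
    unfolding bounded_degree_compositum_def using N x by (intro generate_field.incl) blast
qed

theorem abelian_exponent_compositum:
  assumes ac: "algebraically_closed R" and F: "galois_ext R N F"
    and fin: "finite (carrier (gal_group R F N))" and comm: "comm_group (gal_group R F N)"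
    and e: "e \<ge> 1" "\<And>g. g \<in> carrier (gal_group R F N) \<Longrightarrow> g [^]\<^bsub>gal_group R F N\<^esub> e = \<one>\<^bsub>gal_group R F
        N\<^esub>"
  shows "F \<subseteq> bounded_degree_compositum R N e"
proof
  let ?G = "gal_group R F N" and ?B = "bounded_degree_compositum R N e"
  interpret G: comm_group ?G by fact
  note ff = galois_extD[OF F]
  have Fr: "subring F R" using ff(2) subfieldE(1) by blast
  have Fc: "F \<subseteq> carrier R" using subringE(1)[OF Fr] .
  note fs = subringE[OF Fr] and bs = subringE[OF subfieldE(1)[OF compositum_subfield[of N e]]]
  have ap: "(\<phi> \<otimes>\<^bsub>?G\<^esub> \<tau>) x = \<phi> (\<tau> x)" if "\<phi> \<in> carrier ?G" "\<tau> \<in> carrier ?G" "x \<in> F" for \<phi> \<tau> x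
    using gal_group_mult[OF that(1,2)] that(3) by (simp add: compose_eq)
  \<comment> \<open>The compositum is formed in the whole algebraic closure and may leave
    \<open>F\<close>; its intersection with \<open>F\<close> is an intermediate field, to which
    \<open>fixed_field_of_fixing_group\<close> applies.\<close>
  define Q where "Q = ?B \<inter> F"
  have Q: "subfield Q R"
  proof (rule subfieldI'[OF subringI])
    show "inv a \<in> Q" if "a \<in> Q - {\<zero>}" for a
      using that subfield_m_inv(1)[OF compositum_subfield, of a N e] subfield_m_inv(1)[OF ff(2), of
          a]
      unfolding Q_def by simp
  qed (use fs bs in \<open>auto simp: Q_def\<close>)
  have NQ: "N \<subseteq> Q" unfolding Q_def using base_in_compositum[OF ff(1) e(1)] ff(3) by simp
  have QF: "Q \<subseteq> F" unfolding Q_def by simp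
  fix x assume x: "x \<in> F"
  show "x \<in> ?B"
  proof (rule ccontr)
    assume "x \<notin> ?B"
    then have xQ: "x \<notin> Q" unfolding Q_def by simp
    obtain s where s: "s \<in> carrier ?G" "\<And>d. d \<in> Q \<Longrightarrow> s d = d" "s x \<noteq> x"
      using fixed_field_of_fixing_group[OF ac F Q NQ QF x xQ] by metis
    have "s \<noteq> \<one>\<^bsub>?G\<^esub>" using s(3) x unfolding gal_group_one by auto
    then obtain H T where H: "subgroup H ?G" "s \<notin> H" and T: "finite T" "T \<subseteq> carrier ?G" "card T \<le> e"
      "\<And>g. g \<in> carrier ?G \<Longrightarrow> \<exists>r\<in>T. \<exists>h\<in>H. g = h \<otimes>\<^bsub>?G\<^esub> r"
      using G.avoiding_subgroup_cover[OF fin s(1) _ e] by metis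
    obtain z where z: "z \<in> F" "\<And>h. h \<in> H \<Longrightarrow> h z = z" "s z \<noteq> z"
      using fixed_element_moved[OF Fr ff(3) fin H(1) s(1) H(2)] by metis
    have "\<phi> z \<in> (\<lambda>r. r z) ` T" if sg: "\<phi> \<in> carrier ?G" for \<phi>
    proof -
      obtain r h where r: "r \<in> T" "h \<in> H" "\<phi> = h \<otimes>\<^bsub>?G\<^esub> r" using T(4)[OF sg] by blast
      have hr: "h \<in> carrier ?G" "r \<in> carrier ?G" using r T(2) subgroup.mem_carrier[OF H(1)] by auto
      \<comment> \<open>The cover consists of cosets \<open>H r\<close>. Commutativity moves the
        factor in \<open>H\<close> next to \<open>z\<close>, which it fixes, so the conjugates of
        \<open>z\<close> are its images under the representatives alone.\<close>
      have "\<phi> = r \<otimes>\<^bsub>?G\<^esub> h" using r(3) G.m_comm[OF hr] by simp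
      then have "\<phi> z = r z" using ap[OF hr(2,1) z(1)] z(2)[OF r(2)] by simp
      then show ?thesis using r(1) by blast
    qed
    then have "degree (Irr N z) \<le> card ((\<lambda>r. r z) ` T)"
      using degree_le_conjugates[OF ac F z(1) finite_imageI[OF T(1)]] by blast
    also have "\<dots> \<le> e" using card_image_le[OF T(1), of "\<lambda>r. r z"] T(3) by linarith
    finally have "z \<in> ?B"
      using simple_extension_in_compositum[OF ff(1) subsetD[OF Fc z(1)] ff(4)[OF z(1)]] by blast
    then have "z \<in> Q" unfolding Q_def using z(1) by simp
    then show False using s(2) z(3) by blast
  qed
qed

text \<open>Every automorphism of \<open>E\<close> is the restriction of one of \<open>F\<close>, so
  commutativity passes to this quotient of the larger group.\<close>

lemma gal_group_comm_subextension:
  assumes ac: "algebraically_closed R" and F: "galois_ext R N F" and E: "galois_ext R N E" "E \<subseteq> F"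
    and comm: "comm_group (gal_group R F N)"
  shows "comm_group (gal_group R E N)"
proof -
  let ?G = "gal_group R E N"
  interpret F: comm_group "gal_group R F N" by fact
  note ff = galois_extD[OF F] and ee = galois_extD[OF E(1)]
  have Er: "subring E R" using ee(2) subfieldE(1) by blast
  interpret G: group ?G by (rule group_gal_group[OF Er ee(3)])
  have lift: "\<exists>\<phi>'\<in>carrier (gal_group R F N). \<forall>x\<in>E. \<phi>' x = \<phi> x" if s: "\<phi> \<in> carrier ?G" for \<phi>
  proof -
    have h: "restricted_hom E \<phi>" using gal_group_restricted_hom[OF subringE(1)[OF Er] s] .
    obtain \<phi>' where "\<phi>' \<in> carrier (gal_group R F N)" "\<And>d. d \<in> E \<Longrightarrow> \<phi>' d = \<phi> d"
      using gal_group_lift[OF ac F ee(2,3) E(2) h gal_groupD(7)[OF s]] by metis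
    then show ?thesis by blast
  qed
  show ?thesis
  proof (rule G.group_comm_groupI)
    fix \<phi> \<tau> assume s: "\<phi> \<in> carrier ?G" and t: "\<tau> \<in> carrier ?G"
    obtain \<phi>' where s': "\<phi>' \<in> carrier (gal_group R F N)" "\<And>x. x \<in> E \<Longrightarrow> \<phi>' x = \<phi> x" using lift[OF s]
        by blast
    obtain \<tau>' where t': "\<tau>' \<in> carrier (gal_group R F N)" "\<And>x. x \<in> E \<Longrightarrow> \<tau>' x = \<tau> x" using lift[OF t]
        by blast
    have c: "compose F \<phi>' \<tau>' = compose F \<tau>' \<phi>'"
      using F.m_comm[OF s'(1) t'(1)] gal_group_mult[OF s'(1) t'(1)] gal_group_mult[OF t'(1) s'(1)]
          by simp
    have "compose E \<phi> \<tau> x = compose E \<tau> \<phi> x" for x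
    proof (cases "x \<in> E")
      case True
      then have xF: "x \<in> F" using E(2) by auto
      have "\<phi>' (\<tau>' x) = \<tau>' (\<phi>' x)" using fun_cong[OF c, of x] xF by (simp add: compose_eq)
      then show ?thesis
        using True s'(2) t'(2) gal_groupD(3)[OF s True] gal_groupD(3)[OF t True]
            by (simp add: compose_eq)
    qed (simp add: compose_def)
    then show "\<phi> \<otimes>\<^bsub>?G\<^esub> \<tau> = \<tau> \<otimes>\<^bsub>?G\<^esub> \<phi>"
      using gal_group_mult[OF s t] gal_group_mult[OF t s] by auto
  qed
qed

end

section \<open>Residue fields and Frobenius subgroups\<close>

text \<open>A longest independent list spans, since a vector outside its span would lengthen
  it.\<close>

lemma (in ring) dimension_if_independent_bounded:
  assumes K: "subfield K R" and bound: "\<And>Us. independent K Us \<Longrightarrow> length Us \<le> n"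
  obtains m where "m \<le> n" "dimension m K (carrier R)"
proof -
  obtain Us where Us: "independent K Us" "\<And>Vs. independent K Vs \<Longrightarrow> length Vs \<le> length Us"
    using ex_has_greatest_nat[of "independent K" "[]" length "Suc n"] bound le_imp_less_Suc
    by (metis independent.li_Nil)
  have "Span K Us = carrier R"
  proof
    show "Span K Us \<subseteq> carrier R"
      using Span_in_carrier[OF subfieldE(3)[OF K] independent_in_carrier[OF Us(1)]] .
    show "carrier R \<subseteq> Span K Us"
    proof
      fix u assume u: "u \<in> carrier R"
      show "u \<in> Span K Us"
      proof (rule ccontr)
        assume "u \<notin> Span K Us"
        then have "independent K (u # Us)" using independent.li_Cons u Us(1) by blast
        then show False using Us(2) by fastforce
      qed
    qed
  qed
  then have "dimension (length Us) K (carrier R)" using dimension_independent[OF Us(1)] by simp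
  then show thesis using that bound[OF Us(1)] by blast
qed

text \<open>Finiteness is known only for the target. Independent lists remain independent under an
  injective homomorphism, which bounds their length and thereby makes the source
  finite-dimensional.\<close>

lemma (in ring_hom_ring) dimension_le_of_inj_hom:
  assumes K: "subfield K R" and one: "\<one>\<^bsub>S\<^esub> \<noteq> \<zero>\<^bsub>S\<^esub>" and inj: "inj_on h (carrier R)"
    and dim: "S.dimension n (h ` K) (carrier S)"
  obtains m where "m \<le> n" "R.dimension m K (carrier R)"
proof (rule R.dimension_if_independent_bounded[OF K _ that])
  fix Us assume Us: "R.independent K Us"
  have c: "set Us \<subseteq> carrier R" using R.independent_in_carrier[OF Us] .
  have "inj_on h (R.Span K Us)"
    using inj_on_subset[OF inj R.Span_in_carrier[OF subfieldE(3)[OF K] c]] .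
  then have "S.independent (h ` K) (map h Us)" using inj_hom_preserves_independent[OF K one _ Us]
      by blast
  moreover have "set (map h Us) \<subseteq> carrier S" using c by auto
  ultimately show "length Us \<le> n"
    using S.independent_length_le_dimension[OF img_is_subfield(2)[OF K one] dim] by fastforce
qed

lemma (in cring) quotient_field:
  assumes P: "primeideal P R" and inv: "\<And>x. x \<in> carrier R \<Longrightarrow> x \<notin> P \<Longrightarrow> \<exists>y\<in>carrier R. x \<otimes> y \<ominus> \<one> \<in> P"
  shows "field (R Quot P)"
proof -
  interpret P: primeideal P R by fact
  interpret Q: domain "R Quot P" by (rule P.quotient_is_domain)
  note hom = ring_hom_memE[OF P.rcos_ring_hom]
  have id: "ideal P R" by (rule P.ideal_axioms)
  show ?thesis
  proof (rule Q.cring_fieldI2)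
    show "\<zero>\<^bsub>R Quot P\<^esub> \<noteq> \<one>\<^bsub>R Quot P\<^esub>" using Q.one_not_zero by simp
    fix a assume a: "a \<in> carrier (R Quot P)" "a \<noteq> \<zero>\<^bsub>R Quot P\<^esub>"
    obtain x where x: "x \<in> carrier R" "a = P +> x" using a(1) unfolding FactRing_def A_RCOSETS_def'
        by auto
    have "x \<notin> P"
    proof
      assume "x \<in> P"
      then have "P +> x = P" using P.a_rcos_const by simp
      then show False using a(2) x(2) unfolding FactRing_def by simp
    qed
    then obtain y where y: "y \<in> carrier R" "x \<otimes> y \<ominus> \<one> \<in> P" using inv x(1) by blast
    have "P +> (x \<otimes> y) = P +> \<one>" using quotient_eq_iff_same_a_r_cos[OF id] x(1) y by simp
    then have "a \<otimes>\<^bsub>R Quot P\<^esub> (P +> y) = \<one>\<^bsub>R Quot P\<^esub>" using hom(2)[OF x(1) y(1)] hom(4) x(2) by simp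
    moreover have "P +> y \<in> carrier (R Quot P)" using hom(1)[OF y(1)] .
    ultimately show "\<exists>b\<in>carrier (R Quot P). a \<otimes>\<^bsub>R Quot P\<^esub> b = \<one>\<^bsub>R Quot P\<^esub>" by blast
  qed
qed

lemma (in ring) subfield_restrict:
  assumes "subfield k R" "k \<subseteq> B" "subring B R" shows "subfield k (R\<lparr>carrier := B\<rparr>)"
  by (rule ring.subfield_iff(1)[OF subring_is_ring[OF assms(3)]])
    (use subfield_iff(2)[OF assms(1)] assms(2) in auto)

text \<open>\<open>B/P \<rightarrow> B'/P'\<close> is injective because \<open>P\<close> is the contraction of \<open>P'\<close>.\<close>

lemma (in ring) quotient_dimension_le:
  assumes B: "subring B R" "subring B' R" "B \<subseteq> B'" and k: "subfield k R" "k \<subseteq> B"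
    and P: "primeideal P (R\<lparr>carrier := B\<rparr>)" and P': "primeideal P' (R\<lparr>carrier := B'\<rparr>)"
    and PP: "P' \<inter> B = P"
    and dim: "ring.dimension (R\<lparr>carrier := B'\<rparr> Quot P') n ((\<lambda>c. P' +> c) ` k)
      (carrier (R\<lparr>carrier := B'\<rparr> Quot P'))"
  obtains m where "m \<le> n" "ring.dimension (R\<lparr>carrier := B\<rparr> Quot P) m ((\<lambda>c. P +> c) ` k)
      (carrier (R\<lparr>carrier := B\<rparr> Quot P))" "subfield ((\<lambda>c. P +> c) ` k) (R\<lparr>carrier := B\<rparr> Quot P)"
proof -
  let ?R = "R\<lparr>carrier := B\<rparr>" and ?R' = "R\<lparr>carrier := B'\<rparr>"
  let ?Q = "?R Quot P" and ?Q' = "?R' Quot P'"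
  interpret RB: ring ?R by (rule subring_is_ring[OF B(1)])
  interpret RB': ring ?R' by (rule subring_is_ring[OF B(2)])
  interpret P: primeideal P ?R by fact
  interpret P': primeideal P' ?R' by fact
  interpret Q: domain ?Q by (rule P.quotient_is_domain)
  interpret Q': domain ?Q' by (rule P'.quotient_is_domain)
  have cos: "S +>\<^bsub>?R\<^esub> a = S +> a" "S +>\<^bsub>?R'\<^esub> a = S +> a" for S a
    unfolding a_r_coset_def r_coset_def by simp_all
  interpret h: ring_hom_ring ?R ?Q "\<lambda>a. P +> a"
    using P.rcos_ring_hom_ring unfolding cos .
  interpret h': ring_hom_ring ?R' ?Q' "\<lambda>a. P' +> a"
    using P'.rcos_ring_hom_ring unfolding cos .
  \<comment> \<open>Differences are formed within a carrier, so those taken in \<open>B\<close> and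
    in \<open>B'\<close> have to be identified before cosets of \<open>P\<close> and
    \<open>P'\<close> can be compared.\<close>
  have minus: "a \<ominus>\<^bsub>?R\<^esub> b = a \<ominus>\<^bsub>?R'\<^esub> b" if "a \<in> B" "b \<in> B" for a b
  proof -
    have "\<ominus>\<^bsub>?R'\<^esub> b = \<ominus>\<^bsub>?R\<^esub> b"
      using that B(3) RB.l_neg[of b] RB.a_inv_closed[of b] by (intro RB'.minus_equality) auto
    then show ?thesis unfolding a_minus_def by simp
  qed
  have eq: "P +> a = P +> b \<longleftrightarrow> P' +> a = P' +> b" if ab: "a \<in> B" "b \<in> B" for a b
  proof -
    have "P +> a = P +> b \<longleftrightarrow> a \<ominus>\<^bsub>?R\<^esub> b \<in> P"
      using RB.quotient_eq_iff_same_a_r_cos[OF P.ideal_axioms, of a b] ab unfolding cos by simp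
    also have "\<dots> \<longleftrightarrow> a \<ominus>\<^bsub>?R'\<^esub> b \<in> P'"
      using minus[OF ab] PP RB.minus_closed[of a b] ab by auto
    also have "\<dots> \<longleftrightarrow> P' +> a = P' +> b"
      using RB'.quotient_eq_iff_same_a_r_cos[OF P'.ideal_axioms, of a b] ab B(3) unfolding cos
          by auto
    finally show ?thesis .
  qed
  have QE: "\<exists>a\<in>B. Y = P +> a" if "Y \<in> carrier ?Q" for Y
    using that unfolding FactRing_def A_RCOSETS_def' cos by auto
  \<comment> \<open>A coset of \<open>P\<close> is sent to the coset of \<open>P'\<close> of an
    arbitrary representative. One direction of \<open>eq\<close> makes this well defined, the other
    makes it injective.\<close>
  define j where "j Y = P' +> (SOME a. a \<in> B \<and> Y = P +> a)" for Y
  have j: "j (P +> a) = P' +> a" if a: "a \<in> B" for a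
  proof -
    have "\<exists>b. b \<in> B \<and> P +> a = P +> b" using a by blast
    then have "(SOME b. b \<in> B \<and> P +> a = P +> b) \<in> B \<and> P +> a = P +> (SOME b. b \<in> B \<and> P +> a = P +>
        b)"
      by (rule someI_ex)
    then show ?thesis unfolding j_def using eq[OF a, of "SOME b. b \<in> B \<and> P +> a = P +> b"] by simp
  qed
  have jhom: "j \<in> ring_hom ?Q ?Q'"
  proof (rule ring_hom_memI)
    fix Y assume "Y \<in> carrier ?Q"
    then obtain a where a: "a \<in> B" "Y = P +> a" using QE by blast
    then show "j Y \<in> carrier ?Q'" using j[OF a(1)] h'.hom_closed[of a] B(3) by auto
  next
    fix Y Z assume "Y \<in> carrier ?Q" "Z \<in> carrier ?Q"
    then obtain a b where a: "a \<in> B" "Y = P +> a" and b: "b \<in> B" "Z = P +> b" using QE by meson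
    have ab: "a \<otimes> b \<in> B" "a \<oplus> b \<in> B" using subringE(6,7)[OF B(1) a(1) b(1)] by auto
    have "Y \<otimes>\<^bsub>?Q\<^esub> Z = P +> (a \<otimes> b)" using h.hom_mult[of a b] a b by simp
    then have "j (Y \<otimes>\<^bsub>?Q\<^esub> Z) = P' +> (a \<otimes> b)" using j[OF ab(1)] by simp
    also have "\<dots> = (P' +> a) \<otimes>\<^bsub>?Q'\<^esub> (P' +> b)" using h'.hom_mult[of a b] a(1) b(1) B(3) by auto
    finally show "j (Y \<otimes>\<^bsub>?Q\<^esub> Z) = j Y \<otimes>\<^bsub>?Q'\<^esub> j Z" using j[OF a(1)] j[OF b(1)] a(2) b(2) by simp
    have "Y \<oplus>\<^bsub>?Q\<^esub> Z = P +> (a \<oplus> b)" using h.hom_add[of a b] a b by simp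
    then have "j (Y \<oplus>\<^bsub>?Q\<^esub> Z) = P' +> (a \<oplus> b)" using j[OF ab(2)] by simp
    also have "\<dots> = (P' +> a) \<oplus>\<^bsub>?Q'\<^esub> (P' +> b)" using h'.hom_add[of a b] a(1) b(1) B(3) by auto
    finally show "j (Y \<oplus>\<^bsub>?Q\<^esub> Z) = j Y \<oplus>\<^bsub>?Q'\<^esub> j Z" using j[OF a(1)] j[OF b(1)] a(2) b(2) by simp
  next
    show "j \<one>\<^bsub>?Q\<^esub> = \<one>\<^bsub>?Q'\<^esub>" using j[OF subringE(3)[OF B(1)]] h.hom_one h'.hom_one by simp
  qed
  interpret J: ring_hom_ring ?Q ?Q' j
      by (rule ring_hom_ringI2[OF Q.ring_axioms Q'.ring_axioms jhom])
  have inj: "inj_on j (carrier ?Q)"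
  proof (rule inj_onI)
    fix Y Z assume YZ: "Y \<in> carrier ?Q" "Z \<in> carrier ?Q" "j Y = j Z"
    then obtain a b where a: "a \<in> B" "Y = P +> a" and b: "b \<in> B" "Z = P +> b" using QE by meson
    then show "Y = Z" using YZ(3) j[OF a(1)] j[OF b(1)] eq[OF a(1) b(1)] by simp
  qed
  have kB: "subfield k ?R" by (rule subfield_restrict[OF k B(1)])
  have l: "subfield ((\<lambda>c. P +> c) ` k) ?Q" using h.img_is_subfield(2)[OF kB Q.one_not_zero] .
  have "j ` (\<lambda>c. P +> c) ` k = (\<lambda>c. P' +> c) ` k"
    unfolding image_image using j k(2) by (intro image_cong) auto
  then obtain m where "m \<le> n" "Q.dimension m ((\<lambda>c. P +> c) ` k) (carrier ?Q)"
    using J.dimension_le_of_inj_hom[OF l Q'.one_not_zero inj, of n] dim by metis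
  then show thesis using that l by blast
qed

section \<open>Passing between specializations of a subextension and of the whole extension\<close>

lemma compositum_props:
  assumes om: "plain_field \<Omega>" and h: "\<iota> ` F \<subseteq> carrier \<Omega>" and k: "subfield k \<Omega>" and E: "E \<subseteq> F"
  shows "subfield (compositum \<Omega> \<iota> k F) \<Omega>" "k \<subseteq> compositum \<Omega> \<iota> k F"
    "compositum \<Omega> \<iota> k E \<subseteq> compositum \<Omega> \<iota> k F"
proof -
  interpret plain_field \<Omega> by fact
  have c: "k \<union> \<iota> ` F \<subseteq> carrier \<Omega>" using subfieldE(3)[OF k] h by auto
  show "subfield (compositum \<Omega> \<iota> k F) \<Omega>" unfolding compositum_def
      by (rule generate_field_is_subfield[OF c])
  show "k \<subseteq> compositum \<Omega> \<iota> k F" unfolding compositum_def by (auto intro: generate_field.incl)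
  show "compositum \<Omega> \<iota> k E \<subseteq> compositum \<Omega> \<iota> k F"
    unfolding compositum_def using E by (intro mono_generate_field[OF _ c]) auto
qed

text \<open>Going from a subextension \<open>E\<close> to \<open>F\<close>: lying over produces a specialization of \<open>F\<close>, whose
  residue field contains that of \<open>E\<close>.\<close>

lemma specialization_lift:
  assumes FC: "F \<subseteq> carrier C" "E \<subseteq> F"
    and sp: "specialization_at C K n I \<xi> E \<Omega> \<iota> k t i P"
  obtains P' where "specialization_at C K n I \<xi> F \<Omega> \<iota> k t i P'"
    "\<And>b. (ring.finite_dimension (spec_field \<Omega> \<iota> k n \<xi> F i P') over spec_base \<Omega> k P') (carrier
        (spec_field \<Omega> \<iota> k n \<xi> F i P')) \<Longrightarrow>
      (ring.dim (spec_field \<Omega> \<iota> k n \<xi> F i P') over spec_base \<Omega> k P') (carrier (spec_field \<Omega> \<iota> k n \<xi>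
          F i P')) \<le> b \<Longrightarrow>
      \<exists>m\<le>b. plain_field (spec_field \<Omega> \<iota> k n \<xi> E i P) \<and> subfield (spec_base \<Omega> k P) (spec_field \<Omega> \<iota> k
          n \<xi> E i P) \<and>
        ring.dimension (spec_field \<Omega> \<iota> k n \<xi> E i P) m (spec_base \<Omega> k P) (carrier (spec_field \<Omega> \<iota> k n
            \<xi> E i P))"
proof -
  have sc: "scalar_extension C K n I \<xi> \<Omega> \<iota> k"
    and pt: "proj_point \<Omega> k n (base_change \<iota> \<Omega> k n I) t" and i: "i \<le> n" "t i \<noteq> \<zero>\<^bsub>\<Omega>\<^esub>"
    and P: "primeideal P (\<Omega>\<lparr>carrier := spec_ring \<Omega> \<iota> k n \<xi> E i\<rparr>)"
    and PA: "P \<inter> chart_ring \<Omega> k n (\<iota> \<circ> \<xi>) i = chart_max_ideal \<Omega> k n (\<iota> \<circ> \<xi>) i t"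
    using sp unfolding specialization_at_def by auto
  have ac: "algebraically_closed \<Omega>" and hom: "\<iota> \<in> ring_hom C \<Omega>" and k: "subfield k \<Omega>"
    and gp: "generic_point \<Omega> k n (base_change \<iota> \<Omega> k n I) (\<iota> \<circ> \<xi>)"
    using sc unfolding scalar_extension_def by auto
  have om: "plain_field \<Omega>" using ac unfolding plain_field_def algebraically_closed_def by blast
  interpret om: plain_field \<Omega> by fact
  let ?x = "\<iota> \<circ> \<xi>"
  define A B B' where "A = chart_ring \<Omega> k n ?x i" and "B = spec_ring \<Omega> \<iota> k n \<xi> E i"
    and "B' = spec_ring \<Omega> \<iota> k n \<xi> F i"
  have x: "?x j \<in> carrier \<Omega>" if "j \<le> n" for j using gp that unfolding generic_point_def by blast
  have tk: "t j \<in> k" if "j \<le> n" for j using pt that unfolding proj_point_def by blast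
  have xi: "?x i \<noteq> \<zero>\<^bsub>\<Omega>\<^esub>" by (rule om.generic_point_nonzero[OF k gp pt i])
  have kr: "subring k \<Omega>" using subfieldE(1)[OF k] .
  have A: "subring A \<Omega>" unfolding A_def by (rule om.chart_ring_subring[where x = ?x
      and n = n, OF x kr i(1) xi])
  have kA: "k \<subseteq> A" unfolding A_def by (rule om.base_in_chart_ring[where x = ?x
      and n = n, OF x kr i(1) xi])
  have FO: "\<iota> ` F \<subseteq> carrier \<Omega>" "\<iota> ` E \<subseteq> carrier \<Omega>" using FC ring_hom_memE(1)[OF hom] by auto
  note cF = compositum_props[OF om FO(1) k FC(2)]
  note cE = compositum_props[OF om FO(2) k order_refl]
  have Er: "subring (compositum \<Omega> \<iota> k E) \<Omega>" "subring (compositum \<Omega> \<iota> k F) \<Omega>"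
    using subfieldE(1) cE(1) cF(1) by auto
  have Bdef: "B = integral_closure \<Omega> A (compositum \<Omega> \<iota> k E)"
      "B' = integral_closure \<Omega> A (compositum \<Omega> \<iota> k F)"
    unfolding B_def B'_def A_def spec_ring_def by auto
  have Bs: "subring B \<Omega>" "subring B' \<Omega>" unfolding Bdef using om.integral_closure_subring[OF A] Er
      by auto
  have BB': "B \<subseteq> B'" unfolding Bdef integral_closure_def using cF(3) by auto
  have kB: "k \<subseteq> B" unfolding Bdef integral_closure_def
    using kA cE(2) om.integral_over_self[OF A] by auto
  have P: "primeideal P (\<Omega>\<lparr>carrier := B\<rparr>)" using P unfolding B_def .
  have PA: "P \<inter> A = chart_max_ideal \<Omega> k n ?x i t" using PA unfolding A_def .
  have PB: "P \<subseteq> B"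
    using additive_subgroup.a_subset[OF ideal.axioms(1)[OF primeideal.axioms(1)[OF P]]] by simp
  have res: "\<exists>c\<in>k. a \<ominus>\<^bsub>\<Omega>\<^esub> c \<in> P" if "a \<in> A" for a
    using om.chart_ring_residue[where x = ?x and n = n and t = t
        and a = a, OF k x i(1) xi tk i(2)] that PA unfolding A_def by blast
  have AB: "A \<subseteq> B" by (rule om.residue_subset[OF subringE(1)[OF A] Bs(1) kB PB res])
  note inv = om.residue_integral_inverse[OF A Er(1) k kB Bdef(1) P res]
  obtain P' where P': "primeideal P' (\<Omega>\<lparr>carrier := B'\<rparr>)" "P' \<inter> B = P"
    using om.lying_over[OF A Er(2) cF(3), folded Bdef, OF AB P inv] by metis
  \<comment> \<open>Since \<open>A\<close> is contained in \<open>B\<close>, the primes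
    \<open>P'\<close> and \<open>P\<close> have the same trace on \<open>A\<close>; the new prime
    thus lies over the same point \<open>t\<close>.\<close>
  have sp': "specialization_at C K n I \<xi> F \<Omega> \<iota> k t i P'"
  proof -
    have "P' \<inter> A = P \<inter> A" using P'(2) AB by auto
    then show ?thesis using sc pt i P'(1) PA unfolding specialization_at_def A_def B'_def by simp
  qed
  have QF: "spec_field \<Omega> \<iota> k n \<xi> F i P' = \<Omega>\<lparr>carrier := B'\<rparr> Quot P'"
    and QE: "spec_field \<Omega> \<iota> k n \<xi> E i P = \<Omega>\<lparr>carrier := B\<rparr> Quot P"
    unfolding spec_field_def B_def B'_def by auto
  show thesis
  proof (rule that[OF sp'])
    fix b :: nat
    assume fd: "(ring.finite_dimension (spec_field \<Omega> \<iota> k n \<xi> F i P') over spec_base \<Omega> k P') (carrier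
        (spec_field \<Omega> \<iota> k n \<xi> F i P'))"
      and db: "(ring.dim (spec_field \<Omega> \<iota> k n \<xi> F i P') over spec_base \<Omega> k P') (carrier (spec_field \<Omega>
          \<iota> k n \<xi> F i P')) \<le> b"
    let ?Q' = "\<Omega>\<lparr>carrier := B'\<rparr> Quot P'"
    interpret P': primeideal P' "\<Omega>\<lparr>carrier := B'\<rparr>" by (rule P'(1))
    interpret Q': domain ?Q' by (rule P'.quotient_is_domain)
    interpret h': ring_hom_ring "\<Omega>\<lparr>carrier := B'\<rparr>" ?Q' "\<lambda>a. P' +>\<^bsub>\<Omega>\<^esub> a"
      using P'.rcos_ring_hom_ring unfolding a_r_coset_def r_coset_def by simp
    have "subfield k (\<Omega>\<lparr>carrier := B'\<rparr>)" using om.subfield_restrict[OF k _ Bs(2)] kB BB' by auto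
    then have sb: "subfield (spec_base \<Omega> k P') ?Q'"
      using h'.img_is_subfield(2)[OF _ Q'.one_not_zero] unfolding spec_base_def by blast
    \<comment> \<open>The number \<open>dim\<close> describes the space only if it is
      finite-dimensional; the hypothesis \<open>fd\<close> turns it into a statement about
      \<open>dimension\<close>.\<close>
    define d where "d = (Q'.dim over spec_base \<Omega> k P') (carrier ?Q')"
    have "Q'.dimension d (spec_base \<Omega> k P') (carrier ?Q')" unfolding d_def
      by (rule Q'.finite_dimensionE[OF sb]) (use fd in \<open>simp add: QF over_def\<close>)
    then obtain m where m: "m \<le> d"
      "ring.dimension (\<Omega>\<lparr>carrier := B\<rparr> Quot P) m (spec_base \<Omega> k P) (carrier (\<Omega>\<lparr>carrier := B\<rparr> Quot
          P))"
      "subfield (spec_base \<Omega> k P) (\<Omega>\<lparr>carrier := B\<rparr> Quot P)"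
      using om.quotient_dimension_le[OF Bs BB' k kB P P', folded spec_base_def] by metis
    have BR: "cring (\<Omega>\<lparr>carrier := B\<rparr>)" using primeideal.axioms(2)[OF P] .
    interpret RB: cring "\<Omega>\<lparr>carrier := B\<rparr>" by (rule BR)
    have "field (\<Omega>\<lparr>carrier := B\<rparr> Quot P)"
    proof (rule RB.quotient_field[OF P])
      fix u assume u: "u \<in> carrier (\<Omega>\<lparr>carrier := B\<rparr>)" "u \<notin> P"
      then obtain y where y: "y \<in> B" "u \<otimes>\<^bsub>\<Omega>\<^esub> y \<ominus>\<^bsub>\<Omega>\<^esub> \<one>\<^bsub>\<Omega>\<^esub> \<in> P" using inv by auto
      have "\<ominus>\<^bsub>\<Omega>\<lparr>carrier := B\<rparr>\<^esub> \<one>\<^bsub>\<Omega>\<^esub> = \<ominus>\<^bsub>\<Omega>\<^esub> \<one>\<^bsub>\<Omega>\<^esub>"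
        using subringE(3,5)[OF Bs(1)] by (intro RB.minus_equality) (auto simp: om.l_neg)
      then show "\<exists>y\<in>carrier (\<Omega>\<lparr>carrier := B\<rparr>). u \<otimes>\<^bsub>\<Omega>\<lparr>carrier := B\<rparr>\<^esub> y \<ominus>\<^bsub>\<Omega>\<lparr>carrier := B\<rparr>\<^esub> \<one>\<^bsub>\<Omega>\<lparr>carrier
          := B\<rparr>\<^esub> \<in> P"
        using y by (intro bexI[of _ y]) (auto simp: a_minus_def)
    qed
    then have "plain_field (spec_field \<Omega> \<iota> k n \<xi> E i P)" unfolding QE plain_field_def .
    moreover have "m \<le> b" using m(1) db unfolding d_def QF by simp
    ultimately show "\<exists>m\<le>b. plain_field (spec_field \<Omega> \<iota> k n \<xi> E i P) \<and> subfield (spec_base \<Omega> k P)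
        (spec_field \<Omega> \<iota> k n \<xi> E i P) \<and>
        ring.dimension (spec_field \<Omega> \<iota> k n \<xi> E i P) m (spec_base \<Omega> k P) (carrier (spec_field \<Omega> \<iota> k n
            \<xi> E i P))"
      using m(2,3) unfolding QE by blast
  qed
qed

text \<open>By its definition the Frobenius subgroup is an image of the automorphism group of the
  residue extension, and bounds for the latter carry over. The summand \<open>1\<close> keeps the
  base positive, so that the exponent may be raised from \<open>m\<close> to
  \<open>b\<close>.\<close>

lemma frobenius_subgroup_card:
  assumes L: "plain_field (spec_field \<Omega> \<iota> k n \<xi> E i P)"
    and l: "subfield (spec_base \<Omega> k P) (spec_field \<Omega> \<iota> k n \<xi> E i P)"
    and dim: "ring.dimension (spec_field \<Omega> \<iota> k n \<xi> E i P) m (spec_base \<Omega> k P) (carrier (spec_field \<Omega>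
        \<iota> k n \<xi> E i P))"
    and mb: "m \<le> b"
  shows "finite (frobenius_subgroup \<Omega> \<iota> k n \<xi> E i P)"
      "card (frobenius_subgroup \<Omega> \<iota> k n \<xi> E i P) \<le> (b * b + 1) ^ b"
proof -
  let ?L = "spec_field \<Omega> \<iota> k n \<xi> E i P" and ?l = "spec_base \<Omega> k P"
  interpret L: plain_field ?L by fact
  note c = L.gal_group_card[OF l L.carrier_is_subring subfieldE(3)[OF l] dim]
  show "finite (frobenius_subgroup \<Omega> \<iota> k n \<xi> E i P)"
    unfolding frobenius_subgroup_def Let_def using c(1) by simp
  have "card (frobenius_subgroup \<Omega> \<iota> k n \<xi> E i P) \<le> (m * m) ^ m"
    unfolding frobenius_subgroup_def Let_def using card_image_le[OF c(1)] c(2) le_trans by blast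
  also have "\<dots> \<le> (b * b + 1) ^ m" using mb by (intro power_mono) (auto intro: mult_le_mono le_SucI)
  also have "\<dots> \<le> (b * b + 1) ^ b" using mb by (intro power_increasing) auto
  finally show "card (frobenius_subgroup \<Omega> \<iota> k n \<xi> E i P) \<le> (b * b + 1) ^ b" .
qed

text \<open>The order of \<open>g\<close> is the cardinality of the cyclic group it generates, hence
  of the conjugate \<open>H\<close>. It is at most \<open>d\<close> and positive, so it divides the
  factorial of \<open>d\<close>.\<close>

lemma (in group) pow_fact_of_conjugate_card:
  assumes g: "g \<in> carrier G" and h: "h \<in> carrier G"
    and H: "H = (\<lambda>x. h \<otimes> x \<otimes> inv h) ` generate G {g}" "finite H" "card H \<le> d"
  shows "g [^] (fact d :: nat) = \<one>"
proof -
  have gc: "generate G {g} \<subseteq> carrier G" using generate_incl[of "{g}"] g by simp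
  have inj: "inj_on (\<lambda>x. h \<otimes> x \<otimes> inv h) (generate G {g})"
    by (rule inj_onI) (use gc h in \<open>auto simp: subset_iff\<close>)
  have "card (generate G {g}) = card H" unfolding H(1) using card_image[OF inj] by simp
  moreover have "finite (generate G {g})" using H(2) finite_imageD[OF _ inj] unfolding H(1) by blast
  moreover have "g \<in> generate G {g}" by (rule generate.incl) simp
  ultimately have "0 < card H" by (metis card_gt_0_iff empty_iff)
  moreover have "ord g = card H" using generate_pow_card[OF g] \<open>card (generate G {g}) = card H\<close>
      by simp
  ultimately have "ord g dvd fact d" using H(3) by (intro dvd_fact) auto
  then show ?thesis using pow_eq_id[OF g] by simp
qed

theorem corollary2p9:
  fixes C :: "'a ring" and K F :: "'a set"
    and M :: "('a \<Rightarrow> int) set set"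
    and n :: nat and I :: "(nat multiset \<Rightarrow> 'a) set" and \<xi> :: "nat \<Rightarrow> 'a"
  assumes "algebraic_closure C (function_field C K n \<xi>)"
    and "subfield K C"
    and "M \<subseteq> places C K"
    and "smooth_projective_variety C K n I"
    and "generic_point C K n I \<xi>"
    and "galois_ext C (function_field C K n \<xi>) F"
    and "tchebotarev_existence C K n I \<xi> M F"
    and "uniformly_bounded_local_degrees C K n I \<xi> M F"
    and "comm_group (gal_group C F (function_field C K n \<xi>))"
  shows "\<exists>d\<ge>1. F \<subseteq> bounded_degree_compositum C (function_field C K n \<xi>) d"
proof -
  define N where "N = function_field C K n \<xi>"
  have closure: "algebraic_closure C N" using assms(1) unfolding N_def .
  interpret C: plain_field C
      by (rule plain_field.intro) (rule algebraic_closure.axioms(1)[OF closure])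
  interpret ac: algebraic_closure C N by (rule closure)
  have alg: "algebraically_closed C" by (rule ac.algebraically_closed_axioms)
  have F: "galois_ext C N F" using assms(6) unfolding N_def .
  have FC: "F \<subseteq> carrier C" using subfieldE(3)[OF C.galois_extD(2)[OF F]] .
  have comm: "comm_group (gal_group C F N)" using assms(9) unfolding N_def .
  obtain E where E: "\<And>j::nat. galois_ext C N (E j)" "\<And>j. (ring.finite_dimension C over N) (E j)"
    "\<And>j. tchebotarev_finite C K n I \<xi> M (E j)" and FE: "F = (\<Union>j. E j)"
    using assms(7) unfolding tchebotarev_existence_def Let_def N_def[symmetric] by metis
  obtain b where b: "\<And>(\<Omega> :: (nat \<Rightarrow> 'a) ring) \<iota> k w t i P.
      local_field C K M \<Omega> \<iota> k w \<Longrightarrow> specialization_at C K n I \<xi> F \<Omega> \<iota> k t i P \<Longrightarrow>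
      (ring.finite_dimension (spec_field \<Omega> \<iota> k n \<xi> F i P) over spec_base \<Omega> k P) (carrier (spec_field
          \<Omega> \<iota> k n \<xi> F i P)) \<and>
      (ring.dim (spec_field \<Omega> \<iota> k n \<xi> F i P) over spec_base \<Omega> k P) (carrier (spec_field \<Omega> \<iota> k n \<xi> F
          i P)) \<le> b"
    using assms(8) unfolding uniformly_bounded_local_degrees_def Let_def by metis
  \<comment> \<open>This depends on the uniform bound \<open>b\<close> but not on the layer
    \<open>j\<close>; therefore all layers lie in one and the same compositum.\<close>
  define d where "d = (b * b + 1) ^ b"
  have "E j \<subseteq> bounded_degree_compositum C N (fact d)" for j
  proof -
    let ?G = "gal_group C (E j) N"
    have EF: "E j \<subseteq> F" unfolding FE by blast
    note e = C.galois_extD[OF E(1)[of j]]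
    have Er: "subring (E j) C" using subfieldE(1)[OF e(2)] .
    interpret G: comm_group ?G by (rule C.gal_group_comm_subextension[OF alg F E(1) EF comm])
    have "ring.finite_dimension C N (E j)" using E(2) unfolding over_def .
    then obtain m where "ring.dimension C m N (E j)" by (rule C.finite_dimensionE')
    then have fin: "finite (carrier ?G)" using C.gal_group_card(1)[OF e(1) Er e(3)] by blast
    show ?thesis
    proof (rule C.abelian_exponent_compositum[OF alg E(1) fin G.comm_group_axioms])
      show "1 \<le> (fact d :: nat)" by (rule fact_ge_1)
      fix g assume g: "g \<in> carrier ?G"
      obtain \<Omega> :: "(nat \<Rightarrow> 'a) ring" and \<iota> k w t i P where
        lf: "local_field C K M \<Omega> \<iota> k w" and sp: "specialization_at C K n I \<xi> (E j) \<Omega> \<iota> k t i P"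
        and cyc: "\<exists>h\<in>carrier ?G. frobenius_subgroup \<Omega> \<iota> k n \<xi> (E j) i P =
          (\<lambda>x. h \<otimes>\<^bsub>?G\<^esub> x \<otimes>\<^bsub>?G\<^esub> inv\<^bsub>?G\<^esub> h) ` generate ?G {g}"
        using E(3)[of j] g unfolding tchebotarev_finite_def Let_def N_def[symmetric] by metis
      obtain P' where P': "specialization_at C K n I \<xi> F \<Omega> \<iota> k t i P'"
        and dims: "\<exists>m\<le>b. plain_field (spec_field \<Omega> \<iota> k n \<xi> (E j) i P) \<and>
          subfield (spec_base \<Omega> k P) (spec_field \<Omega> \<iota> k n \<xi> (E j) i P) \<and>
          ring.dimension (spec_field \<Omega> \<iota> k n \<xi> (E j) i P) m (spec_base \<Omega> k P)
            (carrier (spec_field \<Omega> \<iota> k n \<xi> (E j) i P))"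
        using specialization_lift[OF FC EF sp] b[OF lf] by metis
      then obtain m where m: "m \<le> b" "plain_field (spec_field \<Omega> \<iota> k n \<xi> (E j) i P)"
          "subfield (spec_base \<Omega> k P) (spec_field \<Omega> \<iota> k n \<xi> (E j) i P)"
          "ring.dimension (spec_field \<Omega> \<iota> k n \<xi> (E j) i P) m (spec_base \<Omega> k P)
            (carrier (spec_field \<Omega> \<iota> k n \<xi> (E j) i P))"
        by (elim exE conjE)
      note card = frobenius_subgroup_card[OF m(2,3,4,1)]
      obtain h where h: "h \<in> carrier ?G" "frobenius_subgroup \<Omega> \<iota> k n \<xi> (E j) i P =
          (\<lambda>x. h \<otimes>\<^bsub>?G\<^esub> x \<otimes>\<^bsub>?G\<^esub> inv\<^bsub>?G\<^esub> h) ` generate ?G {g}" using cyc by (elim bexE)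
      show "g [^]\<^bsub>?G\<^esub> (fact d :: nat) = \<one>\<^bsub>?G\<^esub>"
        by (rule G.pow_fact_of_conjugate_card[OF g h card(1)]) (use card(2) in \<open>simp add: d_def\<close>)
    qed
  qed
  then have "F \<subseteq> bounded_degree_compositum C N (fact d)" unfolding FE by blast
  moreover have "1 \<le> (fact d :: nat)" by (rule fact_ge_1)
  ultimately show ?thesis unfolding N_def by blast
qed

end
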